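(* If $M$ is a countable free homogeneous structure in a finite relational language, then $\mathrm{Aut}(\mathrm{Aut}(M))\cong\mathrm{Aut}(\mathcal{E}_M)$, where $\mathcal{E}_M$ is the orbital structure associated with $M$.
   Context: A countable structure $M$ in a relational language is homogeneous if every isomorphism between finite substructures extends to an automorphism of $M$; it is free homogeneous if it is the Fraïssé limit of a class of finite structures with free amalgamation (i.e. for $A$ a common substructure of $B$ and $C$ in the class, with $B\cap C=A$, the structure on $B\cup C$ whose relations are exactly those of $B$ together with those of $C$ is also in the class). $\mathrm{Aut}(\mathrm{Aut}(M))$ is the group of all (abstract) group automorphisms of $\mathrm{Aut}(M)$. The orbital structure $\mathcal{E}_M$ has the same domain as $M$ and, for every $0<n<\omega$, a relation $E_n$ of arity $2n$ such that, for $\bar a,\bar b\in M^n$, $\bar a E_n\bar b$ iff there is an automorphism of $M$ mapping $\bar a$ to $\bar b$. *)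

theory Defs
  imports "HOL-Algebra.Bij" "HOL-Library.Countable_Set"
begin

record 'r language =
  symbols :: "'r set"
  arity :: "'r \<Rightarrow> nat"

record ('r, 'a) rel_structure =
  universe :: "'a set"
  interp :: "'r \<Rightarrow> 'a list set"

text \<open>
  Symbols outside the language are interpreted as empty, so that two structures for the same
  language are equal as records iff they are equal as structures. The empty structure is allowed.
\<close>

definition is_structure :: "'r language \<Rightarrow> ('r, 'a) rel_structure \<Rightarrow> bool" where
  "is_structure L M \<longleftrightarrow>
     (\<forall>R\<in>symbols L. interp M R \<subseteq> {xs. length xs = arity L R \<and> set xs \<subseteq> universe M}) \<and>
     (\<forall>R. R \<notin> symbols L \<longrightarrow> interp M R = {})"

definition induced :: "('r, 'a) rel_structure \<Rightarrow> 'a set \<Rightarrow> ('r, 'a) rel_structure" where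
  "induced M S = \<lparr>universe = S, interp = (\<lambda>R. {xs \<in> interp M R. set xs \<subseteq> S})\<rparr>"

definition is_substructure ::
  "('r, 'a) rel_structure \<Rightarrow> ('r, 'a) rel_structure \<Rightarrow> bool" where
  "is_substructure A B \<longleftrightarrow> universe A \<subseteq> universe B \<and> A = induced B (universe A)"

definition is_isomorphism ::
  "'r language \<Rightarrow> ('r, 'a) rel_structure \<Rightarrow> ('r, 'b) rel_structure \<Rightarrow> ('a \<Rightarrow> 'b) \<Rightarrow> bool" where
  "is_isomorphism L M N f \<longleftrightarrow>
     bij_betw f (universe M) (universe N) \<and>
     (\<forall>R\<in>symbols L. \<forall>xs. length xs = arity L R \<and> set xs \<subseteq> universe M \<longrightarrow>
        (xs \<in> interp M R \<longleftrightarrow> map f xs \<in> interp N R))"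

definition aut_group :: "'r language \<Rightarrow> ('r, 'a) rel_structure \<Rightarrow> ('a \<Rightarrow> 'a) monoid" where
  "aut_group L M = (BijGroup (universe M))\<lparr>carrier := {f \<in> Bij (universe M). is_isomorphism L M M f}\<rparr>"

definition homogeneous :: "'r language \<Rightarrow> ('r, 'a) rel_structure \<Rightarrow> bool" where
  "homogeneous L M \<longleftrightarrow>
     (\<forall>A B f. is_substructure A M \<and> is_substructure B M \<and> finite (universe A) \<and> finite (universe B) \<and>
        is_isomorphism L A B f \<longrightarrow>
        (\<exists>g \<in> carrier (aut_group L M). \<forall>x\<in>universe A. g x = f x))"

text \<open>
  Classes of finite structures are represented by their members with universe a finite subset of
  \<open>nat\<close>; every finite structure has an isomorphic copy of this form.
\<close>

definition age :: "'r language \<Rightarrow> ('r, 'a) rel_structure \<Rightarrow> ('r, nat) rel_structure set" where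
  "age L M = {A. is_structure L A \<and> finite (universe A) \<and>
     (\<exists>B f. is_substructure B M \<and> is_isomorphism L A B f)}"

definition free_amalgam ::
  "('r, 'a) rel_structure \<Rightarrow> ('r, 'a) rel_structure \<Rightarrow> ('r, 'a) rel_structure" where
  "free_amalgam B C = \<lparr>universe = universe B \<union> universe C, interp = (\<lambda>R. interp B R \<union> interp C R)\<rparr>"

definition has_free_amalgamation :: "('r, 'a) rel_structure set \<Rightarrow> bool" where
  "has_free_amalgamation K \<longleftrightarrow>
     (\<forall>A\<in>K. \<forall>B\<in>K. \<forall>C\<in>K.
        is_substructure A B \<and> is_substructure A C \<and> universe B \<inter> universe C = universe A \<longrightarrow>
        free_amalgam B C \<in> K)"

text \<open>
  The Fraisse limit of \<open>K\<close> is the countable homogeneous structure with age \<open>K\<close>. Closure of \<open>K\<close>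
  under isomorphism and substructures and the joint embedding and amalgamation properties all
  follow from the existence of such a structure.
\<close>

definition is_fraisse_limit ::
  "'r language \<Rightarrow> ('r, nat) rel_structure set \<Rightarrow> ('r, 'a) rel_structure \<Rightarrow> bool" where
  "is_fraisse_limit L K M \<longleftrightarrow>
     is_structure L M \<and> countable (universe M) \<and> homogeneous L M \<and> age L M = K"

definition free_homogeneous :: "'r language \<Rightarrow> ('r, 'a) rel_structure \<Rightarrow> bool" where
  "free_homogeneous L M \<longleftrightarrow> (\<exists>K. has_free_amalgamation K \<and> is_fraisse_limit L K M)"

text \<open>The symbol \<open>n > 0\<close> stands for \<open>E\<^sub>n\<close>; a pair of \<open>n\<close>-tuples is encoded by concatenation.\<close>

definition orbital_language :: "nat language" where
  "orbital_language = \<lparr>symbols = {n. 0 < n}, arity = (\<lambda>n. 2 * n)\<rparr>"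

definition orbital_structure ::
  "'r language \<Rightarrow> ('r, 'a) rel_structure \<Rightarrow> (nat, 'a) rel_structure" where
  "orbital_structure L M =
     \<lparr>universe = universe M,
      interp = (\<lambda>n. {as @ bs | as bs. 0 < n \<and> length as = n \<and> length bs = n \<and>
        set as \<subseteq> universe M \<and> set bs \<subseteq> universe M \<and>
        (\<exists>g \<in> carrier (aut_group L M). map g as = bs)})\<rparr>"

lemma is_structure_orbital_structure:
  "is_structure orbital_language (orbital_structure L M)"
  unfolding is_structure_def orbital_language_def orbital_structure_def
  by (simp add: subset_iff) fastforce

lemma group_aut_group: "group (aut_group L M)"
proof -
  let ?B = "BijGroup (universe M)"
  let ?H = "{f \<in> Bij (universe M). is_isomorphism L M M f}"
  have into: "set (map f xs) \<subseteq> universe M" if "f \<in> Bij (universe M)" "set xs \<subseteq> universe M" for f xs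
    using that by (auto simp: Bij_def bij_betw_def)
  have "subgroup ?H ?B"
  proof (rule group.subgroupI[OF group_BijGroup])
    show "?H \<subseteq> carrier ?B" by (auto simp: BijGroup_def)
    have "is_isomorphism L M M (\<lambda>x\<in>universe M. x)"
    proof -
      have "map (\<lambda>x\<in>universe M. x) xs = xs" if "set xs \<subseteq> universe M" for xs
        using that by (auto intro!: map_idI)
      then show ?thesis
        using id_Bij[of "universe M"] by (simp add: is_isomorphism_def Bij_def)
    qed
    then show "?H \<noteq> {}" using id_Bij[of "universe M"] by blast
  next
    fix f assume f: "f \<in> ?H"
    let ?g = "\<lambda>x\<in>universe M. inv_into (universe M) f x"
    have g: "?g \<in> Bij (universe M)" using f by (simp add: restrict_inv_into_Bij)
    have "map f (map ?g xs) = xs" if "set xs \<subseteq> universe M" for xs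
      proof -
      have "f (?g x) = x" if "x \<in> universe M" for x
        using that f by (simp add: Bij_def bij_betw_def f_inv_into_f)
      then show ?thesis using that unfolding map_map by (intro map_idI) (auto simp del: restrict_apply)
    qed
    note fg = this
    have "is_isomorphism L M M ?g"
      unfolding is_isomorphism_def
    proof (intro conjI ballI allI impI)
      show "bij_betw ?g (universe M) (universe M)" using g by (simp add: Bij_def)
    next
      fix R xs assume R: "R \<in> symbols L" and xs: "length xs = arity L R \<and> set xs \<subseteq> universe M"
      then have ys: "length (map ?g xs) = arity L R \<and> set (map ?g xs) \<subseteq> universe M"
        using into[OF g] by simp
      from f have "is_isomorphism L M M f" by simp
      with R ys have "map ?g xs \<in> interp M R \<longleftrightarrow> map f (map ?g xs) \<in> interp M R"
        unfolding is_isomorphism_def by blast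
      with fg xs show "xs \<in> interp M R \<longleftrightarrow> map ?g xs \<in> interp M R" by simp
    qed
    with g f show "inv\<^bsub>?B\<^esub> f \<in> ?H" by (simp add: inv_BijGroup)
  next
    fix f g assume f: "f \<in> ?H" and g: "g \<in> ?H"
    then have fg: "compose (universe M) f g \<in> Bij (universe M)" by (simp add: compose_Bij)
    have "map (compose (universe M) f g) xs = map f (map g xs)" if "set xs \<subseteq> universe M" for xs
      using that by (auto simp: compose_def)
    note comp = this
    have "is_isomorphism L M M (compose (universe M) f g)"
      unfolding is_isomorphism_def
    proof (intro conjI ballI allI impI)
      show "bij_betw (compose (universe M) f g) (universe M) (universe M)"
        using fg by (simp add: Bij_def)
    next
      fix R xs assume R: "R \<in> symbols L" and xs: "length xs = arity L R \<and> set xs \<subseteq> universe M"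
      then have ys: "length (map g xs) = arity L R \<and> set (map g xs) \<subseteq> universe M"
        using into[of g xs] g by simp
      from f have "is_isomorphism L M M f" by simp
      with R ys have "map g xs \<in> interp M R \<longleftrightarrow> map f (map g xs) \<in> interp M R"
        unfolding is_isomorphism_def by blast
      moreover from g have "is_isomorphism L M M g" by simp
      with R xs have "xs \<in> interp M R \<longleftrightarrow> map g xs \<in> interp M R"
        unfolding is_isomorphism_def by blast
      ultimately show "xs \<in> interp M R \<longleftrightarrow> map (compose (universe M) f g) xs \<in> interp M R"
        using comp xs by metis
    qed
    with f g fg show "f \<otimes>\<^bsub>?B\<^esub> g \<in> ?H" by (simp add: BijGroup_def)
  qed
  then show ?thesis
    unfolding aut_group_def by (rule subgroup.subgroup_is_group[OF _ group_BijGroup])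
qed

end

(*
  The group Aut(E_M) is the normaliser of G = Aut(M) in the symmetric group of M, and it acts
  faithfully on G by conjugation because point stabilisers in G fix no further point. What has to be
  shown is that every abstract automorphism alpha of G is induced by a permutation of M.

  For a point a, free amalgamation yields a generic pair c, e of involutions in G whose only fixed
  point is a. Their centralisers lie in the stabiliser G_a, and genericity makes
  W = C(c) C(e) C(c) non-meager, so W^-1 W contains an open subgroup. Being a product of
  centralisers, alpha(W^-1 W) is analytic; countably many of its translates cover G, so it is
  non-meager, has the Baire property, and alpha(G_a) is open. This replaces the small index property
  and needs no extension property for finite partial automorphisms.

  Free amalgamation also gives that G_A and G_B generate G_(A Int B), so every open subgroup K has a
  finite support A with G_A <= K <= G_{A}. Since no proper open subgroup of G_a has finite index,
  alpha(G_a) = G_b for a unique b, and a |-> b is the required permutation.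
*)

theory Submission
  imports Defs
begin

section \<open>Baire category in closed permutation groups\<close>

text \<open>The obstacle is that an abstract automorphism \<alpha> is not known to be continuous, so
  topological facts about G_a cannot be carried over directly. What survives are sets defined by
  group operations alone; centralisers are such sets and are closed at the same time. Three factors
  suffice for the following reason. To write g as z1 z2 z3 on a finite set, the outer factors, which
  commute with c, bring the set and its image under g to positions that e moves freely over a small
  finite part. Commuting with e is no restriction outside this part, so the middle factor can be
  prescribed there. The condition that remains on the small part confines g to a neighbourhood. The
  palindromic shape c, e, c makes W closed under inverses, so that W^-1 W = W W is itself a product
  of centralisers.\<close>

abbreviation pinv :: "(nat \<Rightarrow> nat) \<Rightarrow> nat \<Rightarrow> nat" where
  "pinv \<equiv> inv_into UNIV"

text \<open>Closedness in the product topology with discrete factors; a finite set of coordinates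
  describes a basic neighbourhood.\<close>

definition closed_seqs :: "('i \<Rightarrow> nat) set \<Rightarrow> bool" where
  "closed_seqs Y \<longleftrightarrow> (\<forall>x. (\<forall>F. finite F \<longrightarrow> (\<exists>y\<in>Y. \<forall>i\<in>F. y i = x i)) \<longrightarrow> x \<in> Y)"

lemma closed_seqsD:
  assumes "closed_seqs Y" "\<And>F. finite F \<Longrightarrow> \<exists>y\<in>Y. \<forall>i\<in>F. y i = x i"
  shows "x \<in> Y"
  using assms unfolding closed_seqs_def by blast

text \<open>The Baire category theorem, each \<open>P k\<close> holding on a dense open set. The
  proof builds a point together with a growing finite set of frozen coordinates; stage k freezes
  enough of them to force \<open>P k\<close>.\<close>

lemma closed_seqs_Baire:
  fixes Y :: "('i::countable \<Rightarrow> nat) set"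
  assumes Y: "closed_seqs Y" and y0: "y0 \<in> Y" and F0: "finite F0"
    and dense: "\<And>k y F. y \<in> Y \<Longrightarrow> finite F \<Longrightarrow>
      \<exists>y'\<in>Y. \<exists>F'. finite F' \<and> (\<forall>i\<in>F. y' i = y i) \<and> (\<forall>z\<in>Y. (\<forall>i\<in>F'. z i = y' i) \<longrightarrow> P k z)"
  shows "\<exists>z\<in>Y. (\<forall>i\<in>F0. z i = y0 i) \<and> (\<forall>k::nat. P k z)"
proof -
  define ok where "ok = (\<lambda>p :: ('i \<Rightarrow> nat) \<times> 'i set. fst p \<in> Y \<and> finite (snd p))"
  define step where "step = (\<lambda>k p p'. snd p \<union> {i::'i. to_nat i < k} \<subseteq> snd p' \<and>
    (\<forall>i\<in>snd p. fst p' i = fst p i) \<and> (\<forall>z\<in>Y. (\<forall>i\<in>snd p'. z i = fst p' i) \<longrightarrow> P k z))"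
  have fin: "finite {i::'i. to_nat i < k}" for k
    by (rule finite_imageD[where f = to_nat]) (auto intro: finite_subset[of _ "{..<k}"] inj_onI)
  have "\<exists>s. ok (s 0) \<and> s 0 = (y0, F0) \<and> (\<forall>k. ok (s (Suc k)) \<and> step k (s k) (s (Suc k)))"
  proof -
    have ex: "\<exists>p'. ok p' \<and> step k p p'" if p: "ok p" for k p
    proof -
      obtain y' F' where y': "y' \<in> Y" "finite F'" "\<forall>i\<in>snd p. y' i = fst p i"
        "\<forall>z\<in>Y. (\<forall>i\<in>F'. z i = y' i) \<longrightarrow> P k z"
        using dense[of "fst p" "snd p" k] p unfolding ok_def by blast
      have "ok (y', F' \<union> snd p \<union> {i. to_nat i < k})"
        using y' p fin unfolding ok_def by auto
      moreover have "step k p (y', F' \<union> snd p \<union> {i. to_nat i < k})"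
        using y' unfolding step_def by auto
      ultimately show ?thesis by blast
    qed
    have "ok (y0, F0)" using y0 F0 unfolding ok_def by simp
    then show ?thesis
      using dependent_nat_choice[of "\<lambda>n p. ok p \<and> (n = 0 \<longrightarrow> p = (y0, F0))" step] ex
      by (metis (no_types, lifting) nat.distinct(1))
  qed
  then obtain s where s: "\<And>k. ok (s k)" "s 0 = (y0, F0)" "\<And>k. step k (s k) (s (Suc k))"
    by (metis not0_implies_Suc)
  have mono: "snd (s k) \<subseteq> snd (s m) \<and> (\<forall>i\<in>snd (s k). fst (s m) i = fst (s k) i)" if "k \<le> m" for k m
    using that
  proof (induction m rule: dec_induct)
    case (step m)
    then show ?case using s(3)[of m] unfolding step_def by fastforce
  qed simp
  \<comment> \<open>Stage \<open>Suc k\<close> has frozen all coordinates with code below k. So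
    coordinate i is final for k = to_nat i + 1, that is, at stage
    \<open>Suc (Suc (to_nat i))\<close>.\<close>
  define z where "z i = fst (s (Suc (Suc (to_nat i)))) i" for i
  have in_dom: "i \<in> snd (s (Suc (Suc (to_nat i))))" for i
    using s(3)[of "Suc (to_nat i)"] unfolding step_def by auto
  have z: "z i = fst (s k) i" if "i \<in> snd (s k)" for i k
    using mono[of k "max k (Suc (Suc (to_nat i)))"] mono[of "Suc (Suc (to_nat i))" "max k (Suc (Suc (to_nat i)))"]
      in_dom[of i] that unfolding z_def by (metis max.cobounded1 max.cobounded2)
  have "z \<in> Y"
  proof (rule closed_seqsD[OF Y])
    fix F :: "'i set" assume F: "finite F"
    obtain k where k: "\<forall>i\<in>F. Suc (Suc (to_nat i)) \<le> k"
      using F by (metis finite_nat_set_iff_bounded_le finite_imageI imageI)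
    have "F \<subseteq> snd (s k)" using k in_dom mono by blast
    then show "\<exists>y\<in>Y. \<forall>i\<in>F. y i = z i"
      using z s(1)[of k] unfolding ok_def by (metis subsetD)
  qed
  moreover have "\<forall>i\<in>F0. z i = y0 i" using z[of _ 0] s(2) by simp
  moreover have "P k z" for k
    using s(3)[of k] \<open>z \<in> Y\<close> z[of _ "Suc k"] unfolding step_def by auto
  ultimately show ?thesis by blast
qed

text \<open>A continuous image of a closed subset of Baire space. Continuity is spelled out
  coordinatewise: near y, an initial segment settles the value at p.\<close>

definition analytic :: "(nat \<Rightarrow> nat) set \<Rightarrow> bool" where
  "analytic A \<longleftrightarrow> (\<exists>(Y :: (nat \<Rightarrow> nat) set) \<pi>. closed_seqs Y \<and> A = \<pi> ` Y \<and>
     (\<forall>y\<in>Y. \<forall>p. \<exists>n. \<forall>z\<in>Y. (\<forall>i<n. z i = y i) \<longrightarrow> \<pi> z p = \<pi> y (p::nat)))"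

definition set_prod :: "('a \<Rightarrow> 'a) set \<Rightarrow> ('a \<Rightarrow> 'a) set \<Rightarrow> ('a \<Rightarrow> 'a) set" where
  "set_prod A B = {f \<circ> g | f g. f \<in> A \<and> g \<in> B}"

text \<open>Interleaving codes a pair of sequences by one. Composition is continuous because the
  composite at p depends only on the right factor at p and on the left factor at the single point so
  obtained.\<close>

lemma analytic_set_prod:
  assumes "analytic A" "analytic B"
  shows "analytic (set_prod A B)"
proof -
  obtain Y :: "(nat \<Rightarrow> nat) set" and \<pi> where Y: "closed_seqs Y" "A = \<pi> ` Y"
    "\<And>y p. y \<in> Y \<Longrightarrow> \<exists>n. \<forall>z\<in>Y. (\<forall>i<n. z i = y i) \<longrightarrow> \<pi> z p = \<pi> y (p::nat)"
    using assms(1) unfolding analytic_def by blast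
  obtain Z :: "(nat \<Rightarrow> nat) set" and \<rho> where Z: "closed_seqs Z" "B = \<rho> ` Z"
    "\<And>y p. y \<in> Z \<Longrightarrow> \<exists>n. \<forall>z\<in>Z. (\<forall>i<n. z i = y i) \<longrightarrow> \<rho> z p = \<rho> y (p::nat)"
    using assms(2) unfolding analytic_def by blast
  define ev where "ev = (\<lambda>x::nat\<Rightarrow>nat. \<lambda>i. x (2 * i))"
  define od where "od = (\<lambda>x::nat\<Rightarrow>nat. \<lambda>i. x (2 * i + 1))"
  define X where "X = {x. ev x \<in> Y \<and> od x \<in> Z}"
  define \<sigma> where "\<sigma> = (\<lambda>x. \<pi> (ev x) \<circ> \<rho> (od x))"
  have "closed_seqs X"
    unfolding closed_seqs_def
  proof (intro allI impI)
    fix x assume H: "\<forall>F. finite F \<longrightarrow> (\<exists>y\<in>X. \<forall>i\<in>F. y i = x i)"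
    have "ev x \<in> Y"
    proof (rule closed_seqsD[OF Y(1)])
      fix F :: "nat set" assume "finite F"
      then obtain y where "y \<in> X" "\<forall>i\<in>(\<lambda>i. 2 * i) ` F. y i = x i" using H by blast
      then show "\<exists>y\<in>Y. \<forall>i\<in>F. y i = ev x i" unfolding X_def ev_def by auto
    qed
    moreover have "od x \<in> Z"
    proof (rule closed_seqsD[OF Z(1)])
      fix F :: "nat set" assume "finite F"
      then obtain y where "y \<in> X" "\<forall>i\<in>(\<lambda>i. 2 * i + 1) ` F. y i = x i" using H by blast
      then show "\<exists>y\<in>Z. \<forall>i\<in>F. y i = od x i" unfolding X_def od_def by auto
    qed
    ultimately show "x \<in> X" unfolding X_def by simp
  qed
  moreover have "set_prod A B = \<sigma> ` X"
  proof
    show "set_prod A B \<subseteq> \<sigma> ` X"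
    proof
      fix h assume "h \<in> set_prod A B"
      then obtain y z where h: "y \<in> Y" "z \<in> Z" "h = \<pi> y \<circ> \<rho> z"
        unfolding set_prod_def Y(2) Z(2) by blast
      define x where "x n = (if even n then y (n div 2) else z (n div 2))" for n
      have "ev x = y" "od x = z" unfolding ev_def od_def x_def by auto
      then show "h \<in> \<sigma> ` X" using h unfolding X_def \<sigma>_def by (intro image_eqI[of _ _ x]) auto
    qed
    show "\<sigma> ` X \<subseteq> set_prod A B"
      unfolding set_prod_def Y(2) Z(2) X_def \<sigma>_def by blast
  qed
  moreover have "\<exists>n. \<forall>z\<in>X. (\<forall>i<n. z i = x i) \<longrightarrow> \<sigma> z p = \<sigma> x p" if x: "x \<in> X" for x p
  proof -
    have x': "ev x \<in> Y" "od x \<in> Z" using x unfolding X_def by auto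
    obtain n where n: "\<forall>z\<in>Z. (\<forall>i<n. z i = od x i) \<longrightarrow> \<rho> z p = \<rho> (od x) p" using Z(3)[OF x'(2)] by blast
    obtain m where m: "\<forall>z\<in>Y. (\<forall>i<m. z i = ev x i) \<longrightarrow> \<pi> z (\<rho> (od x) p) = \<pi> (ev x) (\<rho> (od x) p)"
      using Y(3)[OF x'(1)] by blast
    have "\<sigma> z p = \<sigma> x p" if z: "z \<in> X" "\<forall>i<2 * n + 2 * m. z i = x i" for z
    proof -
      have "\<forall>i<n. od z i = od x i" "\<forall>i<m. ev z i = ev x i" using z(2) unfolding od_def ev_def by auto
      moreover have "ev z \<in> Y" "od z \<in> Z" using z(1) unfolding X_def by auto
      ultimately show ?thesis using n m unfolding \<sigma>_def by simp
    qed
    then show ?thesis by blast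
  qed
  ultimately show ?thesis unfolding analytic_def by blast
qed

section \<open>Topology of a closed permutation group\<close>

locale perm_group =
  fixes G :: "(nat \<Rightarrow> nat) set"
  assumes bij: "g \<in> G \<Longrightarrow> bij g"
    and id_mem: "id \<in> G"
    and comp_mem: "g \<in> G \<Longrightarrow> h \<in> G \<Longrightarrow> g \<circ> h \<in> G"
    and pinv_mem: "g \<in> G \<Longrightarrow> pinv g \<in> G"
    and closed: "bij f \<Longrightarrow> (\<And>S. finite S \<Longrightarrow> \<exists>g\<in>G. \<forall>x\<in>S. g x = f x) \<Longrightarrow> f \<in> G"
begin

lemma pinv_left [simp]: "g \<in> G \<Longrightarrow> pinv g (g x) = x"
  using bij by (simp add: bij_is_inj)

lemma pinv_right [simp]: "g \<in> G \<Longrightarrow> g (pinv g x) = x"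
  using bij by (simp add: bij_is_surj surj_f_inv_f)

lemma inj_mem: "g \<in> G \<Longrightarrow> g x = g y \<longleftrightarrow> x = y"
  using pinv_left by metis

lemma pinv_eq: "g \<in> G \<Longrightarrow> g x = y \<Longrightarrow> pinv g y = x"
  by auto

lemma pinv_comp: "g \<in> G \<Longrightarrow> h \<in> G \<Longrightarrow> pinv (g \<circ> h) x = pinv h (pinv g x)"
  by (rule pinv_eq) (simp_all add: comp_mem)

lemma pinv_pinv: "g \<in> G \<Longrightarrow> pinv (pinv g) = g"
  by (simp add: bij inv_inv_eq)

lemma comp_pinv: "g \<in> G \<Longrightarrow> pinv g \<circ> g = id" "g \<in> G \<Longrightarrow> g \<circ> pinv g = id"
  by auto

text \<open>Inverses are controlled along with values, since a pointwise limit of permutations need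
  not be surjective. The topology on \<open>G\<close> is the usual one, but limits built from these
  neighbourhoods stay inside \<open>G\<close>.\<close>

definition nbhd :: "(nat \<Rightarrow> nat) \<Rightarrow> nat set \<Rightarrow> (nat \<Rightarrow> nat) set" where
  "nbhd g S = {h \<in> G. \<forall>x\<in>S. h x = g x \<and> pinv h x = pinv g x}"

lemma nbhd_refl: "g \<in> G \<Longrightarrow> g \<in> nbhd g S" by (simp add: nbhd_def)

lemma nbhd_mono: "h \<in> nbhd g S \<Longrightarrow> S \<subseteq> T \<Longrightarrow> nbhd h T \<subseteq> nbhd g S"
  unfolding nbhd_def by fastforce

lemma nbhd_mem: "h \<in> nbhd g S \<Longrightarrow> h \<in> G" by (simp add: nbhd_def)

lemma countable_nbhds: "countable {nbhd g S | g S. g \<in> G \<and> finite S}"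
proof -
  have "{nbhd g S | g S. g \<in> G \<and> finite S} \<subseteq>
    (\<lambda>F. {h \<in> G. \<forall>(x, y, z)\<in>F. h x = y \<and> pinv h x = z}) ` {F :: (nat \<times> nat \<times> nat) set. finite F}"
  proof
    fix N assume "N \<in> {nbhd g S | g S. g \<in> G \<and> finite S}"
    then obtain g S where N: "N = nbhd g S" "finite S" by blast
    show "N \<in> (\<lambda>F. {h \<in> G. \<forall>(x, y, z)\<in>F. h x = y \<and> pinv h x = z}) ` {F. finite F}"
      using N by (intro image_eqI[of _ _ "(\<lambda>x. (x, g x, pinv g x)) ` S"]) (auto simp: nbhd_def)
  qed
  moreover have "countable {F :: (nat \<times> nat \<times> nat) set. finite F}"
    by (simp add: countable_Collect_finite)
  ultimately show ?thesis by (rule countable_subset[OF _ countable_image])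
qed

definition nowhere_dense :: "(nat \<Rightarrow> nat) set \<Rightarrow> bool" where
  "nowhere_dense N \<longleftrightarrow> (\<forall>g\<in>G. \<forall>S. finite S \<longrightarrow>
     (\<exists>h\<in>nbhd g S. \<exists>T. finite T \<and> nbhd h T \<inter> N = {}))"

definition meager :: "(nat \<Rightarrow> nat) set \<Rightarrow> bool" where
  "meager A \<longleftrightarrow> (\<exists>F. countable F \<and> (\<forall>N\<in>F. nowhere_dense N) \<and> A \<subseteq> \<Union>F)"

lemma meager_subset: "meager B \<Longrightarrow> A \<subseteq> B \<Longrightarrow> meager A"
  unfolding meager_def by (meson order_trans)

lemma nowhere_dense_meager: "nowhere_dense N \<Longrightarrow> meager N"
  unfolding meager_def by (intro exI[of _ "{N}"]) auto

lemma meager_UN: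
  assumes "countable I" "\<And>i. i \<in> I \<Longrightarrow> meager (A i)"
  shows "meager (\<Union>i\<in>I. A i)"
proof -
  obtain F where F: "\<And>i. i \<in> I \<Longrightarrow> countable (F i) \<and> (\<forall>N\<in>F i. nowhere_dense N) \<and> A i \<subseteq> \<Union>(F i)"
    using assms(2) unfolding meager_def by metis
  then have "countable (\<Union>i\<in>I. F i)" using assms(1) by blast
  moreover have "\<forall>N\<in>\<Union>i\<in>I. F i. nowhere_dense N" using F by blast
  moreover have "(\<Union>i\<in>I. A i) \<subseteq> \<Union>(\<Union>i\<in>I. F i)"
    using F by (intro UN_least) (meson UN_upper Union_mono order_trans)
  ultimately show ?thesis unfolding meager_def by (intro exI conjI)
qed

lemma meager_Un: "meager A \<Longrightarrow> meager B \<Longrightarrow> meager (A \<union> B)"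
  using meager_UN[of "{A, B}" id] by auto

lemma meager_sequence:
  assumes "meager A"
  shows "\<exists>N. (\<forall>k::nat. nowhere_dense (N k)) \<and> A \<subseteq> (\<Union>k. N k)"
proof -
  obtain F where F: "countable F" "\<forall>N\<in>F. nowhere_dense N" "A \<subseteq> \<Union>F"
    using assms unfolding meager_def by auto
  have e: "nowhere_dense {}" unfolding nowhere_dense_def by (metis Int_empty_right finite.emptyI nbhd_refl)
  define N where "N = from_nat_into (insert {} F)"
  have "range N = insert {} F" using F(1) unfolding N_def by (intro range_from_nat_into) auto
  moreover from this have "N k \<in> insert {} F" for k by blast
  then have "nowhere_dense (N k)" for k using F(2) e by (metis insertE)
  moreover have "A \<subseteq> \<Union>(range N)" using F(3) calculation(1) by simp
  ultimately show ?thesis by (intro exI[of _ N]) simp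
qed

text \<open>A permutation is stored with its inverse, because the codes then form a closed set of
  sequences, although \<open>G\<close> itself need not be closed among all functions.\<close>

definition perm_code :: "(nat \<Rightarrow> nat) \<Rightarrow> bool \<times> nat \<Rightarrow> nat" where
  "perm_code g p = (if fst p then g (snd p) else pinv g (snd p))"

definition closed_in_G :: "(nat \<Rightarrow> nat) set \<Rightarrow> bool" where
  "closed_in_G X \<longleftrightarrow> X \<subseteq> G \<and> (\<forall>f\<in>G. (\<forall>S. finite S \<longrightarrow> (\<exists>g\<in>X. \<forall>x\<in>S. g x = f x)) \<longrightarrow> f \<in> X)"

lemma closed_in_G_self: "closed_in_G G" by (simp add: closed_in_G_def)

text \<open>The limits u and v of the permutations and of their inverses are mutually inverse: each
  instance of this involves only two points and so is read off from an approximant. Hence u is a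
  bijection and the closedness of \<open>G\<close> applies.\<close>

lemma limit_mem:
  assumes X: "closed_in_G X"
    and lim: "\<And>F. finite F \<Longrightarrow> \<exists>g\<in>X. \<forall>x\<in>F. g x = u x \<and> pinv g x = v x"
  shows "u \<in> X" "pinv u = v"
proof -
  have XG: "X \<subseteq> G" using X by (simp add: closed_in_G_def)
  have "v (u x) = x" for x
  proof -
    obtain g where "g \<in> X" "\<forall>y\<in>{x, u x}. g y = u y \<and> pinv g y = v y" using lim[of "{x, u x}"] by auto
    then show ?thesis using XG by (metis insertI1 insert_commute pinv_left subsetD)
  qed
  moreover have "u (v x) = x" for x
  proof -
    obtain g where "g \<in> X" "\<forall>y\<in>{x, v x}. g y = u y \<and> pinv g y = v y" using lim[of "{x, v x}"] by auto
    then show ?thesis using XG by (metis insertI1 insert_commute pinv_right subsetD)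
  qed
  ultimately have bu: "bij u" "pinv u = v"
    by (auto intro!: o_bij[of v] inv_equality)
  have "u \<in> G" by (rule closed[OF bu(1)]) (meson lim XG subsetD)
  then show "u \<in> X" using X lim unfolding closed_in_G_def by meson
  show "pinv u = v" by fact
qed

text \<open>\<open>X\<close> is the projection to the even entries of the closed set of sequences
  that interleave a permutation with its inverse.\<close>

lemma analytic_closed:
  assumes X: "closed_in_G X"
  shows "analytic X"
proof -
  define cd where "cd = (\<lambda>g n. if even n then g (n div 2) else pinv g (n div 2))"
  define \<pi> :: "(nat \<Rightarrow> nat) \<Rightarrow> nat \<Rightarrow> nat" where "\<pi> = (\<lambda>z i. z (2 * i))"
  have "closed_seqs (cd ` X)"
    unfolding closed_seqs_def
  proof (intro allI impI)
    fix x assume H: "\<forall>F. finite F \<longrightarrow> (\<exists>y\<in>cd ` X. \<forall>i\<in>F. y i = x i)"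
    define u where "u i = x (2 * i)" for i
    define v where "v i = x (2 * i + 1)" for i
    have "\<exists>g\<in>X. \<forall>i\<in>F. g i = u i \<and> pinv g i = v i" if "finite F" for F
    proof -
      have "finite ((\<lambda>i. 2 * i) ` F \<union> (\<lambda>i. 2 * i + 1) ` F)" using that by simp
      then obtain g where "g \<in> X" "\<forall>i\<in>(\<lambda>i. 2 * i) ` F \<union> (\<lambda>i. 2 * i + 1) ` F. cd g i = x i"
        using H by blast
      then have "\<forall>i\<in>F. g i = u i \<and> pinv g i = v i"
        unfolding cd_def u_def v_def by (simp add: ball_Un)
      then show ?thesis using \<open>g \<in> X\<close> by blast
    qed
    then have "u \<in> X" "pinv u = v" using limit_mem[OF X] by blast+
    moreover have "cd u n = x n" for n
      using \<open>pinv u = v\<close> unfolding cd_def u_def v_def by auto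
    ultimately show "x \<in> cd ` X" by (metis ext image_eqI)
  qed
  moreover have "X = \<pi> ` cd ` X"
    unfolding \<pi>_def cd_def image_image by simp
  moreover have "\<forall>y\<in>cd ` X. \<forall>p. \<exists>n. \<forall>z\<in>cd ` X. (\<forall>i<n. z i = y i) \<longrightarrow> \<pi> z p = \<pi> y p"
    unfolding \<pi>_def by (metis lessI)
  ultimately show ?thesis unfolding analytic_def by blast
qed

text \<open>Serves twice: with a one-element index type for \<open>G\<close> itself, and with index
  type \<open>nat\<close> for tuples of centraliser elements.\<close>

lemma closed_seqs_family:
  assumes X: "\<And>i. closed_in_G (X i)"
  shows "closed_seqs ((\<lambda>z (i::'k, p). perm_code (z i) p) ` {z. \<forall>i. z i \<in> X i})"
  unfolding closed_seqs_def
proof (intro allI impI)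
  fix x :: "'k \<times> bool \<times> nat \<Rightarrow> nat"
  let ?Y = "(\<lambda>z (i, p). perm_code (z i) p) ` {z. \<forall>i. z i \<in> X i}"
  assume H: "\<forall>F. finite F \<longrightarrow> (\<exists>y\<in>?Y. \<forall>i\<in>F. y i = x i)"
  define u where "u i j = x (i, True, j)" for i j
  define v where "v i j = x (i, False, j)" for i j
  have "\<exists>g\<in>X i. \<forall>j\<in>F. g j = u i j \<and> pinv g j = v i j" if "finite F" for F i
  proof -
    have "finite ((\<lambda>j. (i, True, j)) ` F \<union> (\<lambda>j. (i, False, j)) ` F)" using that by simp
    then obtain z where "\<forall>i. z i \<in> X i"
      "\<forall>q\<in>(\<lambda>j. (i, True, j)) ` F \<union> (\<lambda>j. (i, False, j)) ` F. (\<lambda>(i, p). perm_code (z i) p) q = x q"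
      using H by blast
    then have "z i \<in> X i" "\<forall>j\<in>F. z i j = u i j \<and> pinv (z i) j = v i j"
      unfolding u_def v_def perm_code_def by (simp_all add: ball_Un)
    then show ?thesis by blast
  qed
  note approx = this
  have uv: "u i \<in> X i" "pinv (u i) = v i" for i by (rule limit_mem[OF X approx]; assumption)+
  have "x = (\<lambda>(i, p). perm_code (u i) p)"
  proof
    fix q :: "'k \<times> bool \<times> nat"
    obtain i b j where "q = (i, b, j)" by (cases q) auto
    then show "x q = (\<lambda>(i, p). perm_code (u i) p) q"
      using uv(2)[of i] by (cases b) (auto simp: perm_code_def u_def v_def)
  qed
  then show "x \<in> ?Y" using uv(1) by (intro image_eqI[of _ _ u]) auto
qed

text \<open>Nowhere density in \<open>G\<close> becomes the density hypothesis of
  \<open>closed_seqs_Baire\<close> for codes; the index type \<open>unit\<close> stands for a single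
  permutation.\<close>

lemma baire_nbhd:
  assumes "meager A" "g \<in> G" "finite S"
  shows "\<exists>h\<in>nbhd g S. h \<notin> A"
proof -
  obtain N where N: "\<And>k::nat. nowhere_dense (N k)" and AN: "A \<subseteq> (\<Union>k. N k)"
    using meager_sequence[OF assms(1)] by metis
  define Y where "Y = (\<lambda>z (i::unit, p). perm_code (z i) p) ` {z. \<forall>i. z i \<in> G}"
  define dc where "dc = (\<lambda>y::unit \<times> bool \<times> nat \<Rightarrow> nat. \<lambda>j. y ((), True, j))"
  have Y: "closed_seqs Y" unfolding Y_def by (rule closed_seqs_family) (rule closed_in_G_self)
  have cdY: "(\<lambda>(i, p). perm_code h p) \<in> Y" if "h \<in> G" for h
    unfolding Y_def using that by (intro image_eqI[of _ _ "\<lambda>i. h"]) auto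
  have dcY: "y = (\<lambda>(i, p). perm_code (dc y) p)" "dc y \<in> G" if "y \<in> Y" for y
    using that unfolding Y_def dc_def perm_code_def by (auto simp: fun_eq_iff)
  have "\<exists>z\<in>Y. (\<forall>i\<in>{()} \<times> UNIV \<times> S. z i = (\<lambda>(i, p). perm_code g p) i) \<and> (\<forall>k. dc z \<notin> N k)"
  proof (rule closed_seqs_Baire[OF Y])
    show "(\<lambda>(i, p). perm_code g p) \<in> Y" by (rule cdY) fact
    show "finite ({()} \<times> (UNIV::bool set) \<times> S)" using assms(3) by simp
    fix k y and E :: "(unit \<times> bool \<times> nat) set" assume y: "y \<in> Y" and E: "finite E"
    obtain h T where h: "h \<in> nbhd (dc y) ((snd \<circ> snd) ` E)" "finite T" "nbhd h T \<inter> N k = {}"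
      using N[of k] dcY[OF y] E unfolding nowhere_dense_def by (metis finite_imageI)
    have "\<forall>i\<in>E. (\<lambda>(i, p). perm_code h p) i = y i"
    proof
      fix i assume i: "i \<in> E"
      obtain b j where i': "i = ((), b, j)" by (cases i) auto
      then have "j \<in> (snd \<circ> snd) ` E" using i by force
      then have "h j = dc y j" "pinv h j = pinv (dc y) j" using h(1) unfolding nbhd_def by auto
      then show "(\<lambda>(i, p). perm_code h p) i = y i" using fun_cong[OF dcY(1)[OF y], of i] i' by (simp add: perm_code_def)
    qed
    moreover have "dc z \<notin> N k" if z: "z \<in> Y" "\<forall>i\<in>{()} \<times> UNIV \<times> T. z i = (\<lambda>(i, p). perm_code h p) i" for z
    proof -
      have "perm_code (dc z) (b, x) = perm_code h (b, x)" if "x \<in> T" for x b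
        using z(2) that fun_cong[OF dcY(1)[OF z(1)], of "((), b, x)"] by simp
      from this[of _ True] this[of _ False]
      have "dc z x = h x" "pinv (dc z) x = pinv h x" if "x \<in> T" for x
        using that by (simp_all add: perm_code_def)
      then have "dc z \<in> nbhd h T" using dcY(2)[OF z(1)] unfolding nbhd_def by auto
      then show ?thesis using h(3) by blast
    qed
    ultimately show "\<exists>y'\<in>Y. \<exists>F'. finite F' \<and> (\<forall>i\<in>E. y' i = y i) \<and>
        (\<forall>z\<in>Y. (\<forall>i\<in>F'. z i = y' i) \<longrightarrow> dc z \<notin> N k)"
      using cdY[OF nbhd_mem[OF h(1)]] h(2)
      by (intro bexI[of _ "\<lambda>(i, p). perm_code h p"] exI[of _ "{()} \<times> UNIV \<times> T"] conjI) auto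
  qed
  then obtain z where z: "z \<in> Y" "\<forall>i\<in>{()} \<times> UNIV \<times> S. z i = (\<lambda>(i, p). perm_code g p) i" "\<forall>k. dc z \<notin> N k"
    by blast
  have "perm_code (dc z) (b, x) = perm_code g (b, x)" if "x \<in> S" for x b
    using z(2) that fun_cong[OF dcY(1)[OF z(1)], of "((), b, x)"] by simp
  from this[of _ True] this[of _ False]
  have "dc z x = g x \<and> pinv (dc z) x = pinv g x" if "x \<in> S" for x
    using that by (simp add: perm_code_def)
  then have "dc z \<in> nbhd g S" using dcY(2)[OF z(1)] unfolding nbhd_def by auto
  then show ?thesis using z(3) AN by blast
qed

text \<open>Otherwise the basic sets on which A is meager are dense in \<open>nbhd g S\<close>.
  There are only countably many basic sets, so A is meager on their union, and what is left of
  \<open>nbhd g S\<close> is nowhere dense.\<close>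

lemma locally_nonmeager:
  assumes nm: "\<not> meager (A \<inter> nbhd g S)" and g: "g \<in> G" and S: "finite S"
  shows "\<exists>h\<in>nbhd g S. \<exists>T. finite T \<and> S \<subseteq> T \<and>
    (\<forall>k\<in>nbhd h T. \<forall>T'. finite T' \<longrightarrow> \<not> meager (A \<inter> nbhd k T'))"
proof (rule ccontr)
  assume contra: "\<not> ?thesis"
  define B where "B = {N \<in> {nbhd k T | k T. k \<in> G \<and> finite T}. meager (A \<inter> N)}"
  have B: "countable B" unfolding B_def by (rule countable_subset[OF _ countable_nbhds]) auto
  have "nowhere_dense (nbhd g S - \<Union>B)"
    unfolding nowhere_dense_def
  proof (intro ballI allI impI)
    fix g' S' assume g': "g' \<in> G" and S': "finite (S' :: nat set)"
    show "\<exists>h\<in>nbhd g' S'. \<exists>T. finite T \<and> nbhd h T \<inter> (nbhd g S - \<Union>B) = {}"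
    proof (cases "nbhd g' S' \<inter> nbhd g S = {}")
      case True
      then show ?thesis using S' nbhd_refl[OF g', of S'] by (intro bexI[of _ g'] exI[of _ S']) auto
    next
      case False
      then obtain h where h: "h \<in> nbhd g' S'" "h \<in> nbhd g S" by auto
      have "finite (S \<union> S')" using S S' by simp
      then obtain k T where k: "k \<in> nbhd h (S \<union> S')" "finite T" "meager (A \<inter> nbhd k T)"
        using contra h(2) by (metis Un_upper1)
      have "nbhd k T \<in> B" using k nbhd_mem[OF k(1)] unfolding B_def by blast
      moreover have "k \<in> nbhd g' S'" using k(1) nbhd_mono[OF h(1), of "S \<union> S'"] by auto
      ultimately show ?thesis using k(2) by (intro bexI[of _ k] exI[of _ T]) auto
    qed
  qed
  moreover have "meager (\<Union>b\<in>B. A \<inter> b)" by (rule meager_UN[OF B]) (simp add: B_def)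
  ultimately have "meager ((nbhd g S - \<Union>B) \<union> (\<Union>b\<in>B. A \<inter> b))"
    by (rule meager_Un[OF nowhere_dense_meager])
  then have "meager (A \<inter> nbhd g S)" by (rule meager_subset) auto
  then show False using nm by simp
qed

text \<open>
  The Souslin scheme argument: \<open>W s\<close> is the image of the basic closed set given by the initial segment
  \<open>s\<close>, and \<open>E s\<close> is the open set of points at which \<open>W s\<close> is everywhere non-meager. Outside the meager
  set of points leaving the scheme \<open>E\<close>, a point of \<open>E []\<close> determines a branch, and it is the image of
  that branch.
\<close>

lemma analytic_nonmeager:
  assumes an: "analytic A" and AG: "A \<subseteq> G" and nm: "\<not> meager A"
  shows "\<exists>g\<in>G. \<exists>S. finite S \<and> meager (nbhd g S - A)"
proof -
  obtain Y :: "(nat \<Rightarrow> nat) set" and \<pi> where Y: "closed_seqs Y" "A = \<pi> ` Y"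
    and cont: "\<And>y p. y \<in> Y \<Longrightarrow> \<exists>n. \<forall>z\<in>Y. (\<forall>i<n. z i = y i) \<longrightarrow> \<pi> z p = \<pi> y (p::nat)"
    using an unfolding analytic_def by blast
  define W where "W s = \<pi> ` {y \<in> Y. \<forall>i<length s. y i = s ! i}" for s
  define big where "big s g S \<longleftrightarrow> g \<in> G \<and> finite S \<and>
    (\<forall>k\<in>nbhd g S. \<forall>T. finite T \<longrightarrow> \<not> meager (W s \<inter> nbhd k T))" for s g S
  define E where "E s = {x. \<exists>g S. big s g S \<and> x \<in> nbhd g S}" for s
  have split: "W s = (\<Union>j. W (s @ [j]))" for s
    unfolding W_def by (auto simp: nth_append less_Suc_eq image_iff)
  \<comment> \<open>Where \<open>W s\<close> is everywhere non-meager, countability makes one of its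
    pieces \<open>W (s @ [j])\<close> non-meager in any given small neighbourhood and, after
    shrinking, everywhere non-meager.\<close>
  have nwd: "nowhere_dense (E s - (\<Union>j. E (s @ [j])))" for s
    unfolding nowhere_dense_def
  proof (intro ballI allI impI)
    fix g S assume g: "g \<in> G" and S: "finite (S :: nat set)"
    show "\<exists>h\<in>nbhd g S. \<exists>T. finite T \<and> nbhd h T \<inter> (E s - (\<Union>j. E (s @ [j]))) = {}"
    proof (cases "nbhd g S \<inter> E s = {}")
      case True
      then show ?thesis using S nbhd_refl[OF g, of S] by (intro bexI[of _ g] exI[of _ S]) auto
    next
      case False
      then obtain h g' S' where h: "h \<in> nbhd g S" "big s g' S'" "h \<in> nbhd g' S'"
        unfolding E_def by auto
      then have hG: "h \<in> G" and S': "finite S'" using nbhd_mem unfolding big_def by auto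
      have fin: "finite (S \<union> S')" using S S' by simp
      have "\<not> meager (W s \<inter> nbhd h (S \<union> S'))" using h(2,3) fin unfolding big_def by blast
      moreover have "W s \<inter> nbhd h (S \<union> S') = (\<Union>j. W (s @ [j]) \<inter> nbhd h (S \<union> S'))"
        by (subst split) auto
      ultimately obtain j where "\<not> meager (W (s @ [j]) \<inter> nbhd h (S \<union> S'))"
        using meager_UN[of UNIV "\<lambda>j. W (s @ [j]) \<inter> nbhd h (S \<union> S')"] by auto
      from locally_nonmeager[OF this hG fin] obtain k T where
        k: "k \<in> nbhd h (S \<union> S')" "finite T"
          "\<forall>k'\<in>nbhd k T. \<forall>T'. finite T' \<longrightarrow> \<not> meager (W (s @ [j]) \<inter> nbhd k' T')"
        by blast
      then have "big (s @ [j]) k T" using nbhd_mem unfolding big_def by blast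
      then have "nbhd k T \<subseteq> E (s @ [j])" unfolding E_def by auto
      moreover have "k \<in> nbhd g S" using k(1) nbhd_mono[OF h(1), of "S \<union> S'"] by auto
      ultimately show ?thesis using k(2) by (intro bexI[of _ k] exI[of _ T]) auto
    qed
  qed
  have "W [] \<inter> nbhd id {} = A" using AG Y(2) unfolding W_def nbhd_def by auto
  then have "\<not> meager (W [] \<inter> nbhd id {})" using nm by simp
  from locally_nonmeager[OF this id_mem] obtain g S where "g \<in> nbhd id {}" "finite S"
    "\<forall>k\<in>nbhd g S. \<forall>T. finite T \<longrightarrow> \<not> meager (W [] \<inter> nbhd k T)" by auto
  then have gS: "big [] g S" unfolding big_def by (simp add: nbhd_mem)
  have "nbhd g S - A \<subseteq> (\<Union>s. E s - (\<Union>j. E (s @ [j])))"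
  proof (rule subsetI, rule ccontr)
    fix x assume "x \<in> nbhd g S - A" and x': "x \<notin> (\<Union>s. E s - (\<Union>j. E (s @ [j])))"
    then have x: "x \<in> nbhd g S" "x \<notin> A" "\<And>s. x \<in> E s \<Longrightarrow> \<exists>j. x \<in> E (s @ [j])"
      by simp_all
    have xG: "x \<in> G" using x(1) by (rule nbhd_mem)
    define f where "f = rec_nat [] (\<lambda>_ s. s @ [SOME j. x \<in> E (s @ [j])])"
    have f: "f 0 = []" "f (Suc n) = f n @ [SOME j. x \<in> E (f n @ [j])]" for n
      unfolding f_def by simp_all
    have fE: "x \<in> E (f n)" for n
    proof (induction n)
      case 0
      then show ?case using gS x(1) f(1) unfolding E_def by auto
    next
      case (Suc n)
      then show ?case using x(3) someI_ex[of "\<lambda>j. x \<in> E (f n @ [j])"] f(2) by simp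
    qed
    have len: "length (f n) = n" for n by (induction n) (simp_all add: f)
    define z where "z i = f (Suc i) ! i" for i
    have fz: "f n ! i = z i" if "i < n" for i n
      using that
    proof (induction n)
      case (Suc n)
      then show ?case unfolding z_def by (cases "i = n") (auto simp: f nth_append len)
    qed simp
    \<comment> \<open>A non-meager set is non-empty, so every neighbourhood of x meets
      \<open>W (f n)\<close>. This yields elements of Y that follow the branch z while their images
      tend to x.\<close>
    have app: "\<exists>y\<in>Y. (\<forall>i<n. y i = z i) \<and> \<pi> y \<in> nbhd x T" if T: "finite T" for n T
    proof -
      obtain g' S' where "big (f n) g' S'" "x \<in> nbhd g' S'" using fE[of n] unfolding E_def by auto
      then have "\<not> meager (W (f n) \<inter> nbhd x T)" using T unfolding big_def by blast
      then have "W (f n) \<inter> nbhd x T \<noteq> {}" by (metis UN_empty countable_empty empty_iff meager_UN)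
      then show ?thesis unfolding W_def len using fz by auto
    qed
    have "z \<in> Y"
    proof (rule closed_seqsD[OF Y(1)])
      fix F :: "nat set" assume "finite F"
      then obtain n where "\<forall>i\<in>F. i < n" using finite_nat_set_iff_bounded by auto
      then show "\<exists>y\<in>Y. \<forall>i\<in>F. y i = z i" using app[of "{}" n] by auto
    qed
    moreover have "\<pi> z p = x p" for p
    proof -
      obtain n where n: "\<forall>y\<in>Y. (\<forall>i<n. y i = z i) \<longrightarrow> \<pi> y p = \<pi> z p" using cont[OF \<open>z \<in> Y\<close>] by metis
      obtain y where "y \<in> Y" "\<forall>i<n. y i = z i" "\<pi> y \<in> nbhd x {p}" using app[of "{p}" n] by auto
      then show ?thesis using n unfolding nbhd_def by auto
    qed
    ultimately have "x \<in> A" using Y(2) by (metis ext image_eqI)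
    then show False using x(2) by simp
  qed
  moreover have "meager (\<Union>s. E s - (\<Union>j. E (s @ [j])))"
    by (intro meager_UN nowhere_dense_meager nwd) simp
  ultimately have "meager (nbhd g S - A)" by (rule meager_subset[rotated])
  then show ?thesis using gS unfolding big_def by blast
qed

section \<open>Translates and the lemma of Pettis\<close>

lemma nowhere_dense_translate:
  assumes N: "nowhere_dense N" and x: "x \<in> G"
  shows "nowhere_dense ((\<lambda>n. n \<circ> x) ` N)"
  unfolding nowhere_dense_def
proof (intro ballI allI impI)
  fix g S assume g: "g \<in> G" and S: "finite (S :: nat set)"
  have gx: "g \<circ> pinv x \<in> G" using g x by (simp add: comp_mem pinv_mem)
  \<comment> \<open>The image of S under x controls the values of h \<circ> x on S, while S itself
    controls its inverse there.\<close>
  obtain h T where h: "h \<in> nbhd (g \<circ> pinv x) (S \<union> x ` S)" "finite T" "nbhd h T \<inter> N = {}"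
    using N gx S unfolding nowhere_dense_def by (metis finite_UnI finite_imageI)
  have hG: "h \<in> G" using h(1) by (rule nbhd_mem)
  have "h \<circ> x \<in> nbhd g S"
    using h(1) g x hG unfolding nbhd_def
    by (auto simp: comp_mem pinv_comp pinv_mem pinv_pinv)
  moreover have "nbhd (h \<circ> x) (T \<union> pinv x ` T) \<inter> (\<lambda>n. n \<circ> x) ` N = {}"
  proof (rule ccontr)
    assume "\<not> ?thesis"
    then obtain n where n: "n \<in> N" "n \<circ> x \<in> nbhd (h \<circ> x) (T \<union> pinv x ` T)" by blast
    have "n = (n \<circ> x) \<circ> pinv x" using x by auto
    then have nG: "n \<in> G" using comp_mem[OF nbhd_mem[OF n(2)] pinv_mem[OF x]] by simp
    have "n j = h j \<and> pinv n j = pinv h j" if j: "j \<in> T" for j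
    proof
      have "(n \<circ> x) (pinv x j) = (h \<circ> x) (pinv x j)" using n(2) j unfolding nbhd_def by blast
      then show "n j = h j" using x by simp
      have "pinv x (pinv n j) = pinv x (pinv h j)"
        using n(2) j x nG hG unfolding nbhd_def by (auto simp: pinv_comp)
      then show "pinv n j = pinv h j" using x by (metis pinv_right)
    qed
    then show False using h(3) n(1) nG unfolding nbhd_def by blast
  qed
  ultimately show "\<exists>h\<in>nbhd g S. \<exists>T. finite T \<and> nbhd h T \<inter> (\<lambda>n. n \<circ> x) ` N = {}"
    using h(2) by (intro bexI[of _ "h \<circ> x"] exI[of _ "T \<union> pinv x ` T"]) auto
qed

lemma meager_translate:
  assumes "meager A" "x \<in> G"
  shows "meager ((\<lambda>n. n \<circ> x) ` A)"
proof -
  obtain F where F: "countable F" "\<forall>N\<in>F. nowhere_dense N" "A \<subseteq> \<Union>F"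
    using assms(1) unfolding meager_def by blast
  have "(\<lambda>n. n \<circ> x) ` A \<subseteq> (\<Union>N\<in>F. (\<lambda>n. n \<circ> x) ` N)" using F(3) by blast
  moreover have "meager (\<Union>N\<in>F. (\<lambda>n. n \<circ> x) ` N)"
    using F assms(2) by (intro meager_UN nowhere_dense_meager nowhere_dense_translate) auto
  ultimately show ?thesis by (rule meager_subset[rotated])
qed

text \<open>By \<open>analytic_nonmeager\<close>, A is comeager in some \<open>nbhd g S\<close>. If
  x fixes S and its preimage under g pointwise, right translation by x preserves this neighbourhood,
  so A meets its translate there: some w in A has w \<circ> pinv x in A, and x is the quotient of
  the two.\<close>

lemma Pettis:
  assumes an: "analytic A" and AG: "A \<subseteq> G" and nm: "\<not> meager A"
  shows "\<exists>T. finite T \<and> (\<forall>x\<in>G. (\<forall>j\<in>T. x j = j) \<longrightarrow> (\<exists>u\<in>A. \<exists>v\<in>A. x = pinv u \<circ> v))"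
proof -
  obtain g S where g: "g \<in> G" and S: "finite S" and m: "meager (nbhd g S - A)"
    using analytic_nonmeager[OF assms] by blast
  have "\<exists>u\<in>A. \<exists>v\<in>A. x = pinv u \<circ> v" if x: "x \<in> G" and fx: "\<And>j. j \<in> S \<union> pinv g ` S \<Longrightarrow> x j = j" for x
  proof -
    have "meager ((nbhd g S - A) \<union> (\<lambda>n. n \<circ> x) ` (nbhd g S - A))"
      by (intro meager_Un meager_translate m x)
    then obtain w where w: "w \<in> nbhd g S" "w \<in> A" "w \<notin> (\<lambda>n. n \<circ> x) ` (nbhd g S - A)"
      using baire_nbhd[OF _ g S] by blast
    have wG: "w \<in> G" using w(1) by (rule nbhd_mem)
    have x': "pinv x j = j" if "j \<in> S \<union> pinv g ` S" for j using fx[OF that] x by (metis pinv_left)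
    have wx: "w \<circ> pinv x \<in> G" using wG x by (simp add: comp_mem pinv_mem)
    have "w \<circ> pinv x \<in> nbhd g S"
      using w(1) wx wG x fx x' unfolding nbhd_def by (auto simp: pinv_comp pinv_mem pinv_pinv)
    moreover have "w = (w \<circ> pinv x) \<circ> x" using x by auto
    ultimately have "w \<circ> pinv x \<in> A" using w(3) by blast
    moreover have "x = pinv (w \<circ> pinv x) \<circ> w"
      using wG x by (auto simp: pinv_comp pinv_mem pinv_pinv)
    ultimately show ?thesis using w(2) by blast
  qed
  then show ?thesis using S by (intro exI[of _ "S \<union> pinv g ` S"]) auto
qed

end

section \<open>Permutation groups with free amalgamation\<close>

text \<open>For H the hyperedges of a structure, this says that the part on B \<union> C is the free
  amalgam of the parts on B and C over B \<inter> C.\<close>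

definition indep :: "'a set set \<Rightarrow> 'a set \<Rightarrow> 'a set \<Rightarrow> bool" where
  "indep H B C \<longleftrightarrow> (\<forall>t\<in>H. t \<subseteq> B \<union> C \<longrightarrow> t \<subseteq> B \<or> t \<subseteq> C)"

lemma indep_sym: "indep H B C \<Longrightarrow> indep H C B"
  unfolding indep_def by (metis Un_commute)

lemma indepD: "indep H B C \<Longrightarrow> t \<in> H \<Longrightarrow> t \<subseteq> B \<union> C \<Longrightarrow> t \<subseteq> B \<or> t \<subseteq> C"
  unfolding indep_def by blast

lemma indep_subset:
  assumes "indep H B C" "B' \<subseteq> B" "C' \<subseteq> C" "B \<inter> C \<subseteq> B'" "B \<inter> C \<subseteq> C'"
  shows "indep H B' C'"
  unfolding indep_def
proof (intro ballI impI)
  fix t assume t: "t \<in> H" "t \<subseteq> B' \<union> C'"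
  then have "t \<subseteq> B \<or> t \<subseteq> C" using assms by (intro indepD[OF assms(1)]) auto
  then show "t \<subseteq> B' \<or> t \<subseteq> C'" using t(2) assms(2-5) by blast
qed

lemma indep_image_bij:
  assumes "indep H B C" "\<And>t. t \<in> H \<Longrightarrow> g' ` t \<in> H" "\<And>x. g' (g x) = x" "\<And>x. g (g' x) = x"
  shows "indep H (g ` B) (g ` C)"
  unfolding indep_def
proof (intro ballI impI)
  fix t assume t: "t \<in> H" "t \<subseteq> g ` B \<union> g ` C"
  have "g' ` t \<in> H" using t(1) by (rule assms(2))
  moreover have "g' ` t \<subseteq> B \<union> C" using t(2) assms(3) by auto
  ultimately have "g' ` t \<subseteq> B \<or> g' ` t \<subseteq> C" by (rule indepD[OF assms(1)])
  moreover have "t = g ` g' ` t" using assms(4) by (simp add: image_image)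
  ultimately show "t \<subseteq> g ` B \<or> t \<subseteq> g ` C" by (metis image_mono)
qed

text \<open>
  The only properties of the automorphism group of a free homogeneous structure that are used: \<open>H\<close>
  consists of the sets of entries of related tuples, \<open>free\<close> is free amalgamation, and \<open>glue\<close> is
  homogeneity applied to an isomorphism between two free amalgams. Finite partial isomorphisms are
  always represented by elements of \<open>G\<close> inducing them.
\<close>

locale free_perm_group = perm_group +
  fixes H :: "nat set set"
  assumes image_mem: "t \<in> H \<Longrightarrow> g \<in> G \<Longrightarrow> g ` t \<in> H"
    and free: "finite B \<Longrightarrow> finite C \<Longrightarrow> A \<subseteq> B \<Longrightarrow> A \<subseteq> C \<Longrightarrow>
      \<exists>k\<in>G. (\<forall>x\<in>A. k x = x) \<and> k ` B \<inter> C = A \<and> indep H (k ` B) C"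
    and glue: "finite B \<Longrightarrow> finite C \<Longrightarrow> g \<in> G \<Longrightarrow> h \<in> G \<Longrightarrow> indep H B C \<Longrightarrow>
      (\<And>x. x \<in> B \<inter> C \<Longrightarrow> g x = h x) \<Longrightarrow> g ` B \<inter> h ` C = g ` (B \<inter> C) \<Longrightarrow> indep H (g ` B) (h ` C) \<Longrightarrow>
      \<exists>k\<in>G. (\<forall>x\<in>B. k x = g x) \<and> (\<forall>x\<in>C. k x = h x)"
begin

lemma indep_image:
  assumes "indep H B C" "g \<in> G"
  shows "indep H (g ` B) (g ` C)"
  using assms by (intro indep_image_bij[where g' = "pinv g"]) (auto simp: image_mem pinv_mem)

text \<open>A finite approximation of an involution whose only fixed point is a. Only the values of
  f on C matter; f is an arbitrary element of \<open>G\<close> inducing them.\<close>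

definition partial_invol :: "nat \<Rightarrow> nat set \<Rightarrow> (nat \<Rightarrow> nat) \<Rightarrow> bool" where
  "partial_invol a C f \<longleftrightarrow> finite C \<and> a \<in> C \<and> f \<in> G \<and> f a = a \<and>
     (\<forall>x\<in>C. f x \<in> C \<and> f (f x) = x \<and> (f x = x \<longrightarrow> x = a))"

lemma partial_involD:
  assumes "partial_invol a C f"
  shows "finite C" "a \<in> C" "f \<in> G" "f a = a" "x \<in> C \<Longrightarrow> f x \<in> C" "x \<in> C \<Longrightarrow> f (f x) = x"
    "x \<in> C \<Longrightarrow> f x = x \<Longrightarrow> x = a" "f ` C = C" "X \<subseteq> C \<Longrightarrow> f ` f ` X = X"
proof -
  show "finite C" "a \<in> C" "f \<in> G" "f a = a" "x \<in> C \<Longrightarrow> f x \<in> C" "x \<in> C \<Longrightarrow> f (f x) = x"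
    "x \<in> C \<Longrightarrow> f x = x \<Longrightarrow> x = a"
    using assms unfolding partial_invol_def by blast+
  have C: "f x \<in> C" "f (f x) = x" if "x \<in> C" for x
    using assms that unfolding partial_invol_def by blast+
  then show "f ` C = C" by (metis image_subset_iff subsetI subset_antisym imageI)
  assume "X \<subseteq> C"
  then have "\<And>x. x \<in> X \<Longrightarrow> f (f x) = x" using C(2) by blast
  then show "f ` f ` X = X" by (simp add: image_image)
qed

text \<open>A is exchanged with a free copy of itself over C. The map u sends A to this copy and
  agrees with f on C; u on A and its inverse on the copy agree on C, because f is an involution
  there, and so they glue. No fixed points arise, as u maps A - C outside A.\<close>

lemma extend_invol_free:
  assumes f: "partial_invol a C f" and A: "finite A" "C \<subseteq> A"
  shows "\<exists>f'. partial_invol a (A \<union> f' ` A) f' \<and> (\<forall>x\<in>C. f' x = f x) \<and> A \<inter> f' ` A = C \<and> indep H A (f' ` A)"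
proof -
  note f' = partial_involD[OF f]
  have fA: "finite (f ` A)" "C \<subseteq> f ` A" using A(1) image_mono[OF A(2), of f] f'(8) by simp_all
  from free[OF fA(1) A(1) fA(2) A(2)]
  obtain k where k: "k \<in> G" "\<And>x. x \<in> C \<Longrightarrow> k x = x" "k ` f ` A \<inter> A = C" "indep H (k ` f ` A) A"
    by blast
  define u where "u = k \<circ> f"
  have u: "u \<in> G" unfolding u_def using k(1) f'(3) by (rule comp_mem)
  have uA: "u ` A \<inter> A = C" "indep H (u ` A) A" using k unfolding u_def by (auto simp: image_comp)
  have uC1: "u x = f x" if "x \<in> C" for x using k(2)[OF f'(5)[OF that]] by (simp add: u_def)
  have uC2: "pinv u x = f x" if "x \<in> C" for x
    by (rule pinv_eq[OF u]) (use uC1[OF f'(5)[OF that]] f'(6)[OF that] in simp)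
  note uC = uC1 uC2
  have pu: "pinv u ` u ` A = A" using u by (simp add: image_image)
  have AuA: "A \<inter> u ` A = C" using uA(1) by (simp add: Int_commute)
  have "u ` C = C" using uC1 f'(8) by (metis image_cong)
  then have "\<exists>k\<in>G. (\<forall>x\<in>A. k x = u x) \<and> (\<forall>x\<in>u ` A. k x = pinv u x)"
    using A u uA uC by (intro glue) (simp_all add: pinv_mem indep_sym pu AuA)
  then obtain f1 where f1: "f1 \<in> G" "\<And>x. x \<in> A \<Longrightarrow> f1 x = u x" "\<And>x. x \<in> A \<Longrightarrow> f1 (u x) = x"
    using u by auto
  have im: "f1 ` A = u ` A" using f1(2) by auto
  have fixed: "x = a" if "x \<in> A" "u x = x" for x
    using that uA(1) uC(1) f'(7) by (metis IntI imageI)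
  have "partial_invol a (A \<union> f1 ` A) f1"
    unfolding partial_invol_def im
  proof (intro conjI ballI)
    have aA: "a \<in> A" using f'(2) A(2) by blast
    show "finite (A \<union> u ` A)" "a \<in> A \<union> u ` A" "f1 \<in> G" using A(1) aA f1(1) by simp_all
    show "f1 a = a" using f1(2)[OF aA] uC1[OF f'(2)] f'(4) by simp
    fix x assume "x \<in> A \<union> u ` A"
    then obtain y where y: "y \<in> A" "x = y \<or> x = u y" by blast
    show "f1 x \<in> A \<union> u ` A" using y f1(2,3) by auto
    show "f1 (f1 x) = x" using y f1(2,3) by auto
    show "f1 x = x \<longrightarrow> x = a" using y f1(2,3) fixed by auto
  qed
  then show ?thesis using f1(2) uA(2) uC1 A(2) im AuA
    by (intro exI[of _ f1]) (simp add: indep_sym subset_iff)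
qed

text \<open>Amalgamation of sets with an involution: U is placed freely over the image of D, and f
  is transported along k. The transported map agrees with f on the image of D because g commutes
  with f on D, so the two glue. Freeness is kept from all of A, not only from C, for the sake of the
  second involution.\<close>

lemma extend_invol_realize:
  assumes f: "partial_invol a C f" and A: "finite A" "C \<subseteq> A"
    and D: "a \<in> D" "D \<subseteq> U" "U \<subseteq> C" "f ` U \<subseteq> U" "f ` D \<subseteq> D"
    and g: "g \<in> G" "g ` D \<subseteq> C" "\<And>x. x \<in> D \<Longrightarrow> g (f x) = f (g x)"
  shows "\<exists>k\<in>G. \<exists>f'. (\<forall>x\<in>D. k x = g x) \<and> k ` U \<inter> A = g ` D \<and> indep H (k ` U) A \<and>
    partial_invol a (C \<union> k ` U) f' \<and> (\<forall>x\<in>C. f' x = f x) \<and> (\<forall>x\<in>U. f' (k x) = k (f x))"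
proof -
  note f' = partial_involD[OF f]
  have U: "finite U" using D(3) f'(1) by (rule finite_subset)
  have fU: "f ` U = U" and fD: "f ` D = D"
    using D f'(9)[of U] f'(9)[of D] image_mono[OF D(4), of f] image_mono[OF D(5), of f] by auto
  \<comment> \<open>Commuting with f makes g a a fixed point of f in C, and a is the only
    one.\<close>
  have "g a \<in> C" using g(2) D(1) by blast
  moreover have "f (g a) = g a" using g(3)[OF D(1)] f'(4) by simp
  ultimately have ga: "g a = a" by (rule f'(7))
  from free[OF finite_imageI[OF U, of g] A(1) image_mono[OF D(2), of g] order_trans[OF g(2) A(2)]]
  obtain k0 where k0: "k0 \<in> G" "\<forall>x\<in>g ` D. k0 x = x" "k0 ` g ` U \<inter> A = g ` D" "indep H (k0 ` g ` U) A"
    by metis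
  define k where "k = k0 \<circ> g"
  have k: "k \<in> G" unfolding k_def using k0(1) g(1) by (rule comp_mem)
  have kD: "k x = g x" if "x \<in> D" for x using k0(2) that unfolding k_def by simp
  have kU: "k ` U \<inter> A = g ` D" "indep H (k ` U) A" using k0 unfolding k_def by (auto simp: image_comp)
  define r where "r = k \<circ> (f \<circ> pinv k)"
  have r: "r \<in> G" unfolding r_def using k f'(3) by (simp add: comp_mem pinv_mem)
  have rk: "r (k x) = k (f x)" for x unfolding r_def using k by simp
  have rU: "r ` k ` U = k ` U" using fU by (simp add: image_image rk) (metis image_image)
  have CU: "C \<inter> k ` U = g ` D"
    using kU(1) A(2) g(2) by blast
  have fgD: "f ` g ` D = g ` D" using g(3) fD by (metis (no_types, lifting) image_cong image_image)
  have ind: "indep H C (k ` U)"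
    unfolding indep_def
  proof (intro ballI impI)
    fix t assume t: "t \<in> H" "t \<subseteq> C \<union> k ` U"
    then have "t \<subseteq> k ` U \<or> t \<subseteq> A" using indepD[OF kU(2)] A(2) by blast
    then show "t \<subseteq> C \<or> t \<subseteq> k ` U" using t(2) kU(1) g(2) by blast
  qed
  have "\<exists>f1\<in>G. (\<forall>x\<in>C. f1 x = f x) \<and> (\<forall>x\<in>k ` U. f1 x = r x)"
  proof (rule glue)
    show "f x = r x" if "x \<in> C \<inter> k ` U" for x
      using that CU kD g(3) rk D(5) by (metis (no_types, lifting) imageE image_subset_iff)
    show "f ` C \<inter> r ` k ` U = f ` (C \<inter> k ` U)" using CU fgD f'(8) rU by simp
    show "indep H (f ` C) (r ` k ` U)" using ind f'(8) rU by simp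
  qed (simp_all add: f'(1,3) U r ind)
  then obtain f1 where f1: "f1 \<in> G" "\<forall>x\<in>C. f1 x = f x" "\<forall>x\<in>k ` U. f1 x = r x"
    by metis
  have f1k: "f1 (k x) = k (f x)" if "x \<in> U" for x using f1(3) rk that by simp
  have "partial_invol a (C \<union> k ` U) f1"
    unfolding partial_invol_def
  proof (intro conjI ballI)
    show "finite (C \<union> k ` U)" "a \<in> C \<union> k ` U" "f1 \<in> G" using f'(1,2) U f1(1) by simp_all
    show "f1 a = a" using f1(2) f'(2,4) by simp
    fix x assume x: "x \<in> C \<union> k ` U"
    show "f1 x \<in> C \<union> k ` U" using x f1(2) f1k f'(5) D(4) by auto
    show "f1 (f1 x) = x" using x
    proof
      assume "x \<in> k ` U"
      then obtain y where y: "y \<in> U" "x = k y" by blast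
      then have "f y \<in> U" "f (f y) = y" using D(3,4) f'(6) by blast+
      then show ?thesis using y f1k by simp
    qed (use f1(2) f'(5,6) in simp)
    show "f1 x = x \<longrightarrow> x = a" using x
    proof
      assume "x \<in> k ` U"
      then obtain y where y: "y \<in> U" "x = k y" by blast
      show ?thesis
      proof
        assume "f1 x = x"
        then have "f y = y" using y f1k inj_mem[OF k] by simp
        then have "y = a" using f'(7) y(1) D(3) by blast
        then show "x = a" using y(2) kD[OF D(1)] ga by simp
      qed
    qed (use f1(2) f'(7) in simp)
  qed
  then show ?thesis using k kD kU f1(2) f1k by (intro bexI[of _ k] exI[of _ f1]) simp_all
qed

section \<open>Generic pairs of involutions\<close>

text \<open>
  A generic pair \<open>c, e\<close> is built from finite approximations \<open>(C, f)\<close> of \<open>c\<close> and \<open>(E, h)\<close> of \<open>e\<close>. Since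
  \<open>c\<close> and \<open>e\<close> generate an infinite dihedral group, no finite set is closed under both; instead of such
  sets one uses the \<open>e\<close>-closed sets \<open>B\<close> with \<open>spread c e B\<close>, where one application of \<open>c\<close> followed by one
  of \<open>e\<close> leads to a free position over \<open>B\<close>.
\<close>

definition spread :: "(nat \<Rightarrow> nat) \<Rightarrow> (nat \<Rightarrow> nat) \<Rightarrow> nat set \<Rightarrow> bool" where
  "spread f h B \<longleftrightarrow> h ` B = B \<and> (B \<union> f ` B) \<inter> h ` (B \<union> f ` B) = B \<and> indep H (B \<union> f ` B) (h ` (B \<union> f ` B))"

section \<open>Extension steps for pairs of partial involutions\<close>

definition extends :: "nat set \<Rightarrow> (nat \<Rightarrow> nat) \<Rightarrow> nat set \<Rightarrow> (nat \<Rightarrow> nat) \<Rightarrow> bool" where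
  "extends C f C' f' \<longleftrightarrow> C \<subseteq> C' \<and> (\<forall>x\<in>C. f' x = f x)"

lemma extends_trans: "extends C f C' f' \<Longrightarrow> extends C' f' C'' f'' \<Longrightarrow> extends C f C'' f''"
  unfolding extends_def by (metis subsetD subset_trans)

lemma extends_refl: "extends C f C f" unfolding extends_def by simp

lemma extendsD: "extends C f C' f' \<Longrightarrow> C \<subseteq> C'" "extends C f C' f' \<Longrightarrow> x \<in> C \<Longrightarrow> f' x = f x"
  unfolding extends_def by auto

lemma extends_image: "extends C f C' f' \<Longrightarrow> X \<subseteq> C \<Longrightarrow> f' ` X = f ` X"
  unfolding extends_def by (auto intro!: image_cong)

lemma extend_invol:
  assumes "partial_invol a C f" "finite A" "C \<subseteq> A"
  shows "\<exists>f'. partial_invol a (A \<union> f' ` A) f' \<and> extends C f (A \<union> f' ` A) f' \<and>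
    A \<inter> f' ` A = C \<and> indep H A (f' ` A)"
proof -
  obtain f' where "partial_invol a (A \<union> f' ` A) f'" "\<forall>x\<in>C. f' x = f x" "A \<inter> f' ` A = C" "indep H A (f' ` A)"
    using extend_invol_free[OF assms] by metis
  then show ?thesis using assms(3) by (intro exI[of _ f']) (auto simp: extends_def)
qed

lemma extend_invol_domain:
  assumes "partial_invol a C f" "finite S"
  obtains C' f' where "partial_invol a C' f'" "extends C f C' f'" "S \<subseteq> C'"
proof -
  have "finite (C \<union> S)" using assms partial_involD(1) by blast
  from extend_invol[OF assms(1) this] obtain f' where
    "partial_invol a (C \<union> S \<union> f' ` (C \<union> S)) f'" "extends C f (C \<union> S \<union> f' ` (C \<union> S)) f'" by blast
  then show ?thesis by (rule that) auto
qed

text \<open>Doubling under h gives an h-closed B. Doubling B under f gives \<open>C1\<close>, and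
  doubling \<open>C1\<close> under h freely over B is what \<open>spread\<close> asks for.\<close>

lemma extend_spread:
  assumes f: "partial_invol a C f" and h: "partial_invol a E h" and S: "finite S"
  shows "\<exists>C' f' E' h' B. partial_invol a C' f' \<and> partial_invol a E' h' \<and> extends C f C' f' \<and>
    extends E h E' h' \<and> finite B \<and> S \<subseteq> B \<and> B \<subseteq> C' \<and> B \<union> f' ` B \<subseteq> E' \<and> spread f' h' B"
proof -
  define A where "A = C \<union> E \<union> S"
  have A: "finite A" using f h S partial_involD(1) unfolding A_def by blast
  obtain h1 where h1: "partial_invol a (A \<union> h1 ` A) h1" "extends E h (A \<union> h1 ` A) h1"
    using extend_invol[OF h A] unfolding A_def by blast
  define B where "B = A \<union> h1 ` A"
  note h1 = h1[folded B_def]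
  have B: "finite B" using partial_involD(1)[OF h1(1)] .
  have "C \<subseteq> B" unfolding B_def A_def by auto
  from extend_invol[OF f B this] obtain f1 where
    f1: "partial_invol a (B \<union> f1 ` B) f1" "extends C f (B \<union> f1 ` B) f1" by blast
  define C1 where "C1 = B \<union> f1 ` B"
  note f1 = f1[folded C1_def]
  have C1: "finite C1" "B \<subseteq> C1" using partial_involD(1)[OF f1(1)] unfolding C1_def by auto
  from extend_invol[OF h1(1) C1] obtain h2 where
    h2: "partial_invol a (C1 \<union> h2 ` C1) h2" "extends B h1 (C1 \<union> h2 ` C1) h2" "C1 \<inter> h2 ` C1 = B" "indep H C1 (h2 ` C1)"
    by blast
  have "h2 ` B = B" using extends_image[OF h2(2)] partial_involD(8)[OF h1(1)] by simp
  then have "spread f1 h2 B" using h2(3,4) unfolding spread_def C1_def[symmetric] by simp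
  moreover have "extends E h (C1 \<union> h2 ` C1) h2" using h1(2) h2(2) by (rule extends_trans)
  moreover have "S \<subseteq> B" unfolding B_def A_def by auto
  moreover have "B \<subseteq> C1" "B \<union> f1 ` B \<subseteq> C1 \<union> h2 ` C1" unfolding C1_def by auto
  ultimately show ?thesis using f1 h2(1) B by blast
qed

text \<open>U is moved over D to a position V free from everything decided so far, and h is then
  doubled on A \<union> V, so that points of V outside D get entirely new h-images. Hence V and its
  h-image can meet or be related only through D and its h-image, where the hypothesis
  \<open>ind\<close> decides.\<close>

lemma extend_realize_free:
  assumes f: "partial_invol a C f" and h: "partial_invol a E h"
    and D: "a \<in> D" "D \<subseteq> U" "U \<subseteq> C" "D \<subseteq> E" "f ` U \<subseteq> U" "f ` D \<subseteq> D" and ind: "indep H D (h ` D)"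
  shows "\<exists>C' f' E' h' k. partial_invol a C' f' \<and> partial_invol a E' h' \<and> extends C f C' f' \<and>
    extends E h E' h' \<and> k \<in> G \<and> (\<forall>x\<in>D. k x = x) \<and> (\<forall>x\<in>U. k (f' x) = f' (k x)) \<and>
    k ` U \<subseteq> C' \<inter> E' \<and> k ` U \<inter> h' ` k ` U = D \<inter> h' ` D \<and> indep H (k ` U) (h' ` k ` U)"
proof -
  define A where "A = C \<union> E"
  have A: "finite A" "C \<subseteq> A" "E \<subseteq> A" using f h partial_involD(1) unfolding A_def by blast+
  have "\<And>x. x \<in> D \<Longrightarrow> id (f x) = f (id x)" by simp
  moreover have "id ` D \<subseteq> C" using D by simp
  ultimately obtain k f1 where k: "k \<in> G" "\<forall>x\<in>D. k x = id x" "k ` U \<inter> A = id ` D" "indep H (k ` U) A"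
    and f1: "partial_invol a (C \<union> k ` U) f1" "\<forall>x\<in>C. f1 x = f x" "\<forall>x\<in>U. f1 (k x) = k (f x)"
    using extend_invol_realize[OF f A(1,2) D(1,2,3,5,6) id_mem] by metis
  define V where "V = k ` U"
  have k: "k \<in> G" "\<forall>x\<in>D. k x = x" "V \<inter> A = D" "indep H V A" using k unfolding V_def by simp_all
  have DV: "D \<subseteq> V" using k(3) by blast
  have V: "finite V" using f1(1) partial_involD(1) unfolding V_def by blast
  have AV: "finite (A \<union> V)" "E \<subseteq> A \<union> V" using A V by auto
  from extend_invol[OF h AV] obtain h1 where h1: "partial_invol a (A \<union> V \<union> h1 ` (A \<union> V)) h1"
    "extends E h (A \<union> V \<union> h1 ` (A \<union> V)) h1" "(A \<union> V) \<inter> h1 ` (A \<union> V) = E" "indep H (A \<union> V) (h1 ` (A \<union> V))"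
    by blast
  have hh: "h1 (h1 x) = x" if "x \<in> A \<union> V" for x using partial_involD(6)[OF h1(1)] that by blast
  have hE: "h1 x \<in> E" if "x \<in> E" for x
    using extendsD(2)[OF h1(2) that] partial_involD(5)[OF h that] by simp
  have VE: "x \<in> D" if "x \<in> V" "x \<in> E" for x using that k(3) A(3) by blast
  have hVE: "x \<in> h1 ` D" if x: "x \<in> h1 ` V" "x \<in> E" for x
  proof -
    obtain y where y: "y \<in> V" "x = h1 y" using x(1) by blast
    then have "y = h1 x" using hh[of y] by simp
    then have "y \<in> E" using hE[OF x(2)] by simp
    then show ?thesis using y VE by blast
  qed
  have "V \<inter> h1 ` V = D \<inter> h1 ` D"
  proof
    show "V \<inter> h1 ` V \<subseteq> D \<inter> h1 ` D"
    proof
      fix x assume x: "x \<in> V \<inter> h1 ` V"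
      then have "x \<in> (A \<union> V) \<inter> h1 ` (A \<union> V)" by blast
      then have "x \<in> E" unfolding h1(3) .
      then show "x \<in> D \<inter> h1 ` D" using x VE hVE by blast
    qed
    show "D \<inter> h1 ` D \<subseteq> V \<inter> h1 ` V" using DV by blast
  qed
  moreover have "indep H V (h1 ` V)"
  proof -
    have hD: "h1 ` D = h ` D" using extends_image[OF h1(2) D(4)] .
    have hDA: "h1 ` D \<subseteq> A" using hE D(4) A(3) by blast
    \<comment> \<open>A hyperedge lies on one side of the doubling. This is the side A \<union> V;
      the other is reduced to it by applying \<open>h1\<close>, which exchanges V with its
      image.\<close>
    have main: "t \<subseteq> V \<or> t \<subseteq> h1 ` D" if t: "t \<in> H" "t \<subseteq> V \<union> h1 ` V" "t \<subseteq> A \<union> V" for t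
    proof -
      have "x \<in> V \<union> h1 ` D" if "x \<in> t" for x
      proof (cases "x \<in> V")
        case False
        then have "x \<in> (A \<union> V) \<inter> h1 ` (A \<union> V)" "x \<in> h1 ` V" using that t by blast+
        then have "x \<in> h1 ` D" using hVE h1(3) by blast
        then show ?thesis by simp
      qed simp
      then have t': "t \<subseteq> V \<union> h1 ` D" by blast
      then have "t \<subseteq> V \<or> t \<subseteq> A" using indepD[OF k(4) t(1)] hDA by blast
      then show ?thesis
      proof
        assume "t \<subseteq> A"
        then have "t \<subseteq> D \<union> h ` D" using t' k(3) hD by blast
        then show ?thesis using indepD[OF ind t(1)] hD DV by blast
      qed simp
    qed
    show ?thesis
      unfolding indep_def
    proof (intro ballI impI)
      fix t assume t: "t \<in> H" "t \<subseteq> V \<union> h1 ` V"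
      have "t \<subseteq> (A \<union> V) \<union> h1 ` (A \<union> V)" using t(2) by blast
      from indepD[OF h1(4) t(1) this] show "t \<subseteq> V \<or> t \<subseteq> h1 ` V"
      proof
        assume "t \<subseteq> A \<union> V"
        then show ?thesis using main[OF t] DV by blast
      next
        assume t2: "t \<subseteq> h1 ` (A \<union> V)"
        have hV: "h1 ` h1 ` V = V" by (rule partial_involD(9)[OF h1(1)]) auto
        have "h1 ` h1 ` (A \<union> V) = A \<union> V" by (rule partial_involD(9)[OF h1(1)]) auto
        then have "h1 ` t \<subseteq> A \<union> V" using image_mono[OF t2, of h1] by simp
        moreover have "h1 ` t \<subseteq> V \<union> h1 ` V" using image_mono[OF t(2), of h1] hV by (auto simp: image_Un)
        moreover have "h1 ` t \<in> H" using t(1) partial_involD(3)[OF h1(1)] by (rule image_mem)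
        ultimately have "h1 ` t \<subseteq> V \<or> h1 ` t \<subseteq> h1 ` D" using main by blast
        moreover have "h1 ` h1 ` t = t" by (rule partial_involD(9)[OF h1(1)]) (use t(2) in blast)
        ultimately have "t \<subseteq> h1 ` V \<or> t \<subseteq> h1 ` h1 ` D" by (metis image_mono)
        moreover have "h1 ` h1 ` D = D" by (rule partial_involD(9)[OF h1(1)]) (use DV in blast)
        ultimately show ?thesis using DV by blast
      qed
    qed
  qed
  moreover have "extends C f (C \<union> V) f1" using f1(2) unfolding extends_def by simp
  moreover have "\<forall>x\<in>U. k (f1 x) = f1 (k x)" using f1(2,3) D(3) by (metis subsetD)
  moreover have "V \<subseteq> (C \<union> V) \<inter> (A \<union> V \<union> h1 ` (A \<union> V))" by blast
  ultimately show ?thesis using f1(1) h1(1,2) k(1,2) unfolding V_def by metis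
qed

text \<open>V is placed freely over B with h transported, then f is doubled on everything present,
  then h on the outcome. Outside V, the only old points of V and its f-image lie in
  \<open>D\<close>. The hypotheses on B say that f on B and h on \<open>D\<close> are already
  decided, so \<open>sp\<close> settles the old part.\<close>

lemma extend_realize_spread:
  assumes f: "partial_invol a C f" and h: "partial_invol a E h"
    and B: "a \<in> B" "B \<subseteq> U" "U \<subseteq> E" "B \<subseteq> C" "f ` B \<subseteq> E" "h ` (B \<union> f ` B) \<subseteq> C" "h ` U \<subseteq> U"
    and sp: "spread f h B"
  shows "\<exists>C' f' E' h' k. partial_invol a C' f' \<and> partial_invol a E' h' \<and> extends C f C' f' \<and>
    extends E h E' h' \<and> k \<in> G \<and> (\<forall>x\<in>B. k x = x) \<and> (\<forall>x\<in>U. k (h' x) = h' (k x)) \<and>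
    k ` U \<subseteq> C' \<and> k ` U \<union> f' ` k ` U \<subseteq> E' \<and> spread f' h' (k ` U)"
proof -
  define A where "A = C \<union> E"
  have A: "finite A" "E \<subseteq> A" "C \<subseteq> A" using f h partial_involD(1) unfolding A_def by blast+
  have "\<And>x. x \<in> B \<Longrightarrow> id (h x) = h (id x)" by simp
  moreover have "id ` B \<subseteq> E" using B by auto
  moreover have "h ` B \<subseteq> B" using sp unfolding spread_def by simp
  ultimately obtain k h1 where k: "k \<in> G" "\<forall>x\<in>B. k x = id x" "k ` U \<inter> A = id ` B" "indep H (k ` U) A"
    and h1: "partial_invol a (E \<union> k ` U) h1" "\<forall>x\<in>E. h1 x = h x" "\<forall>x\<in>U. h1 (k x) = k (h x)"
    using extend_invol_realize[OF h A(1,2) B(1,2,3,7) _ id_mem] by metis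
  define V where "V = k ` U"
  have k: "k \<in> G" "\<forall>x\<in>B. k x = x" "V \<inter> A = B" "indep H V A" using k unfolding V_def by simp_all
  have BV: "B \<subseteq> V" using k(3) by blast
  have V: "finite V" using h1(1) partial_involD(1) unfolding V_def by blast
  define A1 where "A1 = A \<union> V"
  have A1: "finite A1" "C \<subseteq> A1" "V \<subseteq> A1" "A \<subseteq> A1" using A V unfolding A1_def by auto
  from extend_invol[OF f A1(1,2)] obtain f1 where f1: "partial_invol a (A1 \<union> f1 ` A1) f1"
    "extends C f (A1 \<union> f1 ` A1) f1" "A1 \<inter> f1 ` A1 = C" "indep H A1 (f1 ` A1)"
    by blast
  define C1 where "C1 = A1 \<union> f1 ` A1"
  note f1 = f1[folded C1_def]
  define E1 where "E1 = E \<union> V"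
  note h1 = h1[folded V_def, folded E1_def]
  have C1: "finite C1" "E1 \<subseteq> C1" "E1 \<subseteq> A1" "A1 \<subseteq> C1" "f1 ` A1 \<subseteq> C1"
    using partial_involD(1)[OF f1(1)] A A1 unfolding C1_def E1_def by auto
  from extend_invol[OF h1(1) C1(1,2)] obtain h2 where h2: "partial_invol a (C1 \<union> h2 ` C1) h2"
    "extends E1 h1 (C1 \<union> h2 ` C1) h2" "C1 \<inter> h2 ` C1 = E1" "indep H C1 (h2 ` C1)"
    by blast
  have hh: "h2 (h2 x) = x" if "x \<in> C1" for x using partial_involD(6)[OF h2(1)] that by blast
  have ff: "f1 (f1 x) = x" if "x \<in> C1" for x using partial_involD(6)[OF f1(1)] that by blast
  have hE1: "h2 x \<in> E1" if "x \<in> E1" for x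
    using extendsD(2)[OF h2(2) that] partial_involD(5)[OF h1(1) that] by simp
  have eh: "extends E h (C1 \<union> h2 ` C1) h2"
  proof -
    have "extends E h E1 h1" using h1(2) unfolding extends_def E1_def by simp
    then show ?thesis using h2(2) by (rule extends_trans)
  qed
  have hV: "h2 ` V = V"
  proof -
    have "h2 x \<in> V" if "x \<in> V" for x
    proof -
      obtain y where y: "y \<in> U" "x = k y" using \<open>x \<in> V\<close> unfolding V_def by blast
      have "h2 x = h1 x" using extendsD(2)[OF h2(2)] that unfolding E1_def by blast
      also have "\<dots> = k (h y)" using h1(3) y by simp
      finally show ?thesis using y(1) B(7) unfolding V_def by blast
    qed
    moreover have "h2 (h2 x) = x" if "x \<in> V" for x using hh that A1(3) C1(4) by blast
    ultimately show ?thesis by (metis image_subset_iff imageI subsetI subset_antisym)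
  qed
  define D where "D = B \<union> f ` B"
  have D: "D \<subseteq> A" "D \<subseteq> E" "D \<subseteq> C" "h ` D \<subseteq> C" 
  proof -
    have "f ` B \<subseteq> C" using image_mono[OF B(4), of f] partial_involD(8)[OF f] by simp
    then show "D \<subseteq> C" using B(4) unfolding D_def by simp
    then show "D \<subseteq> A" using A(3) by simp
    show "D \<subseteq> E" using B(2,3,5) unfolding D_def by simp
    show "h ` D \<subseteq> C" using B(6) unfolding D_def .
  qed
  have fB: "f1 ` B = f ` B" by (rule extends_image[OF f1(2) B(4)])
  have hD: "h2 ` D = h ` D" by (rule extends_image[OF eh D(2)])
  have spD: "D \<inter> h ` D = B" "indep H D (h ` D)" using sp unfolding spread_def D_def by simp_all
  define W where "W = V \<union> f1 ` V"
  have W: "W \<subseteq> C1" using A1 C1 unfolding W_def by blast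
  have DW: "D \<subseteq> W" using BV fB unfolding D_def W_def by blast
  have fV: "x \<in> f ` B" if x: "x \<in> f1 ` V" "x \<in> A1" for x
  proof -
    obtain y where y: "y \<in> V" "x = f1 y" using x(1) by blast
    have "x \<in> C" using x(2) y A1(3) f1(3) by blast
    then have "f1 x \<in> C" using extendsD(2)[OF f1(2)] partial_involD(5)[OF f] by simp
    moreover have "f1 x = y" using ff y A1(3) C1(4) by blast
    ultimately have "y \<in> B" using y(1) k(3) A(3) by blast
    then show ?thesis using y(2) fB by blast
  qed
  have WE: "x \<in> V \<union> D" if "x \<in> W" "x \<in> E1" for x
    using that fV C1(3) unfolding W_def D_def by blast
  have hWE: "x \<in> V \<union> h ` D" if x: "x \<in> h2 ` W" "x \<in> E1" for x
  proof -
    obtain y where y: "y \<in> W" "x = h2 y" using x(1) by blast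
    then have "y \<in> E1" using hE1[OF x(2)] hh W by auto
    then have "y \<in> V \<union> D" using WE y(1) by blast
    then show ?thesis using y(2) hV hD by blast
  qed
  have "W \<inter> h2 ` W = V"
  proof
    show "V \<subseteq> W \<inter> h2 ` W" using hV unfolding W_def by blast
    show "W \<inter> h2 ` W \<subseteq> V"
    proof
      fix x assume x: "x \<in> W \<inter> h2 ` W"
      then have "x \<in> C1 \<inter> h2 ` C1" using W by blast
      then have "x \<in> E1" unfolding h2(3) .
      then have "x \<in> V \<union> D" "x \<in> V \<union> h ` D" using x WE hWE by blast+
      then show "x \<in> V" using spD(1) BV by blast
    qed
  qed
  moreover have "indep H W (h2 ` W)"
  proof -
    have main: "t \<subseteq> W \<or> t \<subseteq> h2 ` D" if t: "t \<in> H" "t \<subseteq> W \<union> h2 ` W" "t \<subseteq> C1" for t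
    proof -
      have hDA: "h ` D \<subseteq> A" using D(4) A(3) by blast
      have t': "t \<subseteq> W \<union> h ` D"
      proof
        fix x assume "x \<in> t"
        show "x \<in> W \<union> h ` D"
        proof (cases "x \<in> W")
          case False
          then have "x \<in> C1 \<inter> h2 ` C1" "x \<in> h2 ` W" using \<open>x \<in> t\<close> t W by blast+
          then have "x \<in> V \<union> h ` D" using hWE h2(3) by blast
          then show ?thesis unfolding W_def by blast
        qed simp
      qed
      \<comment> \<open>This is applied to t with X the h-image of \<open>D\<close>, and to the
        image of t under \<open>f1\<close> with X the \<open>f1\<close>-image of that set. The two
        uses are the two sides of the doubling of \<open>A1\<close> under \<open>f1\<close>.\<close>
      have core: "s \<subseteq> V \<or> s \<subseteq> D \<union> X" if s: "s \<in> H" "s \<subseteq> A1" "s \<subseteq> W \<union> X" "X \<subseteq> A" for s X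
      proof -
        have s': "s \<subseteq> V \<union> (D \<union> X)" using s fV unfolding W_def D_def by blast
        then have "s \<subseteq> V \<or> s \<subseteq> A" using indepD[OF k(4) s(1)] D(1) s(4) by blast
        then show ?thesis using s' k(3) unfolding D_def by blast
      qed
      have "t \<subseteq> A1 \<or> t \<subseteq> f1 ` A1" using indepD[OF f1(4) t(1)] t(3) unfolding C1_def by blast
      then show ?thesis
      proof
        assume "t \<subseteq> A1"
        then have "t \<subseteq> V \<or> t \<subseteq> D \<union> h ` D" using core[OF t(1) _ t' hDA] by blast
        then show ?thesis using indepD[OF spD(2) t(1)] hD DW unfolding W_def by blast
      next
        assume t2: "t \<subseteq> f1 ` A1"
        have fhD: "f1 ` h ` D \<subseteq> A"
          using extends_image[OF f1(2) D(4)] image_mono[OF D(4), of f] partial_involD(8)[OF f] A(3) by simp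
        have inv: "f1 ` f1 ` X = X" if "X \<subseteq> C1" for X by (rule partial_involD(9)[OF f1(1) that])
        have ft1: "f1 ` t \<subseteq> A1" using image_mono[OF t2, of f1] inv[OF C1(4)] by simp
        have "f1 ` W = W" using inv[of V] A1(3) C1(4) unfolding W_def image_Un by blast
        then have ft2: "f1 ` t \<subseteq> W \<union> f1 ` h ` D" using image_mono[OF t', of f1] by (simp add: image_Un)
        have "f1 ` t \<in> H" using t(1) partial_involD(3)[OF f1(1)] by (rule image_mem)
        from core[OF this ft1 ft2 fhD] have "f1 ` t \<subseteq> V \<or> f1 ` t \<subseteq> D \<union> f1 ` h ` D" .
        then have "f1 ` f1 ` t \<subseteq> f1 ` V \<or> f1 ` f1 ` t \<subseteq> f1 ` (D \<union> f1 ` h ` D)" by (metis image_mono)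
        moreover have "f1 ` f1 ` t = t" by (rule inv[OF t(3)])
        moreover have "f1 ` D \<subseteq> D"
        proof -
          have "f1 ` f1 ` B = B" using inv[of B] BV A1(3) C1(4) by blast
          then show ?thesis using fB unfolding D_def by (simp add: image_Un)
        qed
        moreover have "f1 ` f1 ` h ` D = h ` D" using inv[of "h ` D"] hDA A1(4) C1(4) by blast
        ultimately have "t \<subseteq> f1 ` V \<or> t \<subseteq> f1 ` D \<union> h ` D" "f1 ` D \<subseteq> D" by (simp_all add: image_Un)
        then have "t \<subseteq> f1 ` V \<or> t \<subseteq> D \<union> h ` D" by blast
        then show ?thesis using indepD[OF spD(2) t(1)] hD DW unfolding W_def by blast
      qed
    qed
    show ?thesis
      unfolding indep_def
    proof (intro ballI impI)
      fix t assume t: "t \<in> H" "t \<subseteq> W \<union> h2 ` W"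
      have inv: "h2 ` h2 ` X = X" if "X \<subseteq> C1 \<union> h2 ` C1" for X by (rule partial_involD(9)[OF h2(1) that])
      have tC: "t \<subseteq> C1 \<union> h2 ` C1" using t(2) W by blast
      from indepD[OF h2(4) t(1) this] show "t \<subseteq> W \<or> t \<subseteq> h2 ` W"
      proof
        assume "t \<subseteq> C1"
        then show ?thesis using main[OF t] DW by blast
      next
        assume t2: "t \<subseteq> h2 ` C1"
        have hC: "h2 ` h2 ` C1 = C1" and hW: "h2 ` h2 ` W = W" and hD': "h2 ` h2 ` D = D"
          using W DW by (auto intro!: inv)
        have ht1: "h2 ` t \<subseteq> C1" using image_mono[OF t2, of h2] hC by simp
        have ht2: "h2 ` t \<subseteq> W \<union> h2 ` W" using image_mono[OF t(2), of h2] hW by (auto simp: image_Un)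
        have "h2 ` t \<in> H" using t(1) partial_involD(3)[OF h2(1)] by (rule image_mem)
        from main[OF this ht2 ht1] have "h2 ` t \<subseteq> W \<or> h2 ` t \<subseteq> h2 ` D" .
        moreover have "h2 ` h2 ` t = t" by (rule inv[OF tC])
        ultimately have "t \<subseteq> h2 ` W \<or> t \<subseteq> D" using hD' by (metis image_mono)
        then show ?thesis using DW by blast
      qed
    qed
  qed
  ultimately have "spread f1 h2 V" using hV unfolding spread_def W_def by blast
  moreover have "\<forall>x\<in>U. k (h2 x) = h2 (k x)"
  proof
    fix x assume "x \<in> U"
    then have "h2 x = h x" "h2 (k x) = h1 (k x)"
      using extendsD(2)[OF eh] B(3) extendsD(2)[OF h2(2)] unfolding E1_def V_def by blast+
    then show "k (h2 x) = h2 (k x)" using h1(3) \<open>x \<in> U\<close> by simp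
  qed
  moreover have "V \<subseteq> C1" "V \<union> f1 ` V \<subseteq> C1 \<union> h2 ` C1" using W unfolding W_def by blast+
  ultimately show ?thesis using f1(1,2) h2(1) eh k(1,2) unfolding V_def by metis
qed

section \<open>Meeting countably many dense requirements\<close>

definition invol :: "nat \<Rightarrow> (nat \<Rightarrow> nat) \<Rightarrow> bool" where
  "invol a c \<longleftrightarrow> c \<in> G \<and> (\<forall>x. c (c x) = x) \<and> (\<forall>x. c x = x \<longleftrightarrow> x = a)"

definition dense_cond ::
  "nat \<Rightarrow> (nat set \<Rightarrow> (nat \<Rightarrow> nat) \<Rightarrow> nat set \<Rightarrow> (nat \<Rightarrow> nat) \<Rightarrow> bool) \<Rightarrow> bool" where
  "dense_cond a T \<longleftrightarrow> (\<forall>C f E h. partial_invol a C f \<and> partial_invol a E h \<longrightarrow>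
     (\<exists>C' f' E' h'. partial_invol a C' f' \<and> partial_invol a E' h' \<and>
       extends C f C' f' \<and> extends E h E' h' \<and> T C' f' E' h'))"

lemma limit_invol:
  assumes p: "\<And>n. partial_invol a (C n) (f n)" and ext: "\<And>n. extends (C n) (f n) (C (Suc n)) (f (Suc n))"
    and cov: "\<And>x. \<exists>n. x \<in> C n"
  shows "\<exists>c. invol a c \<and> (\<forall>n. \<forall>x\<in>C n. f n x = c x)"
proof -
  have mono: "extends (C m) (f m) (C n) (f n)" if "m \<le> n" for m n
    using that
  proof (induction n rule: dec_induct)
    case (step n)
    then show ?case using ext[of n] extends_trans by blast
  qed (rule extends_refl)
  obtain N where N: "\<And>x. x \<in> C (N x)" using cov by metis
  define c where "c x = f (N x) x" for x
  have c: "f n x = c x" if "x \<in> C n" for x n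
  proof -
    have "f (max n (N x)) x = f n x" by (rule extendsD(2)[OF mono[OF max.cobounded1] that])
    moreover have "f (max n (N x)) x = f (N x) x" by (rule extendsD(2)[OF mono[OF max.cobounded2] N])
    ultimately show ?thesis unfolding c_def by simp
  qed
  have inv: "c (c x) = x" for x
    using partial_involD(5)[OF p N, of x] partial_involD(6)[OF p N, of x] c[OF N, of x]
      c[of "f (N x) x" "N x"] by simp
  then have bc: "bij c" by (intro o_bij[of c]) auto
  have "c \<in> G"
  proof (rule closed[OF bc])
    fix S :: "nat set" assume S: "finite S"
    have "S \<subseteq> C (Max (insert 0 (N ` S)))"
    proof
      fix x assume "x \<in> S"
      then have "N x \<le> Max (insert 0 (N ` S))" using S by simp
      from extendsD(1)[OF mono[OF this]] N show "x \<in> C (Max (insert 0 (N ` S)))" by blast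
    qed
    then have "\<forall>x\<in>S. f (Max (insert 0 (N ` S))) x = c x" using c by blast
    then show "\<exists>g\<in>G. \<forall>x\<in>S. g x = c x" by (rule bexI[OF _ partial_involD(3)[OF p]])
  qed
  moreover have "c x = x \<longleftrightarrow> x = a" for x
    using partial_involD(4)[OF p[of "N x"]] partial_involD(7)[OF p N, of x] c[OF N, of x] by auto
  ultimately have "invol a c" using inv unfolding invol_def by simp
  then show ?thesis using c by (intro exI[of _ c]) simp
qed

text \<open>A Rasiowa-Sikorski construction. A requirement has to hold at one stage only and need
  not persist; it is exploited through the values of c and e on the domains of that stage. The
  requirements \<open>pts\<close> make the limits total.\<close>

lemma generic_sequence:
  assumes cTT: "countable TT" and dense: "\<And>T. T \<in> TT \<Longrightarrow> dense_cond a T"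
    and pts: "\<And>x::nat. (\<lambda>C f E h. x \<in> C \<inter> E) \<in> TT"
  shows "\<exists>c e. invol a c \<and> invol a e \<and> (\<forall>T\<in>TT. \<exists>C f E h. T C f E h \<and>
    (\<forall>x\<in>C. f x = c x) \<and> (\<forall>x\<in>E. h x = e x))"
proof -
  define Tn where "Tn = from_nat_into TT"
  have ne: "TT \<noteq> {}" using pts by blast
  have Tn: "Tn n \<in> TT" for n unfolding Tn_def using ne by (rule from_nat_into)
  define ok where "ok = (\<lambda>(C, f, E, h). partial_invol a C f \<and> partial_invol a E h)"
  define step where "step = (\<lambda>n (C, f, E, h) (C', f', E', h'). extends C f C' f' \<and> extends E h E' h' \<and> Tn n C' f' E' h')"
  have "ok ({a}, id, {a}, id)" unfolding ok_def partial_invol_def by (simp add: id_mem)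
  moreover have "\<exists>q. ok q \<and> step n p q" if "ok p" for p n
  proof -
    obtain C f E h where p: "p = (C, f, E, h)" by (cases p) auto
    then have "partial_invol a C f \<and> partial_invol a E h" using that unfolding ok_def by simp
    then obtain C' f' E' h' where "partial_invol a C' f'" "partial_invol a E' h'"
       "extends C f C' f'" "extends E h E' h'" "Tn n C' f' E' h'"
      using dense[OF Tn[of n]] unfolding dense_cond_def by metis
    then show ?thesis unfolding ok_def step_def p by (intro exI[of _ "(C', f', E', h')"]) simp
  qed
  ultimately have "\<exists>s. \<forall>n. ok (s n) \<and> step n (s n) (s (Suc n))"
    using dependent_nat_choice[of "\<lambda>_. ok" step] by blast
  then obtain s where s: "\<And>n. ok (s n)" "\<And>n. step n (s n) (s (Suc n))" by blast
  define C where "C n = fst (s n)" for n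
  define f where "f n = fst (snd (s n))" for n
  define E where "E n = fst (snd (snd (s n)))" for n
  define h where "h n = snd (snd (snd (s n)))" for n
  have sn: "s n = (C n, f n, E n, h n)" for n unfolding C_def f_def E_def h_def by simp
  have p: "partial_invol a (C n) (f n)" "partial_invol a (E n) (h n)" for n
    using s(1)[of n] unfolding sn ok_def by simp_all
  have e: "extends (C n) (f n) (C (Suc n)) (f (Suc n))" "extends (E n) (h n) (E (Suc n)) (h (Suc n))"
    "Tn n (C (Suc n)) (f (Suc n)) (E (Suc n)) (h (Suc n))" for n
    using s(2)[of n] unfolding sn step_def by simp_all
  have T: "\<exists>n. T (C n) (f n) (E n) (h n)" if T: "T \<in> TT" for T
  proof -
    obtain n where "Tn n = T" using from_nat_into_surj[OF cTT T] unfolding Tn_def by auto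
    then show ?thesis using e(3)[of n] by (intro exI[of _ "Suc n"]) simp
  qed
  have cov: "\<exists>n. x \<in> C n" "\<exists>n. x \<in> E n" for x using T[OF pts[of x]] by auto
  from limit_invol[of a C f, OF p(1) e(1) cov(1)]
  obtain c where c: "invol a c" "\<forall>n. \<forall>x\<in>C n. f n x = c x" by auto
  from limit_invol[of a E h, OF p(2) e(2) cov(2)]
  obtain d where d: "invol a d" "\<forall>n. \<forall>x\<in>E n. h n x = d x" by auto
  show ?thesis
  proof (rule exI[of _ c], rule exI[of _ d], intro conjI ballI)
    fix T assume "T \<in> TT"
    from T[OF this] obtain n where n: "T (C n) (f n) (E n) (h n)" by auto
    show "\<exists>C f E h. T C f E h \<and> (\<forall>x\<in>C. f x = c x) \<and> (\<forall>x\<in>E. h x = d x)"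
      by (rule exI[of _ "C n"], rule exI[of _ "f n"], rule exI[of _ "E n"], rule exI[of _ "h n"]) (simp add: n c(2) d(2))
  qed (fact c(1), fact d(1))
qed

text \<open>The extension property of a homogeneous structure that carries c as an additional
  operation. It makes back-and-forth inside the centraliser of c possible.\<close>

definition rich :: "nat \<Rightarrow> (nat \<Rightarrow> nat) \<Rightarrow> bool" where
  "rich a c \<longleftrightarrow> (\<forall>D U g. finite U \<and> a \<in> D \<and> D \<subseteq> U \<and> c ` D \<subseteq> D \<and> c ` U \<subseteq> U \<and> g \<in> G \<and>
     (\<forall>x\<in>D. g (c x) = c (g x)) \<longrightarrow> (\<exists>k\<in>G. (\<forall>x\<in>D. k x = g x) \<and> (\<forall>x\<in>U. k (c x) = c (k x))))"

text \<open>
  The requirements met by the construction. Each becomes void for an approximation that refutes its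
  hypotheses; this makes density a matter of a single extension step.
\<close>

definition forces_rich where
  "forces_rich a D U l C f \<longleftrightarrow> D \<subseteq> C \<and> U \<subseteq> C \<and> snd ` l \<subseteq> C \<and>
     (\<forall>g\<in>G. a \<in> D \<and> D \<subseteq> U \<and> f ` D \<subseteq> D \<and> f ` U \<subseteq> U \<and> (\<lambda>x. (x, g x)) ` D = l \<and>
       (\<forall>x\<in>D. g (f x) = f (g x)) \<longrightarrow>
       (\<exists>k\<in>G. (\<forall>x\<in>D. k x = g x) \<and> k ` U \<subseteq> C \<and> (\<forall>x\<in>U. k (f x) = f (k x))))"

definition forces_spread where
  "forces_spread S C f E h \<longleftrightarrow> (\<exists>B. finite B \<and> S \<subseteq> B \<and> B \<subseteq> C \<and> B \<union> f ` B \<subseteq> E \<and> spread f h B)"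

definition forces_free where
  "forces_free a D U C f E h \<longleftrightarrow> U \<subseteq> C \<and> D \<subseteq> E \<and>
    (a \<in> D \<and> D \<subseteq> U \<and> f ` D \<subseteq> D \<and> f ` U \<subseteq> U \<and> indep H D (h ` D) \<longrightarrow>
     (\<exists>k\<in>G. (\<forall>x\<in>D. k x = x) \<and> (\<forall>x\<in>U. k (f x) = f (k x)) \<and> k ` U \<subseteq> C \<inter> E \<and>
        k ` U \<inter> h ` k ` U = D \<inter> h ` D \<and> indep H (k ` U) (h ` k ` U)))"

definition forces_realize where
  "forces_realize a B U C f E h \<longleftrightarrow> U \<subseteq> E \<and> B \<subseteq> C \<and> f ` B \<subseteq> E \<and>
    (a \<in> B \<and> B \<subseteq> U \<and> h ` U \<subseteq> U \<and> spread f h B \<longrightarrow>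
     (\<exists>k\<in>G. (\<forall>x\<in>B. k x = x) \<and> (\<forall>x\<in>U. k (h x) = h (k x)) \<and> k ` U \<subseteq> C \<and> k ` U \<union> f ` k ` U \<subseteq> E \<and>
        spread f h (k ` U)))"

text \<open>Richness turns finite maps into centraliser elements. The clause on D prepares the two
  outer factors in \<open>realize_free\<close>; the existence of spread sets and the clause on B
  prepare the middle factor in \<open>spread_match\<close>.\<close>

definition generic_pair :: "nat \<Rightarrow> (nat \<Rightarrow> nat) \<Rightarrow> (nat \<Rightarrow> nat) \<Rightarrow> bool" where
  "generic_pair a c e \<longleftrightarrow> invol a c \<and> invol a e \<and> rich a c \<and> rich a e \<and>
    (\<forall>S. finite S \<longrightarrow> (\<exists>B. finite B \<and> S \<subseteq> B \<and> spread c e B)) \<and>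
    (\<forall>D U. finite U \<and> a \<in> D \<and> D \<subseteq> U \<and> c ` D \<subseteq> D \<and> c ` U \<subseteq> U \<and> indep H D (e ` D) \<longrightarrow>
      (\<exists>k\<in>G. (\<forall>x\<in>D. k x = x) \<and> (\<forall>x\<in>U. k (c x) = c (k x)) \<and>
         k ` U \<inter> e ` k ` U = D \<inter> e ` D \<and> indep H (k ` U) (e ` k ` U))) \<and>
    (\<forall>B U. finite U \<and> a \<in> B \<and> B \<subseteq> U \<and> e ` U \<subseteq> U \<and> spread c e B \<longrightarrow>
      (\<exists>k\<in>G. (\<forall>x\<in>B. k x = x) \<and> (\<forall>x\<in>U. k (e x) = e (k x)) \<and> spread c e (k ` U)))"

text \<open>The map g enters only through its finite graph l on D, which keeps the number of
  requirements countable. If the hypotheses hold for some g with this graph, one realisation serves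
  all of them.\<close>

lemma dense_rich:
  assumes fin: "finite D" "finite U" "finite l" and f: "partial_invol a C f"
  shows "\<exists>C' f'. partial_invol a C' f' \<and> extends C f C' f' \<and> forces_rich a D U l C' f'"
proof -
  obtain C1 f1 where f1: "partial_invol a C1 f1" "extends C f C1 f1" "D \<union> U \<union> snd ` l \<subseteq> C1"
    using extend_invol_domain[OF f, of "D \<union> U \<union> snd ` l"] fin by blast
  show ?thesis
  proof (cases "forces_rich a D U l C1 f1")
    case False
    then obtain g where g: "g \<in> G" "a \<in> D" "D \<subseteq> U" "f1 ` D \<subseteq> D" "f1 ` U \<subseteq> U" "(\<lambda>x. (x, g x)) ` D = l"
       "\<forall>x\<in>D. g (f1 x) = f1 (g x)"
      using f1(3) unfolding forces_rich_def by (meson Un_subset_iff)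
    have gD: "g ` D \<subseteq> C1" using g(6) f1(3) by force
    have U: "U \<subseteq> C1" using f1(3) by simp
    obtain k f2 where k: "k \<in> G" "\<forall>x\<in>D. k x = g x"
      and f2: "partial_invol a (C1 \<union> k ` U) f2" "\<forall>x\<in>C1. f2 x = f1 x" "\<forall>x\<in>U. f2 (k x) = k (f1 x)"
      using extend_invol_realize[OF f1(1) partial_involD(1)[OF f1(1)] order_refl g(2,3) U g(5,4,1) gD] g(7) by metis
    have kf: "k (f2 x) = f2 (k x)" if "x \<in> U" for x using f2(2,3) U that by (metis subsetD)
    have "forces_rich a D U l (C1 \<union> k ` U) f2"
      unfolding forces_rich_def
    proof (intro conjI ballI impI)
      fix g' assume "g' \<in> G" and "a \<in> D \<and> D \<subseteq> U \<and> f2 ` D \<subseteq> D \<and> f2 ` U \<subseteq> U \<and> (\<lambda>x. (x, g' x)) ` D = l \<and>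
       (\<forall>x\<in>D. g' (f2 x) = f2 (g' x))"
      then have "(\<lambda>x. (x, g' x)) ` D = (\<lambda>x. (x, g x)) ` D" using g(6) by simp
      then have "\<forall>x\<in>D. g' x = g x" by (auto simp: set_eq_iff image_iff)
      then show "\<exists>ka\<in>G. (\<forall>x\<in>D. ka x = g' x) \<and> ka ` U \<subseteq> C1 \<union> k ` U \<and> (\<forall>x\<in>U. ka (f2 x) = f2 (ka x))"
        using k kf by (intro bexI[of _ k]) auto
    qed (use f1(3) in auto)
    moreover have "extends C1 f1 (C1 \<union> k ` U) f2" using f2(2) unfolding extends_def by simp
    then have "extends C f (C1 \<union> k ` U) f2" by (rule extends_trans[OF f1(2)])
    ultimately show ?thesis using f2(1) by blast
  qed (use f1 in blast)
qed

lemma dense_forces_rich: 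
  assumes "finite D" "finite U" "finite l"
  shows "dense_cond a (\<lambda>C f E h. forces_rich a D U l C f)" "dense_cond a (\<lambda>C f E h. forces_rich a D U l E h)"
  using dense_rich[OF assms] extends_refl unfolding dense_cond_def by metis+

lemma dense_points: "dense_cond a (\<lambda>C f E h. x \<in> C \<inter> E)"
  unfolding dense_cond_def
proof (intro allI impI)
  fix C f E h assume "partial_invol a C f \<and> partial_invol a E h"
  then obtain C' f' E' h' where "partial_invol a C' f'" "extends C f C' f'" "{x} \<subseteq> C'"
    "partial_invol a E' h'" "extends E h E' h'" "{x} \<subseteq> E'"
    using extend_invol_domain[of a C f "{x}"] extend_invol_domain[of a E h "{x}"] by (metis finite.simps)
  then show "\<exists>C' f' E' h'. partial_invol a C' f' \<and> partial_invol a E' h' \<and>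
       extends C f C' f' \<and> extends E h E' h' \<and> x \<in> C' \<inter> E'" by blast
qed

lemma dense_forces_spread:
  assumes "finite S"
  shows "dense_cond a (forces_spread S)"
  using extend_spread[OF _ _ assms] unfolding dense_cond_def forces_spread_def by metis

lemma dense_forces_free:
  assumes "finite D" "finite U"
  shows "dense_cond a (forces_free a D U)"
  unfolding dense_cond_def
proof (intro allI impI)
  fix C f E h assume fh: "partial_invol a C f \<and> partial_invol a E h"
  obtain C1 f1 where f1: "partial_invol a C1 f1" "extends C f C1 f1" "U \<subseteq> C1"
    using extend_invol_domain[of a C f U] fh assms by blast
  obtain E1 h1 where h1: "partial_invol a E1 h1" "extends E h E1 h1" "D \<subseteq> E1"
    using extend_invol_domain[of a E h D] fh assms by blast
  show "\<exists>C' f' E' h'. partial_invol a C' f' \<and> partial_invol a E' h' \<and>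
       extends C f C' f' \<and> extends E h E' h' \<and> forces_free a D U C' f' E' h'"
  proof (cases "forces_free a D U C1 f1 E1 h1")
    case False
    then have hyp: "a \<in> D" "D \<subseteq> U" "f1 ` D \<subseteq> D" "f1 ` U \<subseteq> U" "indep H D (h1 ` D)"
      using f1(3) h1(3) unfolding forces_free_def by blast+
    obtain C2 f2 E2 h2 k where 2: "partial_invol a C2 f2" "partial_invol a E2 h2" "extends C1 f1 C2 f2"
      "extends E1 h1 E2 h2" and k: "k \<in> G" "\<forall>x\<in>D. k x = x" "\<forall>x\<in>U. k (f2 x) = f2 (k x)"
      "k ` U \<subseteq> C2 \<inter> E2" "k ` U \<inter> h2 ` k ` U = D \<inter> h2 ` D" "indep H (k ` U) (h2 ` k ` U)"
      using extend_realize_free[OF f1(1) h1(1) hyp(1,2) f1(3) h1(3) hyp(4,3,5)] by metis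
    have "U \<subseteq> C2" "D \<subseteq> E2" using f1(3) h1(3) extendsD(1)[OF 2(3)] extendsD(1)[OF 2(4)] by simp_all
    then have "forces_free a D U C2 f2 E2 h2" using k unfolding forces_free_def by blast
    then show ?thesis using 2 extends_trans[OF f1(2) 2(3)] extends_trans[OF h1(2) 2(4)] by blast
  qed (use f1 h1 in blast)
qed

text \<open>\<open>extend_realize_spread\<close> needs f decided on B, then h decided on B and its
  f-image, then the h-image of these in the domain of f; hence the three preliminary
  extensions.\<close>

lemma dense_forces_realize:
  assumes "finite B" "finite U"
  shows "dense_cond a (forces_realize a B U)"
  unfolding dense_cond_def
proof (intro allI impI)
  fix C f E h assume fh: "partial_invol a C f \<and> partial_invol a E h"
  obtain C1 f1 where f1: "partial_invol a C1 f1" "extends C f C1 f1" "B \<subseteq> C1"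
    using extend_invol_domain[of a C f B] fh assms by blast
  have "finite (U \<union> B \<union> f1 ` B)" using assms by simp
  then obtain E1 h1 where h1: "partial_invol a E1 h1" "extends E h E1 h1" "U \<union> B \<union> f1 ` B \<subseteq> E1"
    using extend_invol_domain[of a E h "U \<union> B \<union> f1 ` B"] fh by metis
  have "finite (h1 ` (B \<union> f1 ` B))" using assms by simp
  then obtain C2 f2 where f2: "partial_invol a C2 f2" "extends C1 f1 C2 f2" "h1 ` (B \<union> f1 ` B) \<subseteq> C2"
    using extend_invol_domain[OF f1(1)] by metis
  have fB: "f2 ` B = f1 ` B" by (rule extends_image[OF f2(2) f1(3)])
  have BC: "B \<subseteq> C2" using f1(3) extendsD(1)[OF f2(2)] by simp
  have UE: "U \<subseteq> E1" "f2 ` B \<subseteq> E1" using h1(3) fB by simp_all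
  show "\<exists>C' f' E' h'. partial_invol a C' f' \<and> partial_invol a E' h' \<and>
       extends C f C' f' \<and> extends E h E' h' \<and> forces_realize a B U C' f' E' h'"
  proof (cases "forces_realize a B U C2 f2 E1 h1")
    case True
    then show ?thesis using f2(1) h1(1,2) extends_trans[OF f1(2) f2(2)] by blast
  next
    case False
    then have hyp: "a \<in> B" "B \<subseteq> U" "h1 ` U \<subseteq> U" "spread f2 h1 B"
      using UE BC unfolding forces_realize_def by blast+
    have hB: "h1 ` (B \<union> f2 ` B) \<subseteq> C2" using f2(3) fB by simp
    obtain C3 f3 E3 h3 k where 3: "partial_invol a C3 f3" "partial_invol a E3 h3" "extends C2 f2 C3 f3"
      "extends E1 h1 E3 h3" and k: "k \<in> G" "\<forall>x\<in>B. k x = x" "\<forall>x\<in>U. k (h3 x) = h3 (k x)"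
      "k ` U \<subseteq> C3" "k ` U \<union> f3 ` k ` U \<subseteq> E3" "spread f3 h3 (k ` U)"
      using extend_realize_spread[OF f2(1) h1(1) hyp(1,2) UE(1) BC UE(2) hB hyp(3,4)] by metis
    have "U \<subseteq> E3" "B \<subseteq> C3" "f3 ` B \<subseteq> E3"
      using UE BC extendsD(1)[OF 3(3)] extendsD(1)[OF 3(4)] extends_image[OF 3(3) BC] by simp_all
    then have "forces_realize a B U C3 f3 E3 h3" using k unfolding forces_realize_def by blast
    then show ?thesis
      using 3 extends_trans[OF f1(2) extends_trans[OF f2(2) 3(3)]] extends_trans[OF h1(2) 3(4)] by blast
  qed
qed

lemma spread_cong:
  assumes "spread f h B" "\<forall>x\<in>B. f x = c x" "\<forall>x\<in>B \<union> f ` B. h x = e x"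
  shows "spread c e B"
proof -
  have "f ` B = c ` B" using assms(2) by (simp cong: image_cong)
  moreover have "h ` B = e ` B" "h ` (B \<union> f ` B) = e ` (B \<union> f ` B)" using assms(3) by (auto intro!: image_cong)
  ultimately show ?thesis using assms(1) unfolding spread_def by simp
qed

lemma ex_generic_pair: "\<exists>c e. generic_pair a c e"
proof -
  define FF where "FF = {X :: nat set. finite X}"
  define LL where "LL = {X :: (nat \<times> nat) set. finite X}"
  have cnt: "countable FF" "countable LL" unfolding FF_def LL_def by (rule countable_Collect_finite)+
  define TT where "TT = range (\<lambda>x C (f :: nat \<Rightarrow> nat) E (h :: nat \<Rightarrow> nat). x \<in> C \<inter> E)
    \<union> (\<lambda>(D, U, l) C f E h. forces_rich a D U l C f) ` (FF \<times> FF \<times> LL)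
    \<union> (\<lambda>(D, U, l) C f E h. forces_rich a D U l E h) ` (FF \<times> FF \<times> LL)
    \<union> forces_spread ` FF \<union> (\<lambda>(D, U). forces_free a D U) ` (FF \<times> FF) \<union> (\<lambda>(B, U). forces_realize a B U) ` (FF \<times> FF)"
  have cTT: "countable TT" unfolding TT_def using cnt by simp
  have dTT: "dense_cond a T" if "T \<in> TT" for T
    using that dense_points dense_forces_rich dense_forces_spread dense_forces_free dense_forces_realize
    unfolding TT_def FF_def LL_def by (elim UnE imageE) auto
  have pTT: "(\<lambda>C f E h. x \<in> C \<inter> E) \<in> TT" for x unfolding TT_def by blast
  have "\<exists>c e. invol a c \<and> invol a e \<and> (\<forall>T\<in>TT. \<exists>C f E h. T C f E h \<and> (\<forall>x\<in>C. f x = c x) \<and> (\<forall>x\<in>E. h x = e x))"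
    by (rule generic_sequence[OF cTT dTT pTT])
  then obtain c e where
    ce0: "invol a c \<and> invol a e \<and> (\<forall>T\<in>TT. \<exists>C f E h. T C f E h \<and> (\<forall>x\<in>C. f x = c x) \<and> (\<forall>x\<in>E. h x = e x))"
    by (elim exE) (rule that)
  then have ce: "invol a c" "invol a e"
    and dec: "\<And>T. T \<in> TT \<Longrightarrow> \<exists>C f E h. T C f E h \<and> (\<forall>x\<in>C. f x = c x) \<and> (\<forall>x\<in>E. h x = e x)"
    by simp_all
  \<comment> \<open>All points at which the requirement evaluates f lie in the domain C, where f
    equals c. So its hypotheses and its conclusion can be read for c.\<close>
  have rich1: "\<exists>k\<in>G. (\<forall>x\<in>D. k x = g x) \<and> (\<forall>x\<in>U. k (c x) = c (k x))"
    if T: "forces_rich a D U ((\<lambda>x. (x, g x)) ` D) C f" "\<forall>x\<in>C. f x = c x"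
      and h: "finite U" "a \<in> D" "D \<subseteq> U" "c ` D \<subseteq> D" "c ` U \<subseteq> U" "g \<in> G" "\<forall>x\<in>D. g (c x) = c (g x)"
    for c D U g C f
  proof -
    have DU: "D \<subseteq> C" "U \<subseteq> C" "g ` D \<subseteq> C" using T(1) unfolding forces_rich_def by (auto simp: image_image)
    have eq: "\<And>x. x \<in> C \<Longrightarrow> f x = c x" using T(2) by simp
    have "f ` D \<subseteq> D" "f ` U \<subseteq> U" "\<forall>x\<in>D. g (f x) = f (g x)"
      using h DU eq by (auto simp: subset_iff image_iff)
    then obtain k where "k \<in> G" "\<forall>x\<in>D. k x = g x" "k ` U \<subseteq> C" "\<forall>x\<in>U. k (f x) = f (k x)"
      using T(1) h unfolding forces_rich_def by metis
    then show ?thesis using DU eq by (intro bexI[of _ k]) (auto simp: subset_iff image_iff)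
  qed
  have "rich a c"
    unfolding rich_def
  proof (intro allI impI)
    fix D U g
    assume h: "finite U \<and> a \<in> D \<and> D \<subseteq> U \<and> c ` D \<subseteq> D \<and> c ` U \<subseteq> U \<and> g \<in> G \<and> (\<forall>x\<in>D. g (c x) = c (g x))"
    then have "(D, U, (\<lambda>x. (x, g x)) ` D) \<in> FF \<times> FF \<times> LL" unfolding FF_def LL_def by (auto intro: finite_subset)
    then have "(\<lambda>(D, U, l) C f E h. forces_rich a D U l C f) (D, U, (\<lambda>x. (x, g x)) ` D) \<in> TT"
      unfolding TT_def by (blast intro: imageI)
    from dec[OF this] obtain C f where "forces_rich a D U ((\<lambda>x. (x, g x)) ` D) C f" "\<forall>x\<in>C. f x = c x" by auto
    then show "\<exists>k\<in>G. (\<forall>x\<in>D. k x = g x) \<and> (\<forall>x\<in>U. k (c x) = c (k x))"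
      using h by (intro rich1) auto
  qed
  moreover have "rich a e"
    unfolding rich_def
  proof (intro allI impI)
    fix D U g
    assume h': "finite U \<and> a \<in> D \<and> D \<subseteq> U \<and> e ` D \<subseteq> D \<and> e ` U \<subseteq> U \<and> g \<in> G \<and> (\<forall>x\<in>D. g (e x) = e (g x))"
    then have "(D, U, (\<lambda>x. (x, g x)) ` D) \<in> FF \<times> FF \<times> LL" unfolding FF_def LL_def by (auto intro: finite_subset)
    then have "(\<lambda>(D, U, l) C f E h. forces_rich a D U l E h) (D, U, (\<lambda>x. (x, g x)) ` D) \<in> TT"
      unfolding TT_def by (blast intro: imageI)
    from dec[OF this] obtain E h where "forces_rich a D U ((\<lambda>x. (x, g x)) ` D) E h" "\<forall>x\<in>E. h x = e x" by auto
    then show "\<exists>k\<in>G. (\<forall>x\<in>D. k x = g x) \<and> (\<forall>x\<in>U. k (e x) = e (k x))"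
      using h' by (intro rich1) auto
  qed
  moreover have "\<exists>B. finite B \<and> S \<subseteq> B \<and> spread c e B" if "finite S" for S
  proof -
    have "forces_spread S \<in> TT" using that unfolding TT_def FF_def by blast
    from dec[OF this] obtain C f E h where "forces_spread S C f E h" "\<forall>x\<in>C. f x = c x" "\<forall>x\<in>E. h x = e x" by auto
    then show ?thesis unfolding forces_spread_def using spread_cong by (metis subsetD)
  qed
  moreover have "\<exists>k\<in>G. (\<forall>x\<in>D. k x = x) \<and> (\<forall>x\<in>U. k (c x) = c (k x)) \<and>
         k ` U \<inter> e ` k ` U = D \<inter> e ` D \<and> indep H (k ` U) (e ` k ` U)"
    if hyp: "finite U" "a \<in> D" "D \<subseteq> U" "c ` D \<subseteq> D" "c ` U \<subseteq> U" "indep H D (e ` D)" for D U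
  proof -
    have "(D, U) \<in> FF \<times> FF" using hyp(1,3) unfolding FF_def by (auto intro: finite_subset)
    then have "(\<lambda>(D, U). forces_free a D U) (D, U) \<in> TT" unfolding TT_def by (blast intro: imageI)
    from dec[OF this] obtain C f E h where T: "forces_free a D U C f E h" "\<forall>x\<in>C. f x = c x" "\<forall>x\<in>E. h x = e x" by auto
    have im: "f ` X = c ` X" if "X \<subseteq> C" for X using T(2) that by (auto intro!: image_cong)
    have imh: "h ` X = e ` X" if "X \<subseteq> E" for X using T(3) that by (auto intro!: image_cong)
    have U: "U \<subseteq> C" "D \<subseteq> E" using T(1) unfolding forces_free_def by simp_all
    then have DC: "D \<subseteq> C" using hyp(3) by simp
    have "\<exists>k\<in>G. (\<forall>x\<in>D. k x = x) \<and> (\<forall>x\<in>U. k (f x) = f (k x)) \<and> k ` U \<subseteq> C \<inter> E \<and>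
        k ` U \<inter> h ` k ` U = D \<inter> h ` D \<and> indep H (k ` U) (h ` k ` U)"
      using T(1) hyp(2-) im[OF U(1)] im[OF DC] imh[OF U(2)] unfolding forces_free_def by simp
    then obtain k where k: "k \<in> G" "\<forall>x\<in>D. k x = x" "\<forall>x\<in>U. k (f x) = f (k x)" "k ` U \<subseteq> C \<inter> E"
        "k ` U \<inter> h ` k ` U = D \<inter> h ` D" "indep H (k ` U) (h ` k ` U)"
      by metis
    have "\<forall>x\<in>U. k (c x) = c (k x)" using k(3,4) T(2) U(1) by (metis IntD1 image_subset_iff subsetD)
    then show ?thesis using k imh[OF U(2)] imh[of "k ` U"] by (intro bexI[of _ k]) auto
  qed
  moreover have "\<exists>k\<in>G. (\<forall>x\<in>B. k x = x) \<and> (\<forall>x\<in>U. k (e x) = e (k x)) \<and> spread c e (k ` U)"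
    if hyp: "finite U" "a \<in> B" "B \<subseteq> U" "e ` U \<subseteq> U" "spread c e B" for B U
  proof -
    have "(B, U) \<in> FF \<times> FF" using hyp(1,3) unfolding FF_def by (auto intro: finite_subset)
    then have "(\<lambda>(B, U). forces_realize a B U) (B, U) \<in> TT" unfolding TT_def by (blast intro: imageI)
    from dec[OF this] obtain C f E h where T: "forces_realize a B U C f E h" "\<forall>x\<in>C. f x = c x" "\<forall>x\<in>E. h x = e x" by auto
    have U: "U \<subseteq> E" "B \<subseteq> C" "f ` B \<subseteq> E" using T(1) unfolding forces_realize_def by simp_all
    have im: "f ` B = c ` B" using U(2) T(2) by (auto intro!: image_cong)
    have "h ` U = e ` U" using U(1) T(3) by (auto intro!: image_cong)
    moreover have "spread f h B" by (rule spread_cong[OF hyp(5)]) (use U T hyp(3) im in auto)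
    ultimately have "\<exists>k\<in>G. (\<forall>x\<in>B. k x = x) \<and> (\<forall>x\<in>U. k (h x) = h (k x)) \<and> k ` U \<subseteq> C \<and>
        k ` U \<union> f ` k ` U \<subseteq> E \<and> spread f h (k ` U)"
      using T(1) hyp(2-4) unfolding forces_realize_def by simp
    then obtain k where k: "k \<in> G" "\<forall>x\<in>B. k x = x" "\<forall>x\<in>U. k (h x) = h (k x)" "k ` U \<subseteq> C"
        "k ` U \<union> f ` k ` U \<subseteq> E" "spread f h (k ` U)"
      by metis
    have "\<forall>x\<in>U. k (e x) = e (k x)" using k(3,5) T(3) U(1) by (metis Un_subset_iff image_subset_iff subsetD)
    moreover have "spread c e (k ` U)" by (rule spread_cong[OF k(6)]) (use k(4,5) T(2,3) in blast)+
    ultimately show ?thesis using k(1,2) by blast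
  qed
  ultimately have "generic_pair a c e" using ce(1,2) unfolding generic_pair_def by simp
  then show ?thesis by (intro exI)
qed

end

section \<open>Products of centralisers\<close>

context perm_group
begin

definition centralizer :: "(nat \<Rightarrow> nat) \<Rightarrow> (nat \<Rightarrow> nat) set" where
  "centralizer c = {y \<in> G. \<forall>x. y (c x) = c (y x)}"

lemma centralizerD: "y \<in> centralizer c \<Longrightarrow> y \<in> G" "y \<in> centralizer c \<Longrightarrow> y (c x) = c (y x)"
  by (simp_all add: centralizer_def)

lemma centralizer_pinv: "y \<in> centralizer c \<Longrightarrow> pinv y \<in> centralizer c"
  unfolding centralizer_def by (auto simp: pinv_mem) (metis pinv_left pinv_right)

lemma closed_centralizer: "closed_in_G (centralizer c)"
  unfolding closed_in_G_def
proof (intro conjI ballI impI)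
  show "centralizer c \<subseteq> G" by (auto simp: centralizer_def)
  fix f assume f: "f \<in> G" "\<forall>S. finite S \<longrightarrow> (\<exists>g\<in>centralizer c. \<forall>x\<in>S. g x = f x)"
  have "f (c x) = c (f x)" for x
  proof -
    have "finite {x, c x}" by simp
    then obtain g where "g \<in> centralizer c" "\<forall>z\<in>{x, c x}. g z = f z" using f(2) by metis
    then have "g \<in> centralizer c" "g x = f x" "g (c x) = f (c x)" by simp_all
    then show ?thesis using centralizerD(2)[of g c x] by metis
  qed
  then show "f \<in> centralizer c" using f(1) by (simp add: centralizer_def)
qed

end

context free_perm_group
begin

lemma involD: "invol a c \<Longrightarrow> c \<in> G" "invol a c \<Longrightarrow> c (c x) = x" "invol a c \<Longrightarrow> c x = x \<longleftrightarrow> x = a"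
  by (simp_all add: invol_def)

lemma centralizer_fixes:
  assumes "invol a c" "y \<in> centralizer c"
  shows "y a = a"
  using involD(3)[OF assms(1)] centralizerD(2)[OF assms(2), of a] by metis

section \<open>Back-and-forth in a centraliser\<close>

definition equivariant :: "nat \<Rightarrow> (nat \<Rightarrow> nat) \<Rightarrow> nat set \<Rightarrow> (nat \<Rightarrow> nat) \<Rightarrow> bool" where
  "equivariant a c D g \<longleftrightarrow> finite D \<and> a \<in> D \<and> c ` D \<subseteq> D \<and> g \<in> G \<and> (\<forall>x\<in>D. g (c x) = c (g x))"

lemma richD:
  assumes "rich a c" "finite U" "a \<in> D" "D \<subseteq> U" "c ` D \<subseteq> D" "c ` U \<subseteq> U" "g \<in> G" "\<forall>x\<in>D. g (c x) = c (g x)"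
  shows "\<exists>k\<in>G. (\<forall>x\<in>D. k x = g x) \<and> (\<forall>x\<in>U. k (c x) = c (k x))"
  using assms unfolding rich_def by simp

lemma equivariant_step:
  assumes c: "invol a c" "rich a c" and g: "equivariant a c D g"
  shows "\<exists>U k. equivariant a c U k \<and> D \<subseteq> U \<and> n \<in> U \<and> (\<forall>x\<in>D. k x = g x)"
proof -
  define U where "U = D \<union> {n, c n}"
  have g': "finite D" "a \<in> D" "c ` D \<subseteq> D" "g \<in> G" "\<forall>x\<in>D. g (c x) = c (g x)"
    using g unfolding equivariant_def by simp_all
  have U: "finite U" "D \<subseteq> U" "c ` U \<subseteq> U" "n \<in> U"
    using g' involD(2)[OF c(1)] unfolding U_def by auto
  then have "\<exists>k\<in>G. (\<forall>x\<in>D. k x = g x) \<and> (\<forall>x\<in>U. k (c x) = c (k x))"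
    by (intro richD[OF c(2)] g')
  then obtain k where "k \<in> G" "\<forall>x\<in>D. k x = g x" "\<forall>x\<in>U. k (c x) = c (k x)" by auto
  then show ?thesis using U g'(2) unfolding equivariant_def by (intro exI[of _ U] exI[of _ k]) auto
qed

lemma equivariant_inverse:
  assumes c: "invol a c" and g: "equivariant a c D g"
  shows "equivariant a c (g ` D) (pinv g)"
proof -
  have g': "finite D" "a \<in> D" "c ` D \<subseteq> D" "g \<in> G" "\<forall>x\<in>D. g (c x) = c (g x)"
    using g unfolding equivariant_def by simp_all
  have "g a = a" using g'(2,5) involD(3)[OF c] by metis
  then have "a \<in> g ` D" using g'(2) by (metis imageI)
  moreover have "c ` g ` D \<subseteq> g ` D" using g'(3,5) by (auto simp: image_iff subset_iff) metis
  moreover have "pinv g (c y) = c (pinv g y)" if y: "y \<in> g ` D" for y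
  proof -
    obtain x where x: "x \<in> D" "y = g x" using y by blast
    then have "c y = g (c x)" using g'(5) by simp
    then show ?thesis using x g'(4) by simp
  qed
  ultimately show ?thesis using g'(1,4) pinv_mem unfolding equivariant_def by simp
qed

text \<open>Richness is one-sided, but the inverse of an equivariant map is equivariant: extend,
  invert, extend again, invert back.\<close>

lemma equivariant_step_both:
  assumes c: "invol a c" "rich a c" and g: "equivariant a c D g"
  shows "\<exists>U k. equivariant a c U k \<and> D \<subseteq> U \<and> n \<in> U \<and> n \<in> k ` U \<and> (\<forall>x\<in>D. k x = g x)"
proof -
  obtain U k where k: "equivariant a c U k" "D \<subseteq> U" "n \<in> U" "\<forall>x\<in>D. k x = g x"
    using equivariant_step[OF assms, of n] by auto
  obtain V l where l: "equivariant a c V l" "k ` U \<subseteq> V" "n \<in> V" "\<forall>x\<in>k ` U. l x = pinv k x"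
    using equivariant_step[OF c equivariant_inverse[OF c(1) k(1)], of n] by auto
  have kG: "k \<in> G" and lG: "l \<in> G" using k(1) l(1) unfolding equivariant_def by simp_all
  have lk: "l (k x) = x" if "x \<in> U" for x using l(4) that kG by simp
  have "x \<in> l ` V" if "x \<in> U" for x using lk[OF that] that l(2) by (metis image_subset_iff imageI)
  moreover have "pinv l x = k x" if "x \<in> U" for x using lk[OF that] lG by (intro pinv_eq)
  moreover have "n \<in> pinv l ` l ` V" using l(3) lG by (simp add: image_image)
  ultimately show ?thesis using equivariant_inverse[OF c(1) l(1)] k(2-4)
    by (intro exI[of _ "l ` V"] exI[of _ "pinv l"]) (auto simp: subset_iff)
qed

text \<open>The union of a back-and-forth chain is a permutation commuting with c, and it lies in
  \<open>G\<close> by closedness. All later centraliser elements are produced from finite maps in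
  this way.\<close>

lemma equivariant_extends:
  assumes c: "invol a c" "rich a c" and g: "equivariant a c D g"
  shows "\<exists>y\<in>centralizer c. \<forall>x\<in>D. y x = g x"
proof -
  define ok where "ok = (\<lambda>(U, k). equivariant a c U k)"
  define step where "step = (\<lambda>(n::nat) (D, g) (U, k). D \<subseteq> U \<and> n \<in> U \<and> n \<in> k ` U \<and> (\<forall>x\<in>D. k x = (g x :: nat)))"
  have "\<exists>q. ok q \<and> step n p q" if "ok p" for n p
  proof -
    obtain D g where p: "p = (D, g)" by (cases p)
    then have "equivariant a c D g" using that unfolding ok_def by simp
    then obtain U k where "equivariant a c U k" "D \<subseteq> U" "n \<in> U" "n \<in> k ` U" "\<forall>x\<in>D. k x = g x"
      using equivariant_step_both[OF c, of D g n] by auto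
    then show ?thesis unfolding ok_def step_def p by (intro exI[of _ "(U, k)"]) simp
  qed
  moreover have "ok (D, g)" using g unfolding ok_def by simp
  ultimately have "\<exists>s. \<forall>n. (ok (s n) \<and> (n = 0 \<longrightarrow> s n = (D, g))) \<and> step n (s n) (s (Suc n))"
    by (intro dependent_nat_choice) auto
  then obtain s where s: "\<And>n. ok (s n)" "s 0 = (D, g)" "\<And>n. step n (s n) (s (Suc n))" by blast
  define U where "U n = fst (s n)" for n
  define k where "k n = snd (s n)" for n
  have sn: "s n = (U n, k n)" for n unfolding U_def k_def by simp
  have eq: "equivariant a c (U n) (k n)" for n using s(1)[of n] unfolding sn ok_def by simp
  have st: "U n \<subseteq> U (Suc n)" "n \<in> U (Suc n)" "n \<in> k (Suc n) ` U (Suc n)" "\<forall>x\<in>U n. k (Suc n) x = k n x" for n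
    using s(3)[of n] unfolding sn step_def by simp_all
  have kG: "k n \<in> G" for n using eq[of n] unfolding equivariant_def by simp
  have mono: "extends (U m) (k m) (U n) (k n)" if "m \<le> n" for m n
    using that
  proof (induction n rule: dec_induct)
    case (step n)
    have "extends (U n) (k n) (U (Suc n)) (k (Suc n))" using st[of n] unfolding extends_def by simp
    then show ?case by (rule extends_trans[OF step.IH])
  qed (rule extends_refl)
  \<comment> \<open>By stage \<open>Suc x\<close> the point x has entered the domain, so its value
    is final.\<close>
  define y where "y x = k (Suc x) x" for x
  have y: "y x = k n x" if "x \<in> U n" for x n
    using extendsD(2)[OF mono[OF max.cobounded1[of n "Suc x"]] that]
      extendsD(2)[OF mono[OF max.cobounded2[of "Suc x" n]] st(2)] unfolding y_def by simp
  have fin: "\<exists>n. S \<subseteq> U n" if S: "finite S" for S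
  proof -
    obtain n where n: "\<forall>x\<in>S. x < n" using S finite_nat_set_iff_bounded by auto
    have "x \<in> U n" if "x \<in> S" for x
    proof -
      have "Suc x \<le> n" using n that by (simp add: Suc_le_eq)
      from extendsD(1)[OF mono[OF this]] st(2)[of x] show ?thesis by blast
    qed
    then show ?thesis by blast
  qed
  have "inj y"
  proof (rule injI)
    fix p q assume "y p = y q"
    obtain n where "{p, q} \<subseteq> U n" using fin[of "{p, q}"] by auto
    then have "k n p = k n q" using \<open>y p = y q\<close> y[of p n] y[of q n] by simp
    then show "p = q" using inj_mem[OF kG] by blast
  qed
  moreover have "\<exists>x. y x = n" for n
    using st(3)[of n] y[of _ "Suc n"] by (metis imageE)
  then have "surj y" unfolding surj_def by metis
  ultimately have bij_y: "bij y" by (rule bijI)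
  have "y \<in> G"
  proof (rule closed[OF bij_y])
    fix S :: "nat set" assume "finite S"
    then obtain n where "S \<subseteq> U n" using fin by metis
    then have "\<forall>x\<in>S. k n x = y x" using y by (metis subsetD)
    then show "\<exists>g\<in>G. \<forall>x\<in>S. g x = y x" by (rule bexI[OF _ kG])
  qed
  moreover have "y (c x) = c (y x)" for x
  proof -
    obtain n where n: "{x} \<subseteq> U n" using fin[of "{x}"] by auto
    then have "c x \<in> U n" using eq[of n] unfolding equivariant_def by blast
    then show ?thesis using n y[of x n] y[of "c x" n] eq[of n] unfolding equivariant_def by simp
  qed
  moreover have "y x = g x" if "x \<in> D" for x using y[of x 0] that s(2) unfolding U_def k_def by simp
  ultimately show ?thesis unfolding centralizer_def by blast
qed

section \<open>The product of three centralisers is non-meager\<close>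

lemma generic_pairD:
  assumes "generic_pair a c e"
  shows "invol a c" "invol a e" "rich a c" "rich a e"
    "finite S \<Longrightarrow> \<exists>B. finite B \<and> S \<subseteq> B \<and> spread c e B"
    "finite U \<Longrightarrow> a \<in> D \<Longrightarrow> D \<subseteq> U \<Longrightarrow> c ` D \<subseteq> D \<Longrightarrow> c ` U \<subseteq> U \<Longrightarrow> indep H D (e ` D) \<Longrightarrow>
      \<exists>k\<in>G. (\<forall>x\<in>D. k x = x) \<and> (\<forall>x\<in>U. k (c x) = c (k x)) \<and>
         k ` U \<inter> e ` k ` U = D \<inter> e ` D \<and> indep H (k ` U) (e ` k ` U)"
    "finite U \<Longrightarrow> a \<in> B \<Longrightarrow> B \<subseteq> U \<Longrightarrow> e ` U \<subseteq> U \<Longrightarrow> spread c e B \<Longrightarrow>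
      \<exists>k\<in>G. (\<forall>x\<in>B. k x = x) \<and> (\<forall>x\<in>U. k (e x) = e (k x)) \<and> spread c e (k ` U)"
  using assms unfolding generic_pair_def by simp_all

text \<open>An element of C(e) need not carry spread sets to spread sets, as it ignores c. So y is
  replaced by p: a spread set D is chosen around the y-image of a spread set \<open>B1\<close>; the
  preimage U of D is e-closed and is moved over \<open>B1\<close> to a spread set by some k
  commuting with e on U; then p = y \<circ> pinv k.\<close>

lemma spread_match:
  assumes gp: "generic_pair a c e" and y: "y \<in> centralizer e" and S: "finite S" "a \<in> S"
  shows "\<exists>B p. finite B \<and> p \<in> G \<and> S \<subseteq> B \<and> S \<subseteq> p ` B \<and> spread c e B \<and> spread c e (p ` B) \<and>
    (\<forall>x\<in>B. p (e x) = e (p x)) \<and> (\<forall>x\<in>S. p x = y x)"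
proof -
  note g = generic_pairD[OF gp]
  have yG: "y \<in> G" by (rule centralizerD(1)[OF y])
  obtain B1 where B1: "finite B1" "S \<subseteq> B1" "spread c e B1" using g(5)[OF S(1)] by metis
  have "finite (y ` B1 \<union> S)" using B1(1) S(1) by simp
  then obtain D where D: "finite D" "y ` B1 \<union> S \<subseteq> D" "spread c e D" using g(5) by metis
  define U where "U = pinv y ` D"
  have U: "finite U" "B1 \<subseteq> U" using D(1,2) yG unfolding U_def by (auto simp: image_iff) (metis image_subset_iff pinv_left)
  have yU: "y ` U = D" unfolding U_def using yG by (simp add: image_image)
  have "e x \<in> U" if "x \<in> U" for x
  proof -
    have "y x \<in> D" using that yU by blast
    then have "e (y x) \<in> D" using D(3) unfolding spread_def by blast
    then have "y (e x) \<in> D" using centralizerD(2)[OF y] by simp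
    then show ?thesis unfolding U_def using yG by (metis imageI pinv_left)
  qed
  then have eU: "e ` U \<subseteq> U" by blast
  have "a \<in> B1" using S(2) B1(2) by blast
  then obtain k where k: "k \<in> G" "\<forall>x\<in>B1. k x = x" "\<forall>x\<in>U. k (e x) = e (k x)" "spread c e (k ` U)"
    using g(7)[OF U(1) _ U(2) eU B1(3)] by metis
  define p where "p = y \<circ> pinv k"
  have pG: "p \<in> G" unfolding p_def using yG k(1) by (simp add: comp_mem pinv_mem)
  have pk: "p (k x) = y x" for x unfolding p_def using k(1) by simp
  have "p ` k ` U = D" using yU by (simp add: image_image pk)
  moreover have BU: "B1 \<subseteq> k ` U" using U(2) k(2) by (metis imageI subsetD subsetI)
  moreover have "p (e x) = e (p x)" if x: "x \<in> k ` U" for x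
  proof -
    obtain u where u: "u \<in> U" "x = k u" using x by blast
    then have "p (e x) = y (e u)" using k(3) pk by metis
    then show ?thesis using u(2) pk centralizerD(2)[OF y] by simp
  qed
  moreover have "p x = y x" if "x \<in> S" for x using pk[of x] k(2) B1(2) that by (metis subsetD)
  ultimately show ?thesis using U(1) pG B1(2) D(2,3) k(4)
    by (intro exI[of _ "k ` U"] exI[of _ p]) auto
qed

text \<open>A move k that commutes with c puts the y-image of T in free position with respect to e.
  Then k \<circ> y is c-equivariant on T, so it extends to an element of the centraliser; k fixes B
  and its c-image, so the prescribed values of y are kept.\<close>

lemma realize_free:
  assumes gp: "generic_pair a c e" and B: "finite B" "a \<in> B" "spread c e B"
    and y: "y \<in> centralizer c" and T: "finite T" "pinv y ` (B \<union> c ` B) \<subseteq> T" "c ` T \<subseteq> T"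
  shows "\<exists>z\<in>centralizer c. (\<forall>x\<in>B \<union> c ` B. z (pinv y x) = x) \<and> z ` T \<inter> e ` z ` T = B \<and> indep H (z ` T) (e ` z ` T)"
proof -
  note g = generic_pairD[OF gp]
  have yG: "y \<in> G" by (rule centralizerD(1)[OF y])
  define D where "D = B \<union> c ` B"
  have yD: "pinv y x \<in> T" if "x \<in> D" for x using T(2) that unfolding D_def by blast
  have DU: "D \<subseteq> y ` T"
  proof
    fix x assume "x \<in> D"
    then have "y (pinv y x) \<in> y ` T" by (intro imageI yD)
    then show "x \<in> y ` T" using yG by simp
  qed
  have "c ` D \<subseteq> D" using involD(2)[OF g(1)] unfolding D_def by auto
  moreover have "c ` y ` T \<subseteq> y ` T" 
  proof
    fix z assume "z \<in> c ` y ` T"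
    then obtain x where "x \<in> T" "z = y (c x)" using centralizerD(2)[OF y] by auto
    then show "z \<in> y ` T" using T(3) by blast
  qed
  moreover have "D \<inter> e ` D = B" "indep H D (e ` D)" using B(3) unfolding spread_def D_def by simp_all
  moreover have "a \<in> D" using B(2) unfolding D_def by simp
  ultimately obtain k where k: "k \<in> G" "\<forall>x\<in>D. k x = x" "\<forall>x\<in>y ` T. k (c x) = c (k x)"
    "k ` y ` T \<inter> e ` k ` y ` T = B" "indep H (k ` y ` T) (e ` k ` y ` T)"
    using g(6)[of "y ` T" D] T(1) DU by (metis finite_imageI)
  have "y a = a" by (rule centralizer_fixes[OF g(1) y])
  then have "a \<in> T" using yD[OF \<open>a \<in> D\<close>] yG by (metis pinv_left)
  then have "equivariant a c T (k \<circ> y)"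
    unfolding equivariant_def using T(1,3) k(1,3) yG centralizerD(2)[OF y] by (simp add: comp_mem)
  from equivariant_extends[OF g(1,3) this]
  obtain z where z: "z \<in> centralizer c" "\<forall>x\<in>T. z x = k (y x)" by auto
  have "z ` T = k ` y ` T" using z(2) by (simp add: image_image cong: image_cong)
  moreover have "z (pinv y x) = x" if "x \<in> D" for x using z(2) yD[OF that] k(2) that yG by simp
  ultimately show ?thesis using z(1) k(4,5) unfolding D_def by (intro bexI[of _ z]) simp_all
qed

text \<open>As e displaces u freely over B, and the f-image of u freely over that of B, the maps f
  on u and e \<circ> f \<circ> e on the e-image of u agree on B and glue. The result commutes with e
  by construction: away from B this imposes nothing on f.\<close>

lemma glue_invol:
  assumes e: "invol a e" "rich a e" and u: "finite u" "a \<in> u" and f: "f \<in> G"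
    and B: "u \<inter> e ` u = B" "f ` u \<inter> e ` f ` u = f ` B"
    and ind: "indep H u (e ` u)" "indep H (f ` u) (e ` f ` u)"
    and eqv: "\<forall>x\<in>B. f (e x) = e (f x)"
  shows "\<exists>z\<in>centralizer e. \<forall>x\<in>u. z x = f x"
proof -
  note e' = involD[OF e(1)]
  define h where "h = e \<circ> (f \<circ> e)"
  have h: "h \<in> G" unfolding h_def using e'(1) f by (simp add: comp_mem)
  have he: "h (e x) = e (f x)" for x unfolding h_def by (simp add: e'(2))
  have heu: "h ` e ` u = e ` f ` u" by (simp add: image_image he)
  have "\<exists>k\<in>G. (\<forall>x\<in>u. k x = f x) \<and> (\<forall>x\<in>e ` u. k x = h x)"
  proof (rule glue)
    fix x assume "x \<in> u \<inter> e ` u"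
    then have "x \<in> B" using B(1) by simp
    then have "f (e x) = e (f x)" using eqv by simp
    then show "f x = h x" unfolding h_def by (simp add: e'(2))
  qed (use u f h ind heu B in simp_all)
  then obtain m where m: "m \<in> G" "\<forall>x\<in>u. m x = f x" "\<forall>x\<in>e ` u. m x = h x" by auto
  have me: "m (e x) = e (f x)" if "x \<in> u" for x using m(3) he that by simp
  have "m (e x) = e (m x)" if "x \<in> u \<union> e ` u" for x
    using that
  proof
    assume "x \<in> e ` u"
    then obtain w where "w \<in> u" "x = e w" by blast
    then show ?thesis using me m(2) by (simp add: e'(2))
  qed (use me m(2) in simp)
  moreover have "e ` (u \<union> e ` u) \<subseteq> u \<union> e ` u" by (auto simp: e'(2))
  ultimately have "equivariant a e (u \<union> e ` u) m"
    unfolding equivariant_def using u m(1) by simp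
  from equivariant_extends[OF e this]
  obtain z where "z \<in> centralizer e" "\<forall>x\<in>u \<union> e ` u. z x = m x" by blast
  then show ?thesis using m(2) by (intro bexI[of _ z]) simp_all
qed

text \<open>
  Given \<open>g\<close> close to \<open>q\<close>, first \<open>z3\<close> and \<open>z1\<close> are chosen in \<open>C(c)\<close> such that \<open>e\<close> moves \<open>z3 ` T1\<close> and
  \<open>v = inverse z1 ` g ` T1\<close> freely over \<open>B\<close> and \<open>D\<close>; then \<open>inverse z1 \<circ> g \<circ> inverse z3\<close> extends to an
  \<open>e\<close>-equivariant map on \<open>z3 ` T1\<close> and its \<open>e\<close>-image. In the proof \<open>w\<close> is the inverse of \<open>z1\<close>.
\<close>

lemma locally_dense_product:
  assumes gp: "generic_pair a c e" and S: "finite S"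
    and y: "y1 \<in> centralizer c" "y2 \<in> centralizer e" "y3 \<in> centralizer c"
  shows "\<exists>q\<in>G. \<exists>Q. finite Q \<and> (\<forall>g\<in>G. \<forall>T. finite T \<and> (\<forall>x\<in>Q. g x = q x) \<longrightarrow>
    (\<exists>z1\<in>centralizer c. \<exists>z2\<in>centralizer e. \<exists>z3\<in>centralizer c.
      (\<forall>x\<in>S. z1 x = y1 x \<and> z2 x = y2 x \<and> z3 x = y3 x) \<and> (\<forall>x\<in>T. z1 (z2 (z3 x)) = g x)))"
proof -
  note gpD = generic_pairD[OF gp]
  note yG = y[THEN centralizerD(1)]
  \<comment> \<open>For x in S, the value of \<open>z3\<close> at x is controlled by y3 x in B, that
    of \<open>z2\<close> by x in B, and that of \<open>z1\<close> by x in D. Hence both S and its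
    image under y3 enter P.\<close>
  define P where "P = insert a (S \<union> y3 ` S)"
  have "finite P" "a \<in> P" using S unfolding P_def by simp_all
  from spread_match[OF gp y(2) this] obtain B p where
    B: "finite B" "P \<subseteq> B" "spread c e B" and p: "p \<in> G" "P \<subseteq> p ` B" "spread c e (p ` B)"
      "\<forall>x\<in>B. p (e x) = e (p x)" "\<forall>x\<in>P. p x = y2 x"
    by auto
  define D where "D = p ` B"
  have D: "finite D" "P \<subseteq> D" "spread c e D" "a \<in> D" "a \<in> B" using p B unfolding D_def P_def by auto
  define q where "q = y1 \<circ> (p \<circ> y3)"
  have "q \<in> G" unfolding q_def using yG p(1) by (simp add: comp_mem)
  moreover have "finite (pinv y3 ` B)" using B(1) by simp
  moreover have "\<exists>z1\<in>centralizer c. \<exists>z2\<in>centralizer e. \<exists>z3\<in>centralizer c.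
      (\<forall>x\<in>S. z1 x = y1 x \<and> z2 x = y2 x \<and> z3 x = y3 x) \<and> (\<forall>x\<in>T. z1 (z2 (z3 x)) = g x)"
    if g: "g \<in> G" "finite T" "\<forall>x\<in>pinv y3 ` B. g x = q x" for g T
  proof -
    \<comment> \<open>The second set is what \<open>realize_free\<close> needs for
      \<open>z3\<close>, the third what it needs for w.\<close>
    define T0 where "T0 = T \<union> pinv y3 ` (B \<union> c ` B) \<union> pinv g ` y1 ` (D \<union> c ` D)"
    define T1 where "T1 = T0 \<union> c ` T0"
    have T1: "finite T1" "T \<subseteq> T1" "pinv y3 ` (B \<union> c ` B) \<subseteq> T1" "c ` T1 \<subseteq> T1"
      using g(2) B(1) D(1) involD(2)[OF gpD(1)] unfolding T1_def T0_def by auto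
    obtain z3 where z3: "z3 \<in> centralizer c" "\<forall>x\<in>B \<union> c ` B. z3 (pinv y3 x) = x"
      "z3 ` T1 \<inter> e ` z3 ` T1 = B" "indep H (z3 ` T1) (e ` z3 ` T1)"
      using realize_free[OF gp B(1) D(5) B(3) y(3) T1(1,3,4)] by auto
    define T2 where "T2 = g ` T1 \<union> c ` g ` T1"
    have yD: "y1 ` (D \<union> c ` D) \<subseteq> g ` T1"
    proof -
      have "y1 ` (D \<union> c ` D) = g ` pinv g ` y1 ` (D \<union> c ` D)" using g(1) by (simp add: image_image)
      also have "\<dots> \<subseteq> g ` T1" unfolding T1_def T0_def by blast
      finally show ?thesis .
    qed
    have T2: "finite T2" "c ` T2 \<subseteq> T2" "g ` T1 \<subseteq> T2"
      using T1(1) involD(2)[OF gpD(1)] unfolding T2_def by auto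
    have py: "pinv y1 \<in> centralizer c" and ppy: "pinv (pinv y1) = y1"
      using y(1) yG(1) by (simp_all add: centralizer_pinv pinv_pinv)
    have "pinv (pinv y1) ` (D \<union> c ` D) \<subseteq> T2" using yD T2(3) ppy by simp
    from realize_free[OF gp D(1,4,3) py T2(1) this T2(2)] obtain w where
      w: "w \<in> centralizer c" "\<forall>x\<in>D \<union> c ` D. w (y1 x) = x"
      "w ` T2 \<inter> e ` w ` T2 = D" "indep H (w ` T2) (e ` w ` T2)"
      unfolding ppy by auto
    note wG = centralizerD(1)[OF w(1)] and zG = centralizerD(1)[OF z3(1)]
    define f where "f = w \<circ> (g \<circ> pinv z3)"
    have f: "f \<in> G" unfolding f_def using wG g(1) zG by (simp add: comp_mem pinv_mem)
    have fz: "f (z3 x) = w (g x)" for x unfolding f_def using zG by simp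
    define v where "v = w ` g ` T1"
    have fu: "f ` z3 ` T1 = v" unfolding v_def by (simp add: image_image fz)
    have v: "v \<subseteq> w ` T2" unfolding v_def using T2(3) by (rule image_mono)
    have Dv: "D \<subseteq> v"
    proof
      fix x assume x: "x \<in> D"
      then have "y1 x \<in> g ` T1" "w (y1 x) = x" using yD w(2) by blast+
      then show "x \<in> v" unfolding v_def by (metis imageI)
    qed
    have eD: "e ` D = D" using D(3) unfolding spread_def by simp
    \<comment> \<open>The agreement of g with q is used here: it forces f to equal p on B, and p
      commutes with e there.\<close>
    have fB: "f x = p x" if "x \<in> B" for x
    proof -
      have "f x = f (z3 (pinv y3 x))" using z3(2) that by simp
      also have "\<dots> = w (g (pinv y3 x))" by (rule fz)
      also have "\<dots> = w (y1 (p x))" using g(3) that yG(3) unfolding q_def by simp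
      also have "\<dots> = p x" using w(2) that unfolding D_def by simp
      finally show ?thesis .
    qed
    have fBD: "f ` B = D" using fB unfolding D_def by (simp cong: image_cong)
    have Dev: "D \<subseteq> e ` v" using image_mono[OF Dv, of e] eD by simp
    have vev: "v \<inter> e ` v = D"
    proof
      show "v \<inter> e ` v \<subseteq> D" unfolding w(3)[symmetric] using v by (intro Int_mono image_mono)
      show "D \<subseteq> v \<inter> e ` v" using Dv Dev by simp
    qed
    have iv: "indep H v (e ` v)"
      by (rule indep_subset[OF w(4) v image_mono[OF v]]) (use w(3) Dv Dev in simp_all)
    have "a \<in> z3 ` T1" using D(5) z3(3) by blast
    moreover have "e x \<in> B" if "x \<in> B" for x using B(3) that unfolding spread_def by blast
    then have "\<forall>x\<in>B. f (e x) = e (f x)" using fB p(4) by simp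
    ultimately obtain z2 where z2: "z2 \<in> centralizer e" "\<forall>x\<in>z3 ` T1. z2 x = f x"
      using glue_invol[OF gpD(2,4) _ _ f z3(3) _ z3(4)] T1(1) unfolding fu fBD using vev iv by auto
    have "pinv w \<in> centralizer c" using w(1) by (rule centralizer_pinv)
    moreover have "pinv w x = y1 x \<and> z2 x = y2 x \<and> z3 x = y3 x" if x: "x \<in> S" for x
    proof (intro conjI)
      have xP: "x \<in> P" "y3 x \<in> P" using x unfolding P_def by auto
      show "pinv w x = y1 x" using w(2) D(2) xP(1) wG by (intro pinv_eq) auto
      have "y3 x \<in> B" using xP(2) B(2) by blast
      then show "z3 x = y3 x" using z3(2) yG(3) by (metis UnI1 pinv_left)
      have xB: "x \<in> B" using xP(1) B(2) by blast
      then have "x \<in> z3 ` T1" using z3(3) by blast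
      then have "z2 x = f x" using z2(2) by blast
      then show "z2 x = y2 x" using fB[OF xB] p(5) xP(1) by simp
    qed
    moreover have "pinv w (z2 (z3 x)) = g x" if "x \<in> T" for x
      using z2(2) that T1(2) fz wG by auto
    ultimately show ?thesis using z2(1) z3(1) by blast
  qed
  ultimately show ?thesis by (intro bexI[of _ q] exI[of _ "pinv y3 ` B"]) blast+
qed

text \<open>The Baire category theorem for triples from C(c), C(e), C(c). By
  \<open>locally_dense_product\<close>, the products of the triples in any basic open set are dense
  in some open subset of \<open>G\<close>; so the triples whose product avoids \<open>N k\<close>
  contain a dense open set, and some triple avoids every \<open>N k\<close>.\<close>

lemma product_not_meager:
  assumes gp: "generic_pair a c e"
  shows "\<not> meager (set_prod (centralizer c) (set_prod (centralizer e) (centralizer c)))"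
proof
  let ?W = "set_prod (centralizer c) (set_prod (centralizer e) (centralizer c))"
  assume "meager ?W"
  then obtain N where N: "\<And>k::nat. nowhere_dense (N k)" "?W \<subseteq> (\<Union>k. N k)"
    using meager_sequence by metis
  \<comment> \<open>The factors have indices 0, 1, 2; the components from 3 on only pad the
    sequence.\<close>
  define X where "X i = centralizer (if i = (1::nat) then e else c)" for i
  define Y where "Y = (\<lambda>z (i::nat, p). perm_code (z i) p) ` {z. \<forall>i. z i \<in> X i}"
  define dc where "dc y i j = y (i, True, j)" for y :: "nat \<times> bool \<times> nat \<Rightarrow> nat" and i j :: nat
  define pr where "pr y = dc y 0 \<circ> (dc y 1 \<circ> dc y 2)" for y
  have closed: "closed_seqs Y" unfolding Y_def X_def by (intro closed_seqs_family closed_centralizer)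
  have dcY: "dc y i \<in> X i" "y (i, b, j) = perm_code (dc y i) (b, j)" if "y \<in> Y" for y i b j
    using that unfolding Y_def dc_def by (auto simp: perm_code_def)
  have XG: "x \<in> G" if "x \<in> X i" for x i using that unfolding X_def by (rule centralizerD(1))
  have idX: "id \<in> X i" for i unfolding X_def centralizer_def by (simp add: id_mem)
  have "(\<lambda>(i::nat, p). perm_code id p) \<in> Y"
    unfolding Y_def using idX by (intro image_eqI[of _ _ "\<lambda>i. id"]) auto
  moreover have "\<exists>y'\<in>Y. \<exists>F'. finite F' \<and> (\<forall>i\<in>F. y' i = y i) \<and>
      (\<forall>z\<in>Y. (\<forall>i\<in>F'. z i = y' i) \<longrightarrow> pr z \<notin> N k)"
    if y: "y \<in> Y" and F: "finite F" for k y and F :: "(nat \<times> bool \<times> nat) set"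
  proof -
    define S0 where "S0 = (snd \<circ> snd) ` F"
    \<comment> \<open>Agreement on the preimages of \<open>S0\<close> makes the inverses of the
      three factors agree on \<open>S0\<close> as well.\<close>
    define S where "S = S0 \<union> pinv (dc y 0) ` S0 \<union> pinv (dc y 1) ` S0 \<union> pinv (dc y 2) ` S0"
    have S: "finite S" using F unfolding S_def S0_def by simp
    have y': "dc y 0 \<in> centralizer c" "dc y 1 \<in> centralizer e" "dc y 2 \<in> centralizer c"
      using dcY(1)[OF y, of 0] dcY(1)[OF y, of 1] dcY(1)[OF y, of 2] unfolding X_def by simp_all
    from locally_dense_product[OF gp S y'] obtain q Q where q: "q \<in> G" "finite Q"
      "\<And>g T. g \<in> G \<Longrightarrow> finite T \<Longrightarrow> \<forall>x\<in>Q. g x = q x \<Longrightarrow>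
        \<exists>z1\<in>centralizer c. \<exists>z2\<in>centralizer e. \<exists>z3\<in>centralizer c.
        (\<forall>x\<in>S. z1 x = dc y 0 x \<and> z2 x = dc y 1 x \<and> z3 x = dc y 2 x) \<and> (\<forall>x\<in>T. z1 (z2 (z3 x)) = g x)"
      by auto
    obtain h T where h: "h \<in> nbhd q Q" "finite T" "nbhd h T \<inter> N k = {}"
      using N(1)[of k] q(1,2) unfolding nowhere_dense_def by metis
    have hG: "h \<in> G" using h(1) by (rule nbhd_mem)
    define T1 where "T1 = T \<union> pinv h ` T"
    have T1: "finite T1" using h(2) unfolding T1_def by simp
    have "\<forall>x\<in>Q. h x = q x" using h(1) unfolding nbhd_def by simp
    from q(3)[OF hG T1 this] obtain z0 z1 z2 where
      z: "z0 \<in> centralizer c" "z1 \<in> centralizer e" "z2 \<in> centralizer c"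
      "\<forall>x\<in>S. z0 x = dc y 0 x \<and> z1 x = dc y 1 x \<and> z2 x = dc y 2 x" "\<forall>x\<in>T1. z0 (z1 (z2 x)) = h x"
      by auto
    define w where "w i = (if i = 0 then z0 else if i = 1 then z1 else if i = (2::nat) then z2 else dc y i)" for i
    have wX: "w i \<in> X i" for i using z(1-3) dcY(1)[OF y, of i] unfolding w_def X_def by (simp split: if_splits)
    have wS: "w i x = dc y i x" if "x \<in> S" for i x using z(4) that unfolding w_def by simp
    define y1 where "y1 = (\<lambda>(i, p). perm_code (w i) p)"
    have "y1 \<in> Y" unfolding Y_def y1_def using wX by (intro image_eqI[of _ _ w]) auto
    moreover have "y1 p = y p" if p: "p \<in> F" for p
    proof -
      obtain i b j where ib: "p = (i, b, j)" by (cases p)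
      then have j: "j \<in> S0" using p unfolding S0_def by force
      have G1: "w i \<in> G" "dc y i \<in> G" using wX dcY(1)[OF y] XG by blast+
      have "w i j = dc y i j" using wS j unfolding S_def by blast
      moreover have "pinv (w i) j = pinv (dc y i) j"
      proof (cases "i \<le> 2")
        case True
        then have "i = 0 \<or> i = 1 \<or> i = 2" by auto
        then have "pinv (dc y i) j \<in> S" using j unfolding S_def by auto
        then have "w i (pinv (dc y i) j) = j" using wS G1 by simp
        then show ?thesis by (rule pinv_eq[OF G1(1)])
      qed (simp add: w_def)
      ultimately show ?thesis using dcY(2)[OF y, of i b j] unfolding ib y1_def by (simp add: perm_code_def)
    qed
    \<comment> \<open>Freezing each factor only along the path j, z2 j, z1 (z2 j) fixes the product
      at j.\<close>
    moreover have "pr z' \<notin> N k"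
      if z': "z' \<in> Y" "\<forall>i\<in>(\<lambda>j. (2, True, j)) ` T1 \<union> (\<lambda>j. (1, True, z2 j)) ` T1 \<union> (\<lambda>j. (0, True, z1 (z2 j))) ` T1. z' i = y1 i" for z'
    proof -
      have d: "dc z' 2 j = z2 j" "dc z' 1 (z2 j) = z1 (z2 j)" "dc z' 0 (z1 (z2 j)) = z0 (z1 (z2 j))" if "j \<in> T1" for j
        using z'(2) that unfolding dc_def y1_def w_def perm_code_def by (simp_all add: ball_Un)
      have prh: "pr z' j = h j" if "j \<in> T1" for j using d[OF that] z(5) that unfolding pr_def by simp
      have G1: "pr z' \<in> G" unfolding pr_def using dcY(1)[OF z'(1)] XG by (intro comp_mem) blast+
      have "pr z' \<in> nbhd h T"
        unfolding nbhd_def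
      proof (intro CollectI conjI ballI)
        fix j assume j: "j \<in> T"
        show "pr z' j = h j" using prh j unfolding T1_def by blast
        have "pinv h j \<in> T1" using j unfolding T1_def by blast
        then have "pr z' (pinv h j) = j" using prh hG by simp
        then show "pinv (pr z') j = pinv h j" by (rule pinv_eq[OF G1])
      qed (fact G1)
      then show ?thesis using h(3) by blast
    qed
    ultimately show ?thesis using T1
      by (intro bexI[of _ y1] exI[of _ "(\<lambda>j. (2, True, j)) ` T1 \<union> (\<lambda>j. (1, True, z2 j)) ` T1 \<union> (\<lambda>j. (0, True, z1 (z2 j))) ` T1"]) simp_all
  qed
  ultimately have "\<exists>z\<in>Y. (\<forall>i\<in>{}. z i = (\<lambda>(i::nat, p). perm_code id p) i) \<and> (\<forall>k. pr z \<notin> N k)"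
    by (intro closed_seqs_Baire[OF closed]) simp_all
  then obtain z where z: "z \<in> Y" "\<And>k. pr z \<notin> N k" by blast
  have "dc z 0 \<in> centralizer c" "dc z 1 \<in> centralizer e" "dc z 2 \<in> centralizer c"
    using dcY(1)[OF z(1), of 0] dcY(1)[OF z(1), of 1] dcY(1)[OF z(1), of 2] unfolding X_def by simp_all
  then have "pr z \<in> ?W" unfolding set_prod_def pr_def by blast
  then show False using N(2) z(2) by blast
qed

end

section \<open>Openness of the images of point stabilisers\<close>

context perm_group
begin

definition pt_stab :: "nat \<Rightarrow> (nat \<Rightarrow> nat) set" where
  "pt_stab a = {g \<in> G. g a = a}"

text \<open>Says that the identity is an interior point. It is applied to subgroups, for which this
  amounts to openness.\<close>

definition is_open :: "(nat \<Rightarrow> nat) set \<Rightarrow> bool" where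
  "is_open K \<longleftrightarrow> (\<exists>T. finite T \<and> (\<forall>x\<in>G. (\<forall>j\<in>T. x j = j) \<longrightarrow> x \<in> K))"

text \<open>Inverses are compared because h and r lie in the same right coset of the pointwise
  stabiliser of T iff their inverses agree on T. There are only countably many finite tables of
  values.\<close>

lemma countable_cosets:
  assumes T: "finite T"
  shows "\<exists>R. countable R \<and> R \<subseteq> G \<and> (\<forall>h\<in>G. \<exists>r\<in>R. \<forall>j\<in>T. pinv h j = pinv r j)"
proof -
  define \<phi> where "\<phi> h = (\<lambda>j. (j, pinv h j)) ` T" for h :: "nat \<Rightarrow> nat"
  have "\<phi> ` G \<subseteq> {F :: (nat \<times> nat) set. finite F}" unfolding \<phi>_def using T by auto
  then have "countable (\<phi> ` G)" by (rule countable_subset[OF _ countable_Collect_finite])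
  moreover have "\<exists>r\<in>inv_into G \<phi> ` \<phi> ` G. \<forall>j\<in>T. pinv h j = pinv r j" if h: "h \<in> G" for h
  proof -
    have "\<phi> (inv_into G \<phi> (\<phi> h)) = \<phi> h" by (rule f_inv_into_f[OF imageI[OF h]])
    then have "\<forall>j\<in>T. pinv h j = pinv (inv_into G \<phi> (\<phi> h)) j" unfolding \<phi>_def by (auto simp: set_eq_iff image_iff)
    then show ?thesis using h by blast
  qed
  moreover have "inv_into G \<phi> ` \<phi> ` G \<subseteq> G" by (auto intro: inv_into_into)
  ultimately show ?thesis by (intro exI[of _ "inv_into G \<phi> ` \<phi> ` G"]) simp
qed

end

locale free_perm_group_automorphism = free_perm_group +
  fixes \<alpha> :: "(nat \<Rightarrow> nat) \<Rightarrow> nat \<Rightarrow> nat"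
  assumes bij_\<alpha>: "bij_betw \<alpha> G G"
    and hom_\<alpha>: "g \<in> G \<Longrightarrow> h \<in> G \<Longrightarrow> \<alpha> (g \<circ> h) = \<alpha> g \<circ> \<alpha> h"
begin

lemma \<alpha>_mem: "g \<in> G \<Longrightarrow> \<alpha> g \<in> G"
  using bij_\<alpha> by (rule bij_betwE[THEN bspec])

lemma \<alpha>_inj: "g \<in> G \<Longrightarrow> h \<in> G \<Longrightarrow> \<alpha> g = \<alpha> h \<longleftrightarrow> g = h"
  using bij_\<alpha> by (metis bij_betw_def inj_on_eq_iff)

lemma \<alpha>_surj: "h \<in> G \<Longrightarrow> \<exists>g\<in>G. h = \<alpha> g"
  using bij_\<alpha> by (metis bij_betw_def imageE)

lemma \<alpha>_id: "\<alpha> id = id"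
proof -
  have "\<alpha> id \<circ> \<alpha> id = \<alpha> id" using hom_\<alpha>[OF id_mem id_mem] by simp
  then have "pinv (\<alpha> id) \<circ> (\<alpha> id \<circ> \<alpha> id) = pinv (\<alpha> id) \<circ> \<alpha> id" by simp
  then show ?thesis using comp_pinv(1)[OF \<alpha>_mem[OF id_mem]] by (simp add: o_assoc)
qed

lemma \<alpha>_pinv: "g \<in> G \<Longrightarrow> \<alpha> (pinv g) = pinv (\<alpha> g)"
proof -
  assume g: "g \<in> G"
  have "\<alpha> g \<circ> \<alpha> (pinv g) = id" using hom_\<alpha>[OF g pinv_mem[OF g]] comp_pinv(2)[OF g] \<alpha>_id by simp
  then show ?thesis using pinv_eq[OF \<alpha>_mem[OF g]] by (metis comp_apply ext id_apply)
qed

lemma \<alpha>_centralizer: "c \<in> G \<Longrightarrow> \<alpha> ` centralizer c = centralizer (\<alpha> c)"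
proof -
  assume c: "c \<in> G"
  have cen: "y \<in> centralizer d \<longleftrightarrow> y \<in> G \<and> y \<circ> d = d \<circ> y" for y d
    unfolding centralizer_def by (auto simp: fun_eq_iff)
  show ?thesis
  proof
    show "\<alpha> ` centralizer c \<subseteq> centralizer (\<alpha> c)"
      using hom_\<alpha> c \<alpha>_mem unfolding cen subset_iff by (auto simp: cen) metis
    show "centralizer (\<alpha> c) \<subseteq> \<alpha> ` centralizer c"
    proof
      fix y assume y: "y \<in> centralizer (\<alpha> c)"
      then obtain g where g: "g \<in> G" "y = \<alpha> g" using \<alpha>_surj cen by metis
      then have "\<alpha> (g \<circ> c) = \<alpha> (c \<circ> g)" using y hom_\<alpha> c unfolding cen by simp
      then have "g \<circ> c = c \<circ> g" using \<alpha>_inj comp_mem g(1) c by simp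
      then show "y \<in> \<alpha> ` centralizer c" using g cen by blast
    qed
  qed
qed

lemma \<alpha>_set_prod: "A \<subseteq> G \<Longrightarrow> B \<subseteq> G \<Longrightarrow> \<alpha> ` set_prod A B = set_prod (\<alpha> ` A) (\<alpha> ` B)"
proof -
  assume "A \<subseteq> G" "B \<subseteq> G"
  then have "\<alpha> (f \<circ> g) = \<alpha> f \<circ> \<alpha> g" if "f \<in> A" "g \<in> B" for f g using that hom_\<alpha> by blast
  note hom = this
  show ?thesis
  proof
    show "\<alpha> ` set_prod A B \<subseteq> set_prod (\<alpha> ` A) (\<alpha> ` B)"
      using hom unfolding set_prod_def by auto
    show "set_prod (\<alpha> ` A) (\<alpha> ` B) \<subseteq> \<alpha> ` set_prod A B"
    proof
      fix h assume "h \<in> set_prod (\<alpha> ` A) (\<alpha> ` B)"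
      then obtain f g where "f \<in> A" "g \<in> B" "h = \<alpha> f \<circ> \<alpha> g" unfolding set_prod_def by blast
      then show "h \<in> \<alpha> ` set_prod A B"
        using hom unfolding set_prod_def by (intro image_eqI[of _ _ "f \<circ> g"]) auto
    qed
  qed
qed

text \<open>
  The stabiliser of a point contains a product of centralisers with the Baire property, of which
  countably many translates cover \<open>G\<close>; all of this is visible in the abstract group, so that \<open>\<alpha>\<close>
  preserves it.
\<close>

lemma is_open_image_pt_stab: "is_open (\<alpha> ` pt_stab a)"
proof -
  obtain c e where gp: "generic_pair a c e" using ex_generic_pair by blast
  note ce = generic_pairD(1,2)[OF gp]
  note ceG = ce[THEN involD(1)]
  define W where "W = set_prod (centralizer c) (set_prod (centralizer e) (centralizer c))"
  have CG: "centralizer c \<subseteq> G" "centralizer e \<subseteq> G" by (auto simp: centralizer_def)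
  have spG: "set_prod A B \<subseteq> G" if "A \<subseteq> G" "B \<subseteq> G" for A B
    using that comp_mem unfolding set_prod_def by blast
  have WG: "W \<subseteq> G" unfolding W_def by (intro spG CG)
  have an: "analytic W"
    unfolding W_def by (intro analytic_set_prod analytic_closed closed_centralizer)
  obtain T where T: "finite T" "\<And>x. x \<in> G \<Longrightarrow> \<forall>j\<in>T. x j = j \<Longrightarrow> \<exists>u\<in>W. \<exists>v\<in>W. x = pinv u \<circ> v"
    using Pettis[OF an WG product_not_meager[OF gp, folded W_def]] by metis
  have "w a = a" if w: "w \<in> W" for w
  proof -
    obtain z1 z2 z3 where z: "z1 \<in> centralizer c" "z2 \<in> centralizer e" "z3 \<in> centralizer c" "w = z1 \<circ> (z2 \<circ> z3)"
      using w unfolding W_def set_prod_def by auto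
    have "z1 a = a" "z2 a = a" "z3 a = a" using z(1-3) centralizer_fixes ce by blast+
    then show ?thesis unfolding z(4) by simp
  qed
  then have Wa: "W \<subseteq> pt_stab a" using WG unfolding pt_stab_def by blast
  have Winv: "pinv u \<in> W" if u: "u \<in> W" for u
  proof -
    obtain z1 z2 z3 where z: "z1 \<in> centralizer c" "z2 \<in> centralizer e" "z3 \<in> centralizer c" "u = z1 \<circ> (z2 \<circ> z3)"
      using u unfolding W_def set_prod_def by auto
    have "pinv u = pinv z3 \<circ> (pinv z2 \<circ> pinv z1)"
      using z(1-3)[THEN centralizerD(1)] unfolding z(4) by (simp add: fun_eq_iff pinv_comp comp_mem)
    then show ?thesis using z(1-3)[THEN centralizer_pinv] unfolding W_def set_prod_def by blast
  qed
  define V where "V = \<alpha> ` set_prod W W"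
  have V: "V = set_prod (\<alpha> ` W) (\<alpha> ` W)" unfolding V_def by (rule \<alpha>_set_prod[OF WG WG])
  have "\<alpha> ` W = set_prod (centralizer (\<alpha> c)) (set_prod (centralizer (\<alpha> e)) (centralizer (\<alpha> c)))"
    unfolding W_def using CG spG by (simp add: \<alpha>_set_prod \<alpha>_centralizer ceG)
  then have anV: "analytic V"
    unfolding V by (simp add: analytic_set_prod analytic_closed closed_centralizer)
  have VG: "V \<subseteq> G" unfolding V_def using spG[OF WG WG] \<alpha>_mem by blast
  obtain R where R: "countable R" "R \<subseteq> G" "\<And>h. h \<in> G \<Longrightarrow> \<exists>r\<in>R. \<forall>j\<in>T. pinv h j = pinv r j"
    using countable_cosets[OF T(1)] by metis
  have cover: "G \<subseteq> (\<Union>r\<in>R. (\<lambda>n. n \<circ> \<alpha> r) ` V)"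
  proof
    fix y assume "y \<in> G"
    then obtain h where h: "h \<in> G" "y = \<alpha> h" using \<alpha>_surj by blast
    then obtain r where r: "r \<in> R" "\<forall>j\<in>T. pinv h j = pinv r j" using R(3) by blast
    have rG: "r \<in> G" using r(1) R(2) by blast
    have hr: "h \<circ> pinv r \<in> G" using h(1) rG by (simp add: comp_mem pinv_mem)
    have "\<forall>j\<in>T. (h \<circ> pinv r) j = j"
    proof
      fix j assume "j \<in> T"
      then have "pinv r j = pinv h j" using r(2) by simp
      then show "(h \<circ> pinv r) j = j" using h(1) by simp
    qed
    from T(2)[OF hr this] obtain u v where uv: "u \<in> W" "v \<in> W" "h \<circ> pinv r = pinv u \<circ> v" by blast
    then have "h \<circ> pinv r \<in> set_prod W W" unfolding set_prod_def using Winv by blast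
    then have "\<alpha> (h \<circ> pinv r) \<in> V" unfolding V_def by (rule imageI)
    moreover have "y = \<alpha> (h \<circ> pinv r) \<circ> \<alpha> r"
    proof -
      have "h = (h \<circ> pinv r) \<circ> r" using rG by auto
      then show ?thesis using hom_\<alpha>[OF hr rG] h(2) by simp
    qed
    ultimately show "y \<in> (\<Union>r\<in>R. (\<lambda>n. n \<circ> \<alpha> r) ` V)" using r(1) by blast
  qed
  have "\<not> meager V"
  proof
    assume "meager V"
    then have "meager (\<Union>r\<in>R. (\<lambda>n. n \<circ> \<alpha> r) ` V)"
      using R(1,2) \<alpha>_mem by (intro meager_UN meager_translate) auto
    then have "meager G" using cover by (rule meager_subset)
    then show False using baire_nbhd[OF _ id_mem, of G "{}"] nbhd_mem by blast
  qed
  then obtain T' where T': "finite T'" "\<And>x. x \<in> G \<Longrightarrow> \<forall>j\<in>T'. x j = j \<Longrightarrow> \<exists>u\<in>V. \<exists>v\<in>V. x = pinv u \<circ> v"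
    using Pettis[OF anV VG] by metis
  have "pinv u \<circ> v \<in> \<alpha> ` pt_stab a" if uv: "u \<in> V" "v \<in> V" for u v
  proof -
    have ps: "f \<circ> g \<in> pt_stab a" "pinv f \<in> pt_stab a" if "f \<in> pt_stab a" "g \<in> pt_stab a" for f g
      using that unfolding pt_stab_def by (auto simp: comp_mem pinv_mem intro: pinv_eq)
    have "set_prod W W \<subseteq> pt_stab a" using Wa ps(1) unfolding set_prod_def by blast
    then obtain f g where fg: "f \<in> pt_stab a" "g \<in> pt_stab a" "u = \<alpha> f" "v = \<alpha> g"
      using uv unfolding V_def by blast
    then have G2: "f \<in> G" "g \<in> G" unfolding pt_stab_def by simp_all
    have "pinv u \<circ> v = \<alpha> (pinv f \<circ> g)" using fg(3,4) G2 \<alpha>_pinv hom_\<alpha> pinv_mem by simp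
    then show ?thesis using ps fg(1,2) by blast
  qed
  then show ?thesis unfolding is_open_def using T' by metis
qed

end

section \<open>Supports of open subgroups\<close>

context perm_group
begin

definition stab :: "nat set \<Rightarrow> (nat \<Rightarrow> nat) set" where
  "stab A = {g \<in> G. \<forall>x\<in>A. g x = x}"

definition is_subgroup :: "(nat \<Rightarrow> nat) set \<Rightarrow> bool" where
  "is_subgroup K \<longleftrightarrow> K \<subseteq> G \<and> (\<forall>f\<in>K. \<forall>g\<in>K. f \<circ> g \<in> K) \<and> (\<forall>f\<in>K. pinv f \<in> K)"

lemma is_subgroupD: "is_subgroup K \<Longrightarrow> f \<in> K \<Longrightarrow> f \<in> G" "is_subgroup K \<Longrightarrow> f \<in> K \<Longrightarrow> g \<in> K \<Longrightarrow> f \<circ> g \<in> K"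
  "is_subgroup K \<Longrightarrow> f \<in> K \<Longrightarrow> pinv f \<in> K"
  unfolding is_subgroup_def by blast+

lemma stabD: "g \<in> stab A \<Longrightarrow> g \<in> G" "g \<in> stab A \<Longrightarrow> x \<in> A \<Longrightarrow> g x = x"
  unfolding stab_def by auto

lemma is_subgroup_stab: "is_subgroup (stab A)"
  unfolding is_subgroup_def stab_def by (auto simp: comp_mem pinv_mem intro: pinv_eq)

lemma pt_stab_eq_stab: "pt_stab a = stab {a}"
  unfolding pt_stab_def stab_def by simp

lemma stab_conj:
  assumes K: "is_subgroup K" and A: "stab A \<subseteq> K" and g: "g \<in> K"
  shows "stab (g ` A) \<subseteq> K"
proof
  fix f assume f: "f \<in> stab (g ` A)"
  note gG = is_subgroupD(1)[OF K g] and fG = stabD(1)[OF f]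
  have "pinv g \<circ> (f \<circ> g) \<in> stab A"
    using stabD(2)[OF f] gG fG unfolding stab_def by (simp add: comp_mem pinv_mem)
  then have "pinv g \<circ> (f \<circ> g) \<in> K" using A by blast
  then have "g \<circ> ((pinv g \<circ> (f \<circ> g)) \<circ> pinv g) \<in> K"
    using is_subgroupD(2)[OF K] is_subgroupD(3)[OF K g] g by simp
  moreover have "g \<circ> ((pinv g \<circ> (f \<circ> g)) \<circ> pinv g) = f" using gG by auto
  ultimately show "f \<in> K" by simp
qed

end

context free_perm_group
begin

text \<open>Amalgamating A with x added and A \<union> C freely over A puts the copy of x outside C.
  In particular x has an infinite orbit under the stabiliser of A.\<close>

lemma no_algebraicity:
  assumes "finite A" "x \<notin> A" "finite C"
  shows "\<exists>g\<in>stab A. g x \<notin> C"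
proof -
  have "finite (insert x A)" "finite (A \<union> C)" "A \<subseteq> insert x A" "A \<subseteq> A \<union> C" using assms by auto
  from free[OF this] obtain k where k: "k \<in> G" "\<forall>x\<in>A. k x = x" "k ` insert x A \<inter> (A \<union> C) = A" by auto
  have "k x \<notin> C"
  proof
    assume "k x \<in> C"
    then have kA: "k x \<in> A" using k(3) by blast
    then have "k (k x) = k x" using k(2) by blast
    then show False using inj_mem[OF k(1)] assms(2) kA by simp
  qed
  then show ?thesis using k(1,2) unfolding stab_def by blast
qed

text \<open>
  Moving \<open>B\<close> by an element of \<open>stab A\<close> to a set \<open>B'\<close> that is free from \<open>g ` A\<close> as well, the identity on
  \<open>B'\<close> and \<open>g\<close> on \<open>A\<close> have a common extension.
\<close>

lemma stab_Int_indep: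
  assumes K: "is_subgroup K" and A: "finite A" "stab A \<subseteq> K" and B: "finite B" "stab B \<subseteq> K"
    and ind: "indep H B A"
  shows "stab (A \<inter> B) \<subseteq> K"
proof
  fix g assume g: "g \<in> stab (A \<inter> B)"
  note gG = stabD(1)[OF g]
  define X where "X = A \<union> g ` A"
  have "finite (A \<union> B)" "finite X" "A \<subseteq> A \<union> B" "A \<subseteq> X" using A B unfolding X_def by auto
  from free[OF this] obtain h where h: "h \<in> G" "\<forall>x\<in>A. h x = x" "h ` (A \<union> B) \<inter> X = A" "indep H (h ` (A \<union> B)) X"
    by auto
  have hA: "h ` A = A" using h(2) by simp
  have hs: "h \<in> stab A" using h(1,2) unfolding stab_def by simp
  define B' where "B' = h ` B"
  have int: "h ` (A \<inter> B) = A \<inter> B" using h(2) by simp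
  have B'A: "B' \<inter> A = A \<inter> B"
  proof -
    have "B' \<inter> A = h ` B \<inter> h ` A" unfolding B'_def hA ..
    also have "\<dots> = h ` (B \<inter> A)" by (rule image_Int[OF bij_is_inj[OF bij[OF h(1)]], symmetric])
    finally show ?thesis using int by (simp add: Int_commute)
  qed
  have ind': "indep H B' A" using indep_image[OF ind h(1)] unfolding hA B'_def .
  have gAB: "A \<inter> B \<subseteq> g ` A" using stabD(2)[OF g] by (force simp: image_iff)
  have B'Y: "B' \<subseteq> h ` (A \<union> B)" unfolding B'_def by (rule image_mono) simp
  have AX: "A \<subseteq> X" "g ` A \<subseteq> X" unfolding X_def by simp_all
  have B'X: "B' \<inter> X = A \<inter> B"
  proof -
    have "B' \<inter> X \<subseteq> A" using Int_mono[OF B'Y order_refl, of X] h(3) by simp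
    then have "B' \<inter> X = B' \<inter> A" using AX(1) by auto
    then show ?thesis using B'A by simp
  qed
  have ind2: "indep H B' (g ` A)"
    unfolding indep_def
  proof (intro ballI impI)
    fix t assume t: "t \<in> H" "t \<subseteq> B' \<union> g ` A"
    have "t \<subseteq> h ` (A \<union> B) \<union> X" by (rule order_trans[OF t(2) Un_mono[OF B'Y AX(2)]])
    from indepD[OF h(4) t(1) this] show "t \<subseteq> B' \<or> t \<subseteq> g ` A"
    proof
      assume tX: "t \<subseteq> X"
      have "t \<subseteq> g ` A"
      proof
        fix x assume x: "x \<in> t"
        then have "x \<in> B' \<or> x \<in> g ` A" "x \<in> X" using t(2) tX by blast+
        then show "x \<in> g ` A" using B'X gAB by blast
      qed
      then show ?thesis by simp
    next
      assume tY: "t \<subseteq> h ` (A \<union> B)"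
      have tA: "t \<subseteq> B' \<union> (g ` A \<inter> A)"
      proof
        fix x assume x: "x \<in> t"
        then have "x \<in> B' \<or> x \<in> g ` A" "x \<in> h ` (A \<union> B)" using t(2) tY by blast+
        then show "x \<in> B' \<union> (g ` A \<inter> A)" using h(3) AX(2) by blast
      qed
      then have "t \<subseteq> B' \<union> A" by blast
      from indepD[OF ind' t(1) this] show ?thesis
      proof
        assume tA': "t \<subseteq> A"
        have "t \<subseteq> g ` A"
        proof
          fix x assume x: "x \<in> t"
          then have "x \<in> A" "x \<in> B' \<or> x \<in> g ` A" using tA tA' by blast+
          then show "x \<in> g ` A" using B'A gAB by blast
        qed
        then show ?thesis by simp
      qed simp
    qed
  qed
  have "\<exists>k\<in>G. (\<forall>x\<in>B'. k x = id x) \<and> (\<forall>x\<in>A. k x = g x)"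
  proof (rule glue)
    show "finite B'" "finite A" "id \<in> G" "g \<in> G" "indep H B' A" "indep H (id ` B') (g ` A)"
      using A B gG ind' ind2 id_mem unfolding B'_def by simp_all
    show "id x = g x" if "x \<in> B' \<inter> A" for x using that stabD(2)[OF g] unfolding B'A by simp
    have "B' \<inter> g ` A = A \<inter> B"
    proof
      show "B' \<inter> g ` A \<subseteq> A \<inter> B" using Int_mono[OF order_refl AX(2), of B'] B'X by simp
      show "A \<inter> B \<subseteq> B' \<inter> g ` A" unfolding B'A[symmetric] using gAB B'A by auto
    qed
    then show "id ` B' \<inter> g ` A = id ` (B' \<inter> A)" using B'A by simp
  qed
  then obtain k where k: "k \<in> G" "\<forall>x\<in>B'. k x = x" "\<forall>x\<in>A. k x = g x" by auto
  have "h \<in> K" using hs A(2) by blast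
  from stab_conj[OF K B(2) this] have "k \<in> K" using k(1,2) unfolding B'_def stab_def by blast
  moreover have "pinv k \<circ> g \<in> stab A"
    using k gG unfolding stab_def by (auto simp: comp_mem pinv_mem intro!: pinv_eq)
  then have "pinv k \<circ> g \<in> K" using A(2) by blast
  ultimately have "k \<circ> (pinv k \<circ> g) \<in> K" by (rule is_subgroupD(2)[OF K])
  moreover have "k \<circ> (pinv k \<circ> g) = g" using k(1) by auto
  ultimately show "g \<in> K" by simp
qed

text \<open>To reach the independent case, B is replaced by an image of A. Some h fixing B pointwise
  moves A \<union> B freely over B; as h lies in K, the image of A again has its stabiliser in K,
  and it is independent from A with intersection A \<inter> B.\<close>

lemma stab_Int:
  assumes K: "is_subgroup K" and A: "finite A" "stab A \<subseteq> K" and B: "finite B" "stab B \<subseteq> K"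
  shows "stab (A \<inter> B) \<subseteq> K"
proof -
  have "finite (A \<union> B)" "B \<subseteq> A \<union> B" using A B by auto
  from free[OF this(1,1,2,2)] obtain h where h: "h \<in> G" "\<forall>x\<in>B. h x = x" "h ` (A \<union> B) \<inter> (A \<union> B) = B"
    "indep H (h ` (A \<union> B)) (A \<union> B)" by auto
  have hB: "h ` B = B" using h(2) by simp
  have "h ` A \<inter> B = h ` (A \<inter> B)" using image_Int[OF bij_is_inj[OF bij[OF h(1)]], of A B] hB by simp
  then have hAB: "h ` A \<inter> B = A \<inter> B" using h(2) by simp
  have hA: "h ` A \<subseteq> h ` (A \<union> B)" by (rule image_mono) simp
  have AB: "h ` A \<inter> A = A \<inter> B"
  proof
    have "h ` A \<inter> A \<subseteq> B" using Int_mono[OF hA, of A "A \<union> B"] h(3) by simp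
    then show "h ` A \<inter> A \<subseteq> A \<inter> B" by simp
    show "A \<inter> B \<subseteq> h ` A \<inter> A" unfolding hAB[symmetric] using hAB by auto
  qed
  have ind: "indep H (h ` A) A"
    unfolding indep_def
  proof (intro ballI impI)
    fix t assume t: "t \<in> H" "t \<subseteq> h ` A \<union> A"
    have "t \<subseteq> h ` (A \<union> B) \<union> (A \<union> B)" by (rule order_trans[OF t(2) Un_mono[OF hA]]) simp
    from indepD[OF h(4) t(1) this] show "t \<subseteq> h ` A \<or> t \<subseteq> A"
    proof
      assume tY: "t \<subseteq> h ` (A \<union> B)"
      have "t \<subseteq> h ` A"
      proof
        fix x assume x: "x \<in> t"
        then have "x \<in> h ` A \<or> x \<in> A" "x \<in> h ` (A \<union> B)" using t(2) tY by blast+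
        then show "x \<in> h ` A" using h(3) AB by blast
      qed
      then show ?thesis by simp
    next
      assume tX: "t \<subseteq> A \<union> B"
      have "t \<subseteq> A"
      proof
        fix x assume x: "x \<in> t"
        then have "x \<in> h ` A \<or> x \<in> A" "x \<in> A \<union> B" using t(2) tX by blast+
        then have "x \<in> h ` A \<inter> B \<or> x \<in> A" by blast
        then show "x \<in> A" unfolding hAB by blast
      qed
      then show ?thesis by simp
    qed
  qed
  have "h \<in> K" using h(1,2) B(2) unfolding stab_def by blast
  then have "stab (h ` A) \<subseteq> K" by (rule stab_conj[OF K A(2)])
  then have "stab (A \<inter> h ` A) \<subseteq> K" using A by (intro stab_Int_indep[OF K A] ind) simp_all
  moreover have "A \<inter> h ` A = A \<inter> B" using AB by blast
  ultimately show ?thesis by simp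
qed

text \<open>A support of least cardinality works: its image under an element of K is a support as
  well, hence so is the intersection of the two, and minimality forces equality.\<close>

lemma open_subgroup_support:
  assumes K: "is_subgroup K" and op: "is_open K"
  shows "\<exists>A. finite A \<and> stab A \<subseteq> K \<and> (\<forall>g\<in>K. g ` A = A)"
proof -
  define P where "P n \<longleftrightarrow> (\<exists>A. finite A \<and> stab A \<subseteq> K \<and> card A = n)" for n
  have "\<exists>n. P n" using op unfolding is_open_def P_def stab_def by blast
  then have "P (LEAST n. P n)" by (rule LeastI_ex)
  then obtain A where A: "finite A" "stab A \<subseteq> K" "card A = (LEAST n. P n)" unfolding P_def by blast
  have "g ` A = A" if g: "g \<in> K" for g
  proof -
    have "stab (A \<inter> g ` A) \<subseteq> K" using A(1) by (intro stab_Int[OF K A(1,2)] stab_conj[OF K A(2) g]) simp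
    then have "P (card (A \<inter> g ` A))" using A(1) unfolding P_def by blast
    then have "card A \<le> card (A \<inter> g ` A)" unfolding A(3) by (rule Least_le)
    then have "A \<inter> g ` A = A" using A(1) by (intro card_seteq) auto
    moreover have "card (g ` A) \<le> card A" using A(1) by (rule card_image_le)
    ultimately show ?thesis using A(1) by (intro card_seteq[symmetric]) auto
  qed
  then show ?thesis using A by blast
qed

lemma pt_stab_subset:
  assumes "pt_stab a \<subseteq> pt_stab b"
  shows "a = b"
proof (rule ccontr)
  assume "a \<noteq> b"
  then obtain g where "g \<in> stab {a}" "g b \<notin> {b}" using no_algebraicity[of "{a}" b "{b}"] by auto
  then show False using assms unfolding pt_stab_eq_stab using stabD(2)[of g "{b}" b] by blast
qed

end

section \<open>From point stabilisers to a permutation of the points\<close>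

context free_perm_group_automorphism
begin

lemma inverse_automorphism: "free_perm_group_automorphism G H (inv_into G \<alpha>)"
proof
  show "bij_betw (inv_into G \<alpha>) G G" by (rule bij_betw_inv_into[OF bij_\<alpha>])
  fix g h assume gh: "g \<in> G" "h \<in> G"
  then obtain g' h' where g'h': "g' \<in> G" "h' \<in> G" "g = \<alpha> g'" "h = \<alpha> h'" using \<alpha>_surj by metis
  have inv: "inv_into G \<alpha> (\<alpha> x) = x" if "x \<in> G" for x
    using that bij_\<alpha> by (simp add: bij_betw_def)
  have "g \<circ> h = \<alpha> (g' \<circ> h')" using g'h' hom_\<alpha> by simp
  then show "inv_into G \<alpha> (g \<circ> h) = inv_into G \<alpha> g \<circ> inv_into G \<alpha> h"
    using g'h' inv comp_mem by simp
qed

lemma is_subgroup_image: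
  assumes "is_subgroup K"
  shows "is_subgroup (\<alpha> ` K)"
proof -
  have "\<alpha> f \<circ> \<alpha> g = \<alpha> (f \<circ> g)" "pinv (\<alpha> f) = \<alpha> (pinv f)" if "f \<in> K" "g \<in> K" for f g
    using is_subgroupD(1)[OF assms] that by (simp_all add: hom_\<alpha> \<alpha>_pinv)
  then show ?thesis
    using is_subgroupD[OF assms] \<alpha>_mem unfolding is_subgroup_def by (auto intro!: imageI)
qed

text \<open>The stabiliser of A is a finite intersection of point stabilisers, and the injective
  \<alpha> commutes with intersections.\<close>

lemma is_open_image_stab:
  assumes "finite A"
  shows "is_open (\<alpha> ` stab A)"
proof -
  obtain T where T: "\<And>a. finite (T a)" "\<And>a x. x \<in> G \<Longrightarrow> \<forall>j\<in>T a. x j = j \<Longrightarrow> x \<in> \<alpha> ` pt_stab a"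
    using is_open_image_pt_stab unfolding is_open_def by metis
  have "x \<in> \<alpha> ` stab A" if x: "x \<in> G" "\<forall>j\<in>\<Union>(T ` A). x j = j" for x
  proof -
    obtain g where g: "g \<in> G" "x = \<alpha> g" using \<alpha>_surj x(1) by blast
    have "g a = a" if a: "a \<in> A" for a
    proof -
      have "x \<in> \<alpha> ` pt_stab a" using x a by (intro T(2)) auto
      then obtain g' where g': "g' \<in> pt_stab a" "x = \<alpha> g'" by blast
      then have "g' = g" using g \<alpha>_inj unfolding pt_stab_def by auto
      then show ?thesis using g'(1) unfolding pt_stab_def by simp
    qed
    then show ?thesis using g unfolding stab_def by blast
  qed
  moreover have "finite (\<Union>(T ` A))" using assms T(1) by simp
  ultimately show ?thesis unfolding is_open_def by metis
qed

text \<open>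
  If \<open>A\<close> is the support of \<open>\<alpha> ` pt_stab a\<close>, then the preimage of \<open>stab A\<close> is an open subgroup of
  finite index in \<open>pt_stab a\<close>. A point \<open>x \<noteq> a\<close> in its support would have a finite orbit under
  \<open>pt_stab a\<close>.
\<close>

lemma image_pt_stab_subset: "\<exists>b. \<alpha> ` pt_stab a \<subseteq> pt_stab b"
proof -
  have "is_subgroup (\<alpha> ` pt_stab a)"
    unfolding pt_stab_eq_stab by (intro is_subgroup_image is_subgroup_stab)
  from open_subgroup_support[OF this is_open_image_pt_stab] obtain A where
    A: "finite A" "stab A \<subseteq> \<alpha> ` pt_stab a" "\<forall>g\<in>\<alpha> ` pt_stab a. g ` A = A" by auto
  \<comment> \<open>With empty support \<alpha> would map \<open>pt_stab a\<close> onto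
    \<open>G\<close>, although some element of \<open>G\<close> moves a.\<close>
  have "A \<noteq> {}"
  proof
    assume "A = {}"
    obtain g where g: "g \<in> stab {}" "g a \<notin> {a}" using no_algebraicity[of "{}" a "{a}"] by auto
    have gG: "g \<in> G" using g(1) by (rule stabD(1))
    then have "\<alpha> g \<in> stab A" using \<alpha>_mem \<open>A = {}\<close> unfolding stab_def by simp
    then obtain g' where "g' \<in> pt_stab a" "\<alpha> g = \<alpha> g'" using A(2) by blast
    then show False using \<alpha>_inj gG g(2) unfolding pt_stab_def by auto
  qed
  then obtain b where b: "b \<in> A" by blast
  define \<beta> where "\<beta> = inv_into G \<alpha>"
  interpret inv: free_perm_group_automorphism G H \<beta>
    unfolding \<beta>_def by (rule inverse_automorphism)
  have \<beta>\<alpha>: "\<beta> (\<alpha> x) = x" if "x \<in> G" for x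
    using that bij_\<alpha> unfolding \<beta>_def by (simp add: bij_betw_def)
  have \<alpha>\<beta>: "\<alpha> (\<beta> x) = x" if "x \<in> G" for x
    using that bij_\<alpha> unfolding \<beta>_def by (simp add: bij_betw_def f_inv_into_f)
  from open_subgroup_support[OF inv.is_subgroup_image[OF is_subgroup_stab] inv.is_open_image_stab[OF A(1)]]
  obtain B where B: "finite B" "stab B \<subseteq> \<beta> ` stab A" "\<forall>g\<in>\<beta> ` stab A. g ` B = B" by auto
  have "B \<subseteq> {a}"
  proof (rule ccontr)
    assume "\<not> B \<subseteq> {a}"
    then obtain x where x: "x \<in> B" "x \<notin> {a}" by blast
    \<comment> \<open>This records the action of \<open>\<alpha> g\<close> on A, a finite set that
      \<open>\<alpha> g\<close> permutes. So finitely many representatives r suffice, and elements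
      with equal records differ by an element of the preimage of \<open>stab A\<close>, which
      preserves B.\<close>
    define \<phi> where "\<phi> g = (\<lambda>j. (j, \<alpha> g j)) ` A" for g
    have "\<phi> ` pt_stab a \<subseteq> Pow (A \<times> A)" using A(3) unfolding \<phi>_def by auto
    then have "finite (\<phi> ` pt_stab a)" by (rule finite_subset) (simp add: A(1))
    then have "finite (\<Union>r\<in>inv_into (pt_stab a) \<phi> ` \<phi> ` pt_stab a. r ` B)" using B(1) by blast
    from no_algebraicity[OF _ x(2) this] obtain g where
      g: "g \<in> pt_stab a" "g x \<notin> (\<Union>r\<in>inv_into (pt_stab a) \<phi> ` \<phi> ` pt_stab a. r ` B)"
      unfolding pt_stab_eq_stab by auto
    define r where "r = inv_into (pt_stab a) \<phi> (\<phi> g)"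
    have r: "r \<in> pt_stab a" unfolding r_def by (rule inv_into_into[OF imageI[OF g(1)]])
    have "\<phi> r = \<phi> g" unfolding r_def by (rule f_inv_into_f[OF imageI[OF g(1)]])
    then have rg: "\<forall>j\<in>A. \<alpha> g j = \<alpha> r j" unfolding \<phi>_def by (auto simp: set_eq_iff image_iff)
    have gr: "g \<in> G" "r \<in> G" using g(1) r unfolding pt_stab_def by simp_all
    have m: "pinv r \<circ> g \<in> G" using gr by (simp add: comp_mem pinv_mem)
    have "\<alpha> (pinv r \<circ> g) = pinv (\<alpha> r) \<circ> \<alpha> g" using gr by (simp add: hom_\<alpha> \<alpha>_pinv pinv_mem)
    then have "\<alpha> (pinv r \<circ> g) \<in> stab A" using rg gr \<alpha>_mem unfolding stab_def
      by (simp add: comp_mem pinv_mem)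
    then have "pinv r \<circ> g \<in> \<beta> ` stab A" using \<beta>\<alpha>[OF m] by (metis imageI)
    then have "(pinv r \<circ> g) ` B = B" using B(3) by blast
    then have "(pinv r \<circ> g) x \<in> B" using x(1) by blast
    then have "r (pinv r (g x)) \<in> r ` B" by simp
    then have "g x \<in> r ` B" using gr by simp
    then show False using g r_def by blast
  qed
  then have "pt_stab a \<subseteq> stab B" unfolding pt_stab_def stab_def by auto
  then have "pt_stab a \<subseteq> \<beta> ` stab A" using B(2) by blast
  then have "\<alpha> ` pt_stab a \<subseteq> \<alpha> ` \<beta> ` stab A" by (rule image_mono)
  moreover have "\<alpha> ` \<beta> ` stab A = stab A" using \<alpha>\<beta> stabD(1) by (auto simp: image_image)
  moreover have "stab A \<subseteq> pt_stab b" using b unfolding stab_def pt_stab_def by auto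
  ultimately show ?thesis by blast
qed

text \<open>The inclusion is applied to \<alpha> and to its inverse. Together they put
  \<open>pt_stab a\<close> inside \<open>pt_stab a'\<close>, so a = a' and both inclusions are
  equalities.\<close>

lemma image_pt_stab: "\<exists>b. \<alpha> ` pt_stab a = pt_stab b"
proof -
  define \<beta> where "\<beta> = inv_into G \<alpha>"
  interpret inv: free_perm_group_automorphism G H \<beta>
    unfolding \<beta>_def by (rule inverse_automorphism)
  have \<beta>\<alpha>: "\<beta> (\<alpha> x) = x" if "x \<in> G" for x
    using that bij_\<alpha> unfolding \<beta>_def by (simp add: bij_betw_def)
  have \<alpha>\<beta>: "\<alpha> (\<beta> x) = x" if "x \<in> G" for x
    using that bij_\<alpha> unfolding \<beta>_def by (simp add: bij_betw_def f_inv_into_f)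
  obtain b where b: "\<alpha> ` pt_stab a \<subseteq> pt_stab b" using image_pt_stab_subset by blast
  obtain a' where a': "\<beta> ` pt_stab b \<subseteq> pt_stab a'" using inv.image_pt_stab_subset by blast
  have "g \<in> pt_stab a'" if "g \<in> pt_stab a" for g
  proof -
    have "\<beta> (\<alpha> g) \<in> \<beta> ` pt_stab b" using b that by blast
    moreover have "\<beta> (\<alpha> g) = g" using that \<beta>\<alpha> unfolding pt_stab_def by simp
    ultimately show ?thesis using a' by auto
  qed
  then have "a = a'" by (intro pt_stab_subset) blast
  have "g \<in> \<alpha> ` pt_stab a" if "g \<in> pt_stab b" for g
  proof -
    have "\<beta> g \<in> pt_stab a" using a' that unfolding \<open>a = a'\<close> by blast
    moreover have "g = \<alpha> (\<beta> g)" using that \<alpha>\<beta> unfolding pt_stab_def by simp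
    ultimately show ?thesis by (metis imageI)
  qed
  then show ?thesis using b by blast
qed

text \<open>Points are recovered from their stabilisers, which \<alpha> permutes. Equivariance of
  \<phi> is the image under \<alpha> of the fact that the stabiliser of g x is the g-conjugate of
  the stabiliser of x.\<close>

theorem automorphism_is_conjugation: "\<exists>\<phi>. bij \<phi> \<and> (\<forall>g\<in>G. \<forall>x. \<phi> (g x) = \<alpha> g (\<phi> x))"
proof -
  define \<beta> where "\<beta> = inv_into G \<alpha>"
  interpret inv: free_perm_group_automorphism G H \<beta>
    unfolding \<beta>_def by (rule inverse_automorphism)
  have \<alpha>\<beta>: "\<alpha> (\<beta> x) = x" if "x \<in> G" for x
    using that bij_\<alpha> unfolding \<beta>_def by (simp add: bij_betw_def f_inv_into_f)
  obtain \<phi> where \<phi>: "\<And>a. \<alpha> ` pt_stab a = pt_stab (\<phi> a)" using image_pt_stab by metis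
  have ps: "pt_stab a \<subseteq> G" for a unfolding pt_stab_def by blast
  have "inj \<phi>"
  proof (rule injI)
    fix a b assume "\<phi> a = \<phi> b"
    then have "\<alpha> ` pt_stab a = \<alpha> ` pt_stab b" using \<phi> by simp
    then have "pt_stab a = pt_stab b"
      using inj_on_image_eq_iff[OF bij_betw_imp_inj_on[OF bij_\<alpha>] ps ps] by blast
    then show "a = b" by (intro pt_stab_subset) simp
  qed
  moreover have "\<exists>a. \<phi> a = b" for b
  proof -
    obtain a where a: "\<beta> ` pt_stab b = pt_stab a" using inv.image_pt_stab by blast
    have "\<alpha> ` \<beta> ` pt_stab b = pt_stab b" using \<alpha>\<beta> ps by (force simp: image_image)
    then have "pt_stab (\<phi> a) = pt_stab b" using \<phi>[of a] a by simp
    then have "\<phi> a = b" by (intro pt_stab_subset) simp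
    then show ?thesis ..
  qed
  then have "surj \<phi>" unfolding surj_def by metis
  ultimately have "bij \<phi>" by (rule bijI)
  moreover have "\<phi> (g x) = \<alpha> g (\<phi> x)" if g: "g \<in> G" for g x
  proof -
    have "pt_stab (\<phi> (g x)) \<subseteq> pt_stab (\<alpha> g (\<phi> x))"
    proof
      fix f assume "f \<in> pt_stab (\<phi> (g x))"
      then obtain h where h: "h \<in> pt_stab (g x)" "f = \<alpha> h" using \<phi> by blast
      have hG: "h \<in> G" using h(1) ps by blast
      have "pinv g \<circ> (h \<circ> g) \<in> pt_stab x"
        using h(1) g hG unfolding pt_stab_def by (simp add: comp_mem pinv_mem)
      then have "\<alpha> (pinv g \<circ> (h \<circ> g)) \<in> pt_stab (\<phi> x)" using \<phi> by blast
      moreover have "\<alpha> (pinv g \<circ> (h \<circ> g)) = pinv (\<alpha> g) \<circ> (f \<circ> \<alpha> g)"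
        using g hG h(2) by (simp add: hom_\<alpha> \<alpha>_pinv pinv_mem comp_mem)
      ultimately have "pinv (\<alpha> g) (f (\<alpha> g (\<phi> x))) = \<phi> x" unfolding pt_stab_def by simp
      then have "f (\<alpha> g (\<phi> x)) = \<alpha> g (\<phi> x)" using \<alpha>_mem[OF g] by (metis pinv_right)
      then show "f \<in> pt_stab (\<alpha> g (\<phi> x))" using h(2) hG \<alpha>_mem unfolding pt_stab_def by simp
    qed
    then show ?thesis by (rule pt_stab_subset)
  qed
  ultimately show ?thesis by (intro exI[of _ \<phi>]) simp
qed

end

section \<open>Free homogeneous structures\<close>

lemma map_preimage:
  assumes "set xs \<subseteq> f ` S"
  shows "\<exists>ys. set ys \<subseteq> S \<and> xs = map f ys"
proof (intro exI conjI)
  show "set (map (inv_into S f) xs) \<subseteq> S" using assms by (auto intro: inv_into_into)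
  show "xs = map f (map (inv_into S f) xs)"
    unfolding map_map by (rule map_idI[symmetric]) (use assms in \<open>auto simp: f_inv_into_f\<close>)
qed

locale free_structure =
  fixes L :: "'r language" and M :: "('r, 'a) rel_structure"
  assumes st: "is_structure L M" and cnt: "countable (universe M)"
    and hom: "homogeneous L M" and fa: "has_free_amalgamation (age L M)"
begin

abbreviation "U \<equiv> universe M"

abbreviation "Aut \<equiv> carrier (aut_group L M)"

lemma interpD: "xs \<in> interp M R \<Longrightarrow> R \<in> symbols L \<and> length xs = arity L R \<and> set xs \<subseteq> U"
  using st unfolding is_structure_def by fastforce

lemma Aut_iff: "f \<in> Aut \<longleftrightarrow> f \<in> extensional U \<and> bij_betw f U U \<and>
  (\<forall>R xs. set xs \<subseteq> U \<longrightarrow> (xs \<in> interp M R \<longleftrightarrow> map f xs \<in> interp M R))"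
proof
  assume "f \<in> Aut"
  then have f: "f \<in> Bij U" "is_isomorphism L M M f" unfolding aut_group_def by simp_all
  have "xs \<in> interp M R \<longleftrightarrow> map f xs \<in> interp M R" if "set xs \<subseteq> U" for R xs
  proof (cases "R \<in> symbols L \<and> length xs = arity L R")
    case True
    then show ?thesis using f(2) that unfolding is_isomorphism_def by blast
  next
    case False
    then show ?thesis using interpD[of xs R] interpD[of "map f xs" R] by auto
  qed
  then show "f \<in> extensional U \<and> bij_betw f U U \<and>
    (\<forall>R xs. set xs \<subseteq> U \<longrightarrow> (xs \<in> interp M R \<longleftrightarrow> map f xs \<in> interp M R))"
    using f(1) unfolding Bij_def by simp
qed (simp add: aut_group_def Bij_def is_isomorphism_def)

lemma AutD: "f \<in> Aut \<Longrightarrow> f \<in> Bij U" "f \<in> Aut \<Longrightarrow> bij_betw f U U" "f \<in> Aut \<Longrightarrow> x \<in> U \<Longrightarrow> f x \<in> U"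
  "f \<in> Aut \<Longrightarrow> set xs \<subseteq> U \<Longrightarrow> xs \<in> interp M R \<longleftrightarrow> map f xs \<in> interp M R"
  unfolding Aut_iff Bij_def by (auto dest: bij_betwE)

definition hyperedges :: "'a set set" where
  "hyperedges = {set xs | xs R. xs \<in> interp M R}"

lemma hyperedges_subset: "t \<in> hyperedges \<Longrightarrow> t \<subseteq> U"
  unfolding hyperedges_def using interpD by blast

lemma hyperedges_image: "t \<in> hyperedges \<Longrightarrow> f \<in> Aut \<Longrightarrow> f ` t \<in> hyperedges"
proof -
  assume "t \<in> hyperedges" and f: "f \<in> Aut"
  then obtain xs R where xs: "t = set xs" "xs \<in> interp M R" unfolding hyperedges_def by blast
  then have "map f xs \<in> interp M R" using AutD(4)[OF f] interpD by blast
  moreover have "f ` t = set (map f xs)" using xs by simp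
  ultimately show ?thesis unfolding hyperedges_def by blast
qed

lemma extend_partial:
  assumes C: "finite C" "C \<subseteq> U" and p: "inj_on p C" "p ` C \<subseteq> U"
    and rel: "\<And>R xs. set xs \<subseteq> C \<Longrightarrow> xs \<in> interp M R \<longleftrightarrow> map p xs \<in> interp M R"
  shows "\<exists>g\<in>Aut. \<forall>x\<in>C. g x = p x"
proof -
  have sub: "is_substructure (induced M X) M" if "X \<subseteq> U" for X
    using that unfolding is_substructure_def induced_def by simp
  have "is_isomorphism L (induced M C) (induced M (p ` C)) p"
    unfolding is_isomorphism_def
  proof (intro conjI ballI allI impI)
    show "bij_betw p (universe (induced M C)) (universe (induced M (p ` C)))"
      using p(1) unfolding induced_def by (simp add: inj_on_imp_bij_betw)
    fix R xs assume "length xs = arity L R \<and> set xs \<subseteq> universe (induced M C)"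
    then have xs: "set xs \<subseteq> C" unfolding induced_def by simp
    then have "p ` set xs \<subseteq> p ` C" by blast
    then show "xs \<in> interp (induced M C) R \<longleftrightarrow> map p xs \<in> interp (induced M (p ` C)) R"
      using rel[OF xs] xs unfolding induced_def by simp
  qed
  moreover have "finite (universe (induced M C))" "finite (universe (induced M (p ` C)))"
    using C(1) unfolding induced_def by simp_all
  ultimately have "\<exists>g\<in>Aut. \<forall>x\<in>universe (induced M C). g x = p x"
    using hom sub[OF C(2)] sub[OF p(2)] unfolding homogeneous_def by blast
  then show ?thesis unfolding induced_def by simp
qed

text \<open>The members of \<open>age\<close> live on subsets of \<open>nat\<close>, so finite parts
  of M are relabelled before they are amalgamated.\<close>

definition copy :: "('a \<Rightarrow> nat) \<Rightarrow> 'a set \<Rightarrow> ('r, nat) rel_structure" where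
  "copy \<beta> B = \<lparr>universe = \<beta> ` B, interp = (\<lambda>R. map \<beta> ` {xs \<in> interp M R. set xs \<subseteq> B})\<rparr>"

lemma copy_interp_iff:
  assumes "inj_on \<beta> B" "set xs \<subseteq> B"
  shows "map \<beta> xs \<in> interp (copy \<beta> B) R \<longleftrightarrow> xs \<in> interp M R"
proof
  assume "map \<beta> xs \<in> interp (copy \<beta> B) R"
  then obtain ys where ys: "map \<beta> xs = map \<beta> ys" "ys \<in> interp M R" "set ys \<subseteq> B"
    unfolding copy_def by auto
  have "inj_on \<beta> (set xs \<union> set ys)" by (rule inj_on_subset[OF assms(1)]) (use assms(2) ys(3) in simp)
  then have "xs = ys" using ys(1) by (simp add: inj_on_map_eq_map)
  then show "xs \<in> interp M R" using ys(2) by simp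
qed (use assms(2) in \<open>auto simp: copy_def\<close>)

lemma copy_interp_subset: "ys \<in> interp (copy \<beta> B) R \<Longrightarrow> set ys \<subseteq> \<beta> ` B"
proof -
  assume "ys \<in> interp (copy \<beta> B) R"
  then obtain xs where "ys = map \<beta> xs" "set xs \<subseteq> B" unfolding copy_def by auto
  then show ?thesis using image_mono[of "set xs" B \<beta>] by simp
qed

lemma copy_age:
  assumes "inj_on \<beta> B" "finite B" "B \<subseteq> U"
  shows "copy \<beta> B \<in> age L M"
proof -
  have "is_structure L (copy \<beta> B)"
    unfolding is_structure_def copy_def using interpD by fastforce
  moreover have "finite (universe (copy \<beta> B))" using assms(2) unfolding copy_def by simp
  moreover have "is_substructure (induced M B) M"
    using assms(3) unfolding is_substructure_def induced_def by simp
  moreover have "is_isomorphism L (copy \<beta> B) (induced M B) (inv_into B \<beta>)"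
    unfolding is_isomorphism_def
  proof (intro conjI ballI allI impI)
    show "bij_betw (inv_into B \<beta>) (universe (copy \<beta> B)) (universe (induced M B))"
      using bij_betw_inv_into[OF inj_on_imp_bij_betw[OF assms(1)]] unfolding copy_def induced_def by simp
    fix R ys assume "length ys = arity L R \<and> set ys \<subseteq> universe (copy \<beta> B)"
    then have "set ys \<subseteq> \<beta> ` B" unfolding copy_def by simp
    from map_preimage[OF this] obtain xs where xs: "set xs \<subseteq> B" "ys = map \<beta> xs" by auto
    have "map (inv_into B \<beta>) ys = xs"
      unfolding xs(2) map_map using xs(1) assms(1) by (intro map_idI) auto
    then show "ys \<in> interp (copy \<beta> B) R \<longleftrightarrow> map (inv_into B \<beta>) ys \<in> interp (induced M B) R"
      using copy_interp_iff[OF assms(1) xs(1)] xs unfolding induced_def by simp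
  qed
  ultimately show ?thesis unfolding age_def by blast
qed

lemma copy_substructure:
  assumes "inj_on \<beta> B" "A \<subseteq> B"
  shows "is_substructure (copy \<beta> A) (copy \<beta> B)"
proof -
  have "map \<beta> ` {xs \<in> interp M R. set xs \<subseteq> A} =
    {ys \<in> map \<beta> ` {xs \<in> interp M R. set xs \<subseteq> B}. set ys \<subseteq> \<beta> ` A}" for R
  proof
    show "map \<beta> ` {xs \<in> interp M R. set xs \<subseteq> A} \<subseteq>
      {ys \<in> map \<beta> ` {xs \<in> interp M R. set xs \<subseteq> B}. set ys \<subseteq> \<beta> ` A}"
      using assms(2) by fastforce
    show "{ys \<in> map \<beta> ` {xs \<in> interp M R. set xs \<subseteq> B}. set ys \<subseteq> \<beta> ` A} \<subseteq>
      map \<beta> ` {xs \<in> interp M R. set xs \<subseteq> A}"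
    proof
      fix ys assume "ys \<in> {ys \<in> map \<beta> ` {xs \<in> interp M R. set xs \<subseteq> B}. set ys \<subseteq> \<beta> ` A}"
      then obtain xs where xs: "ys = map \<beta> xs" "xs \<in> interp M R" "set xs \<subseteq> B" "\<beta> ` set xs \<subseteq> \<beta> ` A" by auto
      have "x \<in> A" if "x \<in> set xs" for x
      proof -
        have "\<beta> x \<in> \<beta> ` A" using xs(4) that by blast
        then show ?thesis using inj_on_image_mem_iff[OF assms(1) _ assms(2)] xs(3) that by blast
      qed
      then have "set xs \<subseteq> A" by blast
      then show "ys \<in> map \<beta> ` {xs \<in> interp M R. set xs \<subseteq> A}" using xs by blast
    qed
  qed
  then show ?thesis using assms(2) unfolding is_substructure_def induced_def copy_def by auto
qed

text \<open>By \<open>eq\<close>, a label shared by both copies names the same point, so neither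
  copy adds relations among the labels of the other.\<close>

lemma free_amalgam_interp_iff:
  assumes \<beta>: "inj_on \<beta> B" and \<gamma>: "inj_on \<gamma> C" and eq: "\<forall>x\<in>B. \<forall>y\<in>C. \<beta> x = \<gamma> y \<longrightarrow> x = y"
  shows "set xs \<subseteq> B \<Longrightarrow> map \<beta> xs \<in> interp (free_amalgam (copy \<beta> B) (copy \<gamma> C)) R \<longleftrightarrow> xs \<in> interp M R"
    "set xs \<subseteq> C \<Longrightarrow> map \<gamma> xs \<in> interp (free_amalgam (copy \<beta> B) (copy \<gamma> C)) R \<longleftrightarrow> xs \<in> interp M R"
proof -
  have same: "xs = ys" if "map \<beta> xs = map \<gamma> ys" "set xs \<subseteq> B" "set ys \<subseteq> C" for xs ys
  proof (rule nth_equalityI)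
    show len: "length xs = length ys" using that(1) by (rule map_eq_imp_length_eq)
    fix i assume i: "i < length xs"
    have "\<beta> (xs ! i) = \<gamma> (ys ! i)" using that(1) i len by (metis nth_map)
    moreover have "xs ! i \<in> B" "ys ! i \<in> C" using that(2,3) i len by (auto simp: subset_iff)
    ultimately show "xs ! i = ys ! i" using eq by blast
  qed
  show "map \<beta> xs \<in> interp (free_amalgam (copy \<beta> B) (copy \<gamma> C)) R \<longleftrightarrow> xs \<in> interp M R" if xs: "set xs \<subseteq> B"
  proof -
    have "xs \<in> interp M R" if "map \<beta> xs \<in> interp (copy \<gamma> C) R"
    proof -
      from that obtain ys where "map \<beta> xs = map \<gamma> ys" "ys \<in> interp M R" "set ys \<subseteq> C" unfolding copy_def by auto
      moreover from this have "xs = ys" using same xs by blast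
      ultimately show ?thesis by simp
    qed
    then show ?thesis using copy_interp_iff[OF \<beta> xs] unfolding free_amalgam_def by auto
  qed
  show "map \<gamma> xs \<in> interp (free_amalgam (copy \<beta> B) (copy \<gamma> C)) R \<longleftrightarrow> xs \<in> interp M R" if xs: "set xs \<subseteq> C"
  proof -
    have "xs \<in> interp M R" if "map \<gamma> xs \<in> interp (copy \<beta> B) R"
    proof -
      from that obtain ys where "map \<gamma> xs = map \<beta> ys" "ys \<in> interp M R" "set ys \<subseteq> B" unfolding copy_def by auto
      moreover from this have "ys = xs" using same[of ys xs] xs by simp
      ultimately show ?thesis by simp
    qed
    then show ?thesis using copy_interp_iff[OF \<gamma> xs] unfolding free_amalgam_def by auto
  qed
qed

text \<open>The free amalgam of two labelled copies lies in the age, so some F embeds it in M.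
  Homogeneity extends the resulting embeddings of B and C to automorphisms g and h.\<close>

lemma free_M:
  assumes fin: "finite B" "finite C" and BC: "B \<subseteq> U" "C \<subseteq> U" and A: "A \<subseteq> B" "A \<subseteq> C"
  shows "\<exists>g\<in>Aut. \<exists>h\<in>Aut. (\<forall>x\<in>A. g x = h x) \<and> g ` B \<inter> h ` C = h ` A \<and> indep hyperedges (g ` B) (h ` C)"
proof -
  define \<iota> where "\<iota> = to_nat_on U"
  have \<iota>: "\<iota> x = \<iota> y \<longleftrightarrow> x = y" if "x \<in> U" "y \<in> U" for x y
    using inj_on_to_nat_on[OF cnt] that unfolding \<iota>_def inj_on_def by blast
  \<comment> \<open>C and A get even labels, the rest of B odd ones: the two copies share exactly
    the labels of A.\<close>
  define \<gamma> where "\<gamma> x = 2 * \<iota> x" for x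
  define \<beta> where "\<beta> x = (if x \<in> A then 2 * \<iota> x else 2 * \<iota> x + 1)" for x
  have \<beta>: "inj_on \<beta> B" and \<gamma>: "inj_on \<gamma> C"
  proof -
    have "x = y" if "x \<in> B" "y \<in> B" "\<beta> x = \<beta> y" for x y
    proof -
      have "\<iota> x = \<iota> y" using that(3) unfolding \<beta>_def by (simp split: if_splits)
      then show ?thesis using \<iota> that BC by blast
    qed
    then show "inj_on \<beta> B" by (rule inj_onI)
    show "inj_on \<gamma> C" using \<iota> BC unfolding \<gamma>_def by (intro inj_onI) auto
  qed
  have \<beta>\<gamma>: "x = y \<and> x \<in> A" if "x \<in> B" "y \<in> C" "\<beta> x = \<gamma> y" for x y
  proof -
    have "x \<in> A" "\<iota> x = \<iota> y" using that(3) unfolding \<beta>_def \<gamma>_def by (simp_all split: if_splits) presburger+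
    then show ?thesis using \<iota> that BC by blast
  qed
  have \<beta>A: "\<beta> x = \<gamma> x" if "x \<in> A" for x using that unfolding \<beta>_def \<gamma>_def by simp
  have copyA: "copy \<beta> A = copy \<gamma> A"
  proof -
    have "map \<beta> xs = map \<gamma> xs" if "set xs \<subseteq> A" for xs using that \<beta>A by auto
    then have "map \<beta> ` {xs \<in> interp M R. set xs \<subseteq> A} = map \<gamma> ` {xs \<in> interp M R. set xs \<subseteq> A}" for R
      by (intro image_cong) auto
    moreover have "\<beta> ` A = \<gamma> ` A" using \<beta>A by (intro image_cong) auto
    ultimately show ?thesis unfolding copy_def by simp
  qed
  let ?F = "free_amalgam (copy \<beta> B) (copy \<gamma> C)"
  have "finite A" using fin(1) A(1) by (rule finite_subset[rotated])
  then have "copy \<beta> A \<in> age L M" "copy \<beta> B \<in> age L M" "copy \<gamma> C \<in> age L M"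
    using fin BC A \<beta> \<gamma> by (auto intro!: copy_age intro: inj_on_subset)
  moreover have "is_substructure (copy \<beta> A) (copy \<beta> B)" "is_substructure (copy \<beta> A) (copy \<gamma> C)"
    using copy_substructure[OF \<beta> A(1)] copy_substructure[OF \<gamma> A(2)] copyA by simp_all
  moreover have "universe (copy \<beta> B) \<inter> universe (copy \<gamma> C) = universe (copy \<beta> A)"
  proof
    show "universe (copy \<beta> B) \<inter> universe (copy \<gamma> C) \<subseteq> universe (copy \<beta> A)"
      using \<beta>\<gamma> unfolding copy_def by auto
    show "universe (copy \<beta> A) \<subseteq> universe (copy \<beta> B) \<inter> universe (copy \<gamma> C)"
      using A \<beta>A unfolding copy_def by force
  qed
  ultimately have "?F \<in> age L M" using fa unfolding has_free_amalgamation_def by blast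
  then obtain N F where N: "is_substructure N M" and F: "is_isomorphism L ?F N F" and stF: "is_structure L ?F"
    unfolding age_def by blast
  have uF: "universe ?F = \<beta> ` B \<union> \<gamma> ` C" unfolding free_amalgam_def copy_def by simp
  have NU: "universe N \<subseteq> U" and "N = induced M (universe N)"
    using N unfolding is_substructure_def by simp_all
  then have "interp N R = interp (induced M (universe N)) R" for R by (intro arg_cong[of _ _ "\<lambda>X. interp X R"])
  then have iN: "interp N R = {xs \<in> interp M R. set xs \<subseteq> universe N}" for R unfolding induced_def by simp
  have bF: "bij_betw F (\<beta> ` B \<union> \<gamma> ` C) (universe N)" using F unfolding is_isomorphism_def uF by blast
  then have Fin: "F x \<in> U" if "x \<in> \<beta> ` B \<union> \<gamma> ` C" for x using that NU bij_betwE by blast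
  have iF: "ys \<in> interp ?F R \<longleftrightarrow> map F ys \<in> interp M R" if ys: "set ys \<subseteq> \<beta> ` B \<union> \<gamma> ` C" for ys R
  proof -
    have sF: "set (map F ys) \<subseteq> universe N" 
      using image_mono[OF ys, of F] bij_betw_imp_surj_on[OF bF] by simp
    show ?thesis
    proof (cases "R \<in> symbols L \<and> length ys = arity L R")
      case True
      then have "ys \<in> interp ?F R \<longleftrightarrow> map F ys \<in> interp N R"
        using F ys unfolding is_isomorphism_def uF by blast
      then show ?thesis using sF unfolding iN by simp
    next
      case False
      then have "ys \<notin> interp ?F R" using stF unfolding is_structure_def by blast
      moreover have "map F ys \<notin> interp M R" using False interpD[of "map F ys" R] by auto
      ultimately show ?thesis by simp
    qed
  qed
  have "\<forall>x\<in>B. \<forall>y\<in>C. \<beta> x = \<gamma> y \<longrightarrow> x = y" using \<beta>\<gamma> by simp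
  note eq = free_amalgam_interp_iff[OF \<beta> \<gamma> this]
  have injF: "inj_on F (\<beta> ` B \<union> \<gamma> ` C)" using bF by (rule bij_betw_imp_inj_on)
  have "\<exists>g\<in>Aut. \<forall>x\<in>B. g x = (F \<circ> \<beta>) x"
  proof (rule extend_partial[OF fin(1) BC(1)])
    show "inj_on (F \<circ> \<beta>) B" by (rule comp_inj_on[OF \<beta> inj_on_subset[OF injF]]) simp
    show "(F \<circ> \<beta>) ` B \<subseteq> U" using Fin by auto
    fix R xs assume xs: "set xs \<subseteq> B"
    have "set (map \<beta> xs) \<subseteq> \<beta> ` B \<union> \<gamma> ` C" using image_mono[OF xs, of \<beta>] by (simp add: le_supI1)
    from iF[OF this, of R] show "xs \<in> interp M R \<longleftrightarrow> map (F \<circ> \<beta>) xs \<in> interp M R"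
      using eq(1)[OF xs, of R] by simp
  qed
  then obtain g where g: "g \<in> Aut" "\<forall>x\<in>B. g x = F (\<beta> x)" by auto
  have "\<exists>h\<in>Aut. \<forall>x\<in>C. h x = (F \<circ> \<gamma>) x"
  proof (rule extend_partial[OF fin(2) BC(2)])
    show "inj_on (F \<circ> \<gamma>) C" by (rule comp_inj_on[OF \<gamma> inj_on_subset[OF injF]]) simp
    show "(F \<circ> \<gamma>) ` C \<subseteq> U" using Fin by auto
    fix R xs assume xs: "set xs \<subseteq> C"
    have "set (map \<gamma> xs) \<subseteq> \<beta> ` B \<union> \<gamma> ` C" using image_mono[OF xs, of \<gamma>] by (simp add: le_supI2)
    from iF[OF this, of R] show "xs \<in> interp M R \<longleftrightarrow> map (F \<circ> \<gamma>) xs \<in> interp M R"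
      using eq(2)[OF xs, of R] by simp
  qed
  then obtain h where h: "h \<in> Aut" "\<forall>x\<in>C. h x = F (\<gamma> x)" by auto
  have agree: "\<forall>x\<in>A. g x = h x" using g(2) h(2) A \<beta>A by (metis subsetD)
  have gB: "g ` B = F ` \<beta> ` B" and hC: "h ` C = F ` \<gamma> ` C" and hA: "h ` A = F ` \<gamma> ` A"
    using g(2) h(2) A(2) by (auto simp: image_image subset_iff)
  have "\<beta> ` B \<inter> \<gamma> ` C = \<gamma> ` A"
  proof
    show "\<beta> ` B \<inter> \<gamma> ` C \<subseteq> \<gamma> ` A" using \<beta>\<gamma> by auto
    show "\<gamma> ` A \<subseteq> \<beta> ` B \<inter> \<gamma> ` C" using A \<beta>A by force
  qed
  then have int: "g ` B \<inter> h ` C = h ` A"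
    unfolding gB hC hA using inj_on_image_Int[OF injF, of "\<beta> ` B" "\<gamma> ` C"] by simp
  have "indep hyperedges (g ` B) (h ` C)"
    unfolding indep_def
  proof (intro ballI impI)
    fix t assume t: "t \<in> hyperedges" "t \<subseteq> g ` B \<union> h ` C"
    obtain xs R where xs: "t = set xs" "xs \<in> interp M R" using t(1) unfolding hyperedges_def by blast
    have "set xs \<subseteq> F ` (\<beta> ` B \<union> \<gamma> ` C)" using t(2) unfolding xs(1) gB hC image_Un .
    from map_preimage[OF this] obtain ys where ys: "set ys \<subseteq> \<beta> ` B \<union> \<gamma> ` C" "xs = map F ys" by auto
    have "ys \<in> interp ?F R" using iF[OF ys(1)] xs(2) ys(2) by simp
    then have "ys \<in> interp (copy \<beta> B) R \<or> ys \<in> interp (copy \<gamma> C) R" unfolding free_amalgam_def by simp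
    then have "set ys \<subseteq> \<beta> ` B \<or> set ys \<subseteq> \<gamma> ` C" using copy_interp_subset by blast
    then show "t \<subseteq> g ` B \<or> t \<subseteq> h ` C" unfolding xs(1) ys(2) gB hC set_map by (auto dest: image_mono[of _ _ F])
  qed
  then show ?thesis using g(1) h(1) agree int by blast
qed

text \<open>The union of g on B and h on C is a partial isomorphism: independence puts every related
  tuple, in the source as in the image, inside one of the two parts, where an automorphism preserves
  it.\<close>

lemma glue_M:
  assumes fin: "finite B" "finite C" and BC: "B \<subseteq> U" "C \<subseteq> U" and gh: "g \<in> Aut" "h \<in> Aut"
    and ind: "indep hyperedges B C" "indep hyperedges (g ` B) (h ` C)"
    and agree: "\<And>x. x \<in> B \<inter> C \<Longrightarrow> g x = h x" and int: "g ` B \<inter> h ` C = g ` (B \<inter> C)"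
  shows "\<exists>k\<in>Aut. (\<forall>x\<in>B. k x = g x) \<and> (\<forall>x\<in>C. k x = h x)"
proof -
  define p where "p x = (if x \<in> B then g x else h x)" for x
  have pB: "p x = g x" if "x \<in> B" for x using that unfolding p_def by simp
  have pC: "p x = h x" if "x \<in> C" for x using that agree unfolding p_def by auto
  have injg: "inj_on g U" and injh: "inj_on h U" using AutD(2)[OF gh(1)] AutD(2)[OF gh(2)] by (auto dest: bij_betw_imp_inj_on)
  \<comment> \<open>This lets a tuple whose image lies in one part be pulled back to that
    part.\<close>
  have backB: "x \<in> B" if x: "x \<in> C" "h x \<in> g ` B" for x
  proof -
    have "h x \<in> g ` (B \<inter> C)" using x int by blast
    then obtain y where y: "y \<in> B \<inter> C" "h x = g y" by blast
    then have "h x = h y" using agree by simp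
    then have "x = y" using x(1) y(1) BC(2) injh by (meson IntD2 inj_onD subsetD)
    then show ?thesis using y(1) by simp
  qed
  have backC: "x \<in> C" if x: "x \<in> B" "g x \<in> h ` C" for x
  proof -
    have "g x \<in> g ` (B \<inter> C)" using x int by blast
    then obtain y where y: "y \<in> B \<inter> C" "g x = g y" by blast
    then have "x = y" using x(1) BC(1) injg by (meson IntD1 inj_onD subsetD)
    then show ?thesis using y(1) by simp
  qed
  have "\<exists>k\<in>Aut. \<forall>x\<in>B \<union> C. k x = p x"
  proof (rule extend_partial)
    show "finite (B \<union> C)" "B \<union> C \<subseteq> U" using fin BC by simp_all
    show "p ` (B \<union> C) \<subseteq> U" using pB pC BC AutD(3)[OF gh(1)] AutD(3)[OF gh(2)] by auto
    show "inj_on p (B \<union> C)"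
    proof (rule inj_onI)
      fix x y assume xy: "x \<in> B \<union> C" "y \<in> B \<union> C" "p x = p y"
      consider "x \<in> B" "y \<in> B" | "x \<in> C" "y \<in> C" | "x \<in> B" "y \<in> C" | "x \<in> C" "y \<in> B" using xy by blast
      then show "x = y"
      proof cases
        case 1
        then show ?thesis using xy(3) pB BC injg by (metis inj_onD subsetD)
      next
        case 2
        then show ?thesis using xy(3) pC BC injh by (metis inj_onD subsetD)
      next
        case 3
        then have "y \<in> B" using xy(3) pB pC backB by (metis imageI)
        then show ?thesis using 3 xy(3) pB BC injg by (metis inj_onD subsetD)
      next
        case 4
        then have "x \<in> B" using xy(3) pB pC backB by (metis imageI)
        then show ?thesis using 4 xy(3) pB BC injg by (metis inj_onD subsetD)
      qed
    qed
    fix R xs assume xs: "set xs \<subseteq> B \<union> C"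
    have onB: "xs \<in> interp M R \<longleftrightarrow> map p xs \<in> interp M R" if "set xs \<subseteq> B"
    proof -
      have "map p xs = map g xs" using that pB by auto
      then show ?thesis using AutD(4)[OF gh(1)] that BC(1) by (metis subset_trans)
    qed
    have onC: "xs \<in> interp M R \<longleftrightarrow> map p xs \<in> interp M R" if "set xs \<subseteq> C"
    proof -
      have "map p xs = map h xs" using that pC by auto
      then show ?thesis using AutD(4)[OF gh(2)] that BC(2) by (metis subset_trans)
    qed
    show "xs \<in> interp M R \<longleftrightarrow> map p xs \<in> interp M R"
    proof
      assume x: "xs \<in> interp M R"
      then have "set xs \<in> hyperedges" unfolding hyperedges_def by blast
      then have "set xs \<subseteq> B \<or> set xs \<subseteq> C" using xs by (rule indepD[OF ind(1)])
      then show "map p xs \<in> interp M R" using x onB onC by blast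
    next
      assume x: "map p xs \<in> interp M R"
      have "set (map p xs) \<in> hyperedges" using x unfolding hyperedges_def by blast
      moreover have "set (map p xs) \<subseteq> g ` B \<union> h ` C"
      proof
        fix z assume "z \<in> set (map p xs)"
        then obtain y where "y \<in> set xs" "z = p y" by auto
        then show "z \<in> g ` B \<union> h ` C" using xs pB pC by blast
      qed
      ultimately have "set (map p xs) \<subseteq> g ` B \<or> set (map p xs) \<subseteq> h ` C" by (rule indepD[OF ind(2)])
      then have "set xs \<subseteq> B \<or> set xs \<subseteq> C"
      proof
        assume s: "set (map p xs) \<subseteq> g ` B"
        have "y \<in> B" if y: "y \<in> set xs" for y
        proof (rule ccontr)
          assume "y \<notin> B"
          then have "y \<in> C" using y xs by blast
          moreover have "p y \<in> g ` B" using s y by auto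
          ultimately show False using \<open>y \<notin> B\<close> backB pC by simp
        qed
        then show ?thesis by blast
      next
        assume s: "set (map p xs) \<subseteq> h ` C"
        have "y \<in> C" if y: "y \<in> set xs" for y
        proof (rule ccontr)
          assume "y \<notin> C"
          then have "y \<in> B" using y xs by blast
          moreover have "p y \<in> h ` C" using s y by auto
          ultimately show False using \<open>y \<notin> C\<close> backC pB by simp
        qed
        then show ?thesis by blast
      qed
      then show "xs \<in> interp M R" using x onB onC by blast
    qed
  qed
  then obtain k where "k \<in> Aut" "\<forall>x\<in>B \<union> C. k x = p x" by blast
  then show ?thesis using pB pC by (intro bexI[of _ k]) auto
qed

text \<open>Amalgamating a finite U with itself freely over the empty set would need two disjoint
  copies of U inside U.\<close>

lemma infinite_universe:
  assumes "U \<noteq> {}"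
  shows "infinite U"
proof
  assume "finite U"
  then obtain g h where gh: "g \<in> Aut" "h \<in> Aut" "g ` U \<inter> h ` U = h ` {}"
    using free_M[of U U "{}"] by auto
  have "g ` U = U" "h ` U = U" using AutD(2) gh(1,2) by (auto simp: bij_betw_def)
  then show False using gh(3) assms by simp
qed


lemma mult_aut_group: "f \<in> Aut \<Longrightarrow> g \<in> Aut \<Longrightarrow> f \<otimes>\<^bsub>aut_group L M\<^esub> g = compose U f g"
  using AutD(1)[of f] AutD(1)[of g] by (simp add: aut_group_def BijGroup_def)

lemma Aut_compose: "f \<in> Aut \<Longrightarrow> g \<in> Aut \<Longrightarrow> compose U f g \<in> Aut"
  using monoid.m_closed[OF group.is_monoid[OF group_aut_group]] mult_aut_group by metis

lemma one_aut_group: "\<one>\<^bsub>aut_group L M\<^esub> = (\<lambda>x\<in>U. x)"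
  by (simp add: aut_group_def BijGroup_def)

lemma Aut_id: "(\<lambda>x\<in>U. x) \<in> Aut"
  using monoid.one_closed[OF group.is_monoid[OF group_aut_group[of L M]]] one_aut_group by simp

lemma Aut_inverse:
  assumes f: "f \<in> Aut"
  obtains f' where "f' \<in> Aut" "\<And>x. x \<in> U \<Longrightarrow> f' (f x) = x" "\<And>x. x \<in> U \<Longrightarrow> f (f' x) = x"
proof -
  obtain f' where f': "f' \<in> Aut" "f' \<otimes>\<^bsub>aut_group L M\<^esub> f = \<one>\<^bsub>aut_group L M\<^esub>" "f \<otimes>\<^bsub>aut_group L M\<^esub> f' = \<one>\<^bsub>aut_group L M\<^esub>"
    using group.l_inv[OF group_aut_group f] group.r_inv[OF group_aut_group f] group.inv_closed[OF group_aut_group f]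
    by metis
  then have "compose U f' f = (\<lambda>x\<in>U. x)" "compose U f f' = (\<lambda>x\<in>U. x)"
    using mult_aut_group f one_aut_group by simp_all
  then have "f' (f x) = x" "f (f' x) = x" if "x \<in> U" for x
    using that by (auto simp: compose_def fun_eq_iff split: if_splits)
  then show ?thesis by (rule that[OF f'(1)])
qed

text \<open>Two copies of {a, y} in free position over a have different second points, and the
  inverse of h composed with g compares them. The faithfulness of the conjugation action rests on
  this.\<close>

lemma move_point:
  assumes "a \<in> U" "y \<in> U" "a \<noteq> y"
  shows "\<exists>g\<in>Aut. g a = a \<and> g y \<noteq> y"
proof -
  obtain g h where gh: "g \<in> Aut" "h \<in> Aut" "g a = h a" "g ` {a, y} \<inter> h ` {a, y} = h ` {a}"
    using free_M[of "{a, y}" "{a, y}" "{a}"] assms by auto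
  obtain h' where h': "h' \<in> Aut" "\<And>x. x \<in> U \<Longrightarrow> h' (h x) = x" "\<And>x. x \<in> U \<Longrightarrow> h (h' x) = x"
    using Aut_inverse[OF gh(2)] by metis
  have hya: "h y \<noteq> h a" using h'(2) assms by metis
  have "g y \<noteq> h y"
  proof
    assume "g y = h y"
    then have "h y \<in> g ` {a, y} \<inter> h ` {a, y}" by simp
    then show False unfolding gh(4) using hya by simp
  qed
  then have "h' (g y) \<noteq> y" using h'(3)[OF AutD(3)[OF gh(1) assms(2)]] by metis
  then show ?thesis using Aut_compose[OF h'(1) gh(1)] h'(2) gh(3) assms
    by (intro bexI[of _ "compose U h' g"]) (simp_all add: compose_def)
qed

text \<open>
  The universe, if nonempty, is identified with \<open>nat\<close>; for an empty universe \<open>decode_pt\<close> is junk.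
\<close>

definition code_pt :: "'a \<Rightarrow> nat" where "code_pt = to_nat_on U"

definition decode_pt :: "nat \<Rightarrow> 'a" where "decode_pt = from_nat_into U"

definition lift_perm :: "('a \<Rightarrow> 'a) \<Rightarrow> nat \<Rightarrow> nat" where
  "lift_perm f n = code_pt (f (decode_pt n))"

section \<open>Transfer to permutations of \<open>nat\<close>\<close>

context
  assumes ne: "U \<noteq> {}"
begin

lemma decode_mem: "decode_pt n \<in> U"
  unfolding decode_pt_def using ne by (rule from_nat_into)

lemma code_decode [simp]: "code_pt (decode_pt n) = n"
  unfolding code_pt_def decode_pt_def using cnt infinite_universe[OF ne] by (rule to_nat_on_from_nat_into_infinite)

lemma decode_code: "x \<in> U \<Longrightarrow> decode_pt (code_pt x) = x"
  unfolding code_pt_def decode_pt_def using cnt by (rule from_nat_into_to_nat_on)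

lemma decode_lift: "f \<in> Aut \<Longrightarrow> decode_pt (lift_perm f n) = f (decode_pt n)"
  unfolding lift_perm_def by (simp add: decode_code AutD(3) decode_mem)

lemma lift_compose: "f \<in> Aut \<Longrightarrow> g \<in> Aut \<Longrightarrow> lift_perm (compose U f g) = lift_perm f \<circ> lift_perm g"
  by (rule ext) (simp add: lift_perm_def compose_def decode_mem decode_code AutD(3))

lemma lift_inverse:
  assumes "f \<in> Aut"
  shows "\<exists>f'\<in>Aut. bij (lift_perm f) \<and> pinv (lift_perm f) = lift_perm f'"
proof -
  obtain f' where f': "f' \<in> Aut" "\<And>x. x \<in> U \<Longrightarrow> f' (f x) = x" "\<And>x. x \<in> U \<Longrightarrow> f (f' x) = x"
    using Aut_inverse[OF assms] by metis
  have 1: "lift_perm f' (lift_perm f n) = n" "lift_perm f (lift_perm f' n) = n" for n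
    using f' assms by (simp_all add: lift_perm_def decode_code AutD(3) decode_mem)
  then have "bij (lift_perm f)" by (intro o_bij[of "lift_perm f'"]) auto
  moreover have "pinv (lift_perm f) = lift_perm f'" using 1 by (intro inv_equality)
  ultimately show ?thesis using f'(1) by blast
qed

lemma lift_image: "f \<in> Aut \<Longrightarrow> X \<subseteq> U \<Longrightarrow> lift_perm f ` code_pt ` X = code_pt ` f ` X"
  by (auto simp: lift_perm_def image_image decode_code subset_iff intro!: image_cong)

lemma code_image_decode: "code_pt ` decode_pt ` X = X"
  by (simp add: image_image)

lemma inj_code: "inj_on code_pt U"
  unfolding code_pt_def by (rule inj_on_to_nat_on[OF cnt])

lemma indep_code:
  assumes "X \<subseteq> U" "Y \<subseteq> U"
  shows "indep ((`) code_pt ` hyperedges) (code_pt ` X) (code_pt ` Y) \<longleftrightarrow> indep hyperedges X Y"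
proof -
  have *: "code_pt ` s \<subseteq> code_pt ` Z \<longleftrightarrow> s \<subseteq> Z" if "s \<in> hyperedges" "Z \<subseteq> U" for s Z
  proof
    assume sub: "code_pt ` s \<subseteq> code_pt ` Z"
    show "s \<subseteq> Z"
    proof
      fix x assume x: "x \<in> s"
      then have "code_pt x \<in> code_pt ` Z" using sub by blast
      then show "x \<in> Z" using inj_on_image_mem_iff[OF inj_code _ that(2)] hyperedges_subset[OF that(1)] x by blast
    qed
  qed (rule image_mono)
  show ?thesis
    unfolding indep_def using * assms by (simp add: image_Un[symmetric])
qed

text \<open>Being an automorphism is a condition on finite tuples, and on each of them f agrees with
  a lifted automorphism.\<close>

lemma lift_closed:
  assumes f: "bij f" and app: "\<And>S. finite S \<Longrightarrow> \<exists>g\<in>lift_perm ` Aut. \<forall>x\<in>S. g x = f x"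
  shows "f \<in> lift_perm ` Aut"
proof -
  define u where "u = (\<lambda>x\<in>U. decode_pt (f (code_pt x)))"
  have u: "u x = decode_pt (f (code_pt x))" if "x \<in> U" for x using that unfolding u_def by simp
  have "u \<in> Aut"
    unfolding Aut_iff
  proof (intro conjI allI impI)
    show "u \<in> extensional U" unfolding u_def by simp
    show "bij_betw u U U"
    proof (rule bij_betwI[where g = "\<lambda>x. decode_pt (pinv f (code_pt x))"])
      show "u \<in> U \<rightarrow> U" "(\<lambda>x. decode_pt (pinv f (code_pt x))) \<in> U \<rightarrow> U" using u decode_mem by auto
      show "decode_pt (pinv f (code_pt (u x))) = x" if "x \<in> U" for x
        using that f by (simp add: u decode_code bij_is_inj)
      show "u (decode_pt (pinv f (code_pt x))) = x" if "x \<in> U" for x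
        using that f by (simp add: u decode_mem decode_code bij_is_surj surj_f_inv_f)
    qed
    fix R xs assume xs: "set xs \<subseteq> U"
    have "finite (code_pt ` set xs)" by simp
    from app[OF this] obtain g where g: "g \<in> Aut" "\<forall>x\<in>set xs. lift_perm g (code_pt x) = f (code_pt x)" by auto
    have "g x = u x" if "x \<in> set xs" for x
    proof -
      have "x \<in> U" using that xs by blast
      then have "g x = decode_pt (lift_perm g (code_pt x))" using g(1) by (simp add: decode_lift decode_code)
      then show ?thesis using g(2) that u[OF \<open>x \<in> U\<close>] by simp
    qed
    then have gu: "map g xs = map u xs" by simp
    show "xs \<in> interp M R \<longleftrightarrow> map u xs \<in> interp M R"
      unfolding gu[symmetric] by (rule AutD(4)[OF g(1) xs])
  qed
  moreover have "f = lift_perm u" by (rule ext) (simp add: lift_perm_def u decode_mem)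
  ultimately show ?thesis by blast
qed

text \<open>\<open>free_M\<close> moves both parts, one by g and one by h; composing with the
  inverse of h leaves C in place.\<close>

lemma lift_free:
  assumes "finite B" "finite C" "A \<subseteq> B" "A \<subseteq> C"
  shows "\<exists>k\<in>lift_perm ` Aut. (\<forall>x\<in>A. k x = x) \<and> k ` B \<inter> C = A \<and> indep ((`) code_pt ` hyperedges) (k ` B) C"
proof -
  let ?H = "(`) code_pt ` hyperedges"
  have sub: "decode_pt ` X \<subseteq> U" for X using decode_mem by blast
  have "finite (decode_pt ` B)" "finite (decode_pt ` C)" "decode_pt ` A \<subseteq> decode_pt ` B" "decode_pt ` A \<subseteq> decode_pt ` C"
    using assms by auto
  from free_M[OF this(1,2) sub sub this(3,4)] obtain g h where g: "g \<in> Aut" and h: "h \<in> Aut"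
    and gh: "\<forall>x\<in>decode_pt ` A. g x = h x" "g ` decode_pt ` B \<inter> h ` decode_pt ` C = h ` decode_pt ` A"
      "indep hyperedges (g ` decode_pt ` B) (h ` decode_pt ` C)"
    by auto
  have im: "lift_perm f ` X = code_pt ` f ` decode_pt ` X" if "f \<in> Aut" for f X
    using lift_image[OF that sub, of X] by (simp add: code_image_decode)
  have imU: "f ` decode_pt ` X \<subseteq> U" if "f \<in> Aut" for f X using AutD(3)[OF that] decode_mem by blast
  obtain h' where h': "h' \<in> Aut" "bij (lift_perm h)" "pinv (lift_perm h) = lift_perm h'" using lift_inverse[OF h] by auto
  have hh: "lift_perm h' (lift_perm h n) = n" "lift_perm h (lift_perm h' n) = n" for n
    unfolding h'(3)[symmetric] using h'(2) by (simp_all add: bij_is_inj bij_is_surj surj_f_inv_f)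
  have bh': "inj (lift_perm h')" using hh by (metis injI)
  have hX: "lift_perm h' ` lift_perm h ` X = X" for X by (simp add: image_image hh)
  define k where "k = lift_perm (compose U h' g)"
  have k: "k x = lift_perm h' (lift_perm g x)" for x unfolding k_def lift_compose[OF h'(1) g] by simp
  have kB: "k ` B = lift_perm h' ` lift_perm g ` B" by (simp add: image_image k)
  have "k x = x" if "x \<in> A" for x
  proof -
    have "lift_perm g x = lift_perm h x" using gh(1) that unfolding lift_perm_def by simp
    then show ?thesis using k hh by simp
  qed
  moreover have "k ` B \<inter> C = A"
  proof -
    have "lift_perm g ` B \<inter> lift_perm h ` C = lift_perm h ` A"
      unfolding im[OF g] im[OF h] gh(2)[symmetric]
      by (rule inj_on_image_Int[OF inj_code imU[OF g] imU[OF h], symmetric])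
    then have "lift_perm h' ` lift_perm g ` B \<inter> lift_perm h' ` lift_perm h ` C = lift_perm h' ` lift_perm h ` A"
      using image_Int[OF bh', of "lift_perm g ` B" "lift_perm h ` C"] by simp
    then show ?thesis unfolding kB hX .
  qed
  moreover have "indep ?H (k ` B) C"
  proof -
    have "indep ?H (lift_perm g ` B) (lift_perm h ` C)"
      unfolding im[OF g] im[OF h] using gh(3) indep_code[OF imU[OF g] imU[OF h]] by simp
    then have "indep ?H (lift_perm h' ` lift_perm g ` B) (lift_perm h' ` lift_perm h ` C)"
    proof (rule indep_image_bij[where g' = "lift_perm h"])
      fix t assume "t \<in> ?H"
      then obtain s where s: "s \<in> hyperedges" "t = code_pt ` s" by blast
      then have "lift_perm h ` t = code_pt ` h ` s" using lift_image[OF h hyperedges_subset] by simp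
      then show "lift_perm h ` t \<in> ?H" using hyperedges_image[OF s(1) h] by blast
    qed (rule hh)+
    then show ?thesis unfolding kB hX .
  qed
  moreover have "k \<in> lift_perm ` Aut" unfolding k_def using Aut_compose[OF h'(1) g] by (rule imageI)
  ultimately show ?thesis by blast
qed

lemma lift_glue:
  assumes fin: "finite B" "finite C" and gh: "g \<in> Aut" "h \<in> Aut"
    and ind: "indep ((`) code_pt ` hyperedges) B C"
      "indep ((`) code_pt ` hyperedges) (lift_perm g ` B) (lift_perm h ` C)"
    and agree: "\<And>x. x \<in> B \<inter> C \<Longrightarrow> lift_perm g x = lift_perm h x"
    and int: "lift_perm g ` B \<inter> lift_perm h ` C = lift_perm g ` (B \<inter> C)"
  shows "\<exists>k\<in>lift_perm ` Aut. (\<forall>x\<in>B. k x = lift_perm g x) \<and> (\<forall>x\<in>C. k x = lift_perm h x)"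
proof -
  have sub: "decode_pt ` X \<subseteq> U" for X using decode_mem by blast
  have im: "lift_perm f ` X = code_pt ` f ` decode_pt ` X" if "f \<in> Aut" for f X
    using lift_image[OF that sub, of X] by (simp add: code_image_decode)
  have imU: "f ` decode_pt ` X \<subseteq> U" if "f \<in> Aut" for f X using AutD(3)[OF that] decode_mem by blast
  have "inj decode_pt" using code_decode by (metis injI)
  then have dInt: "decode_pt ` (B \<inter> C) = decode_pt ` B \<inter> decode_pt ` C" by (rule image_Int)
  have "\<exists>k\<in>Aut. (\<forall>x\<in>decode_pt ` B. k x = g x) \<and> (\<forall>x\<in>decode_pt ` C. k x = h x)"
  proof (rule glue_M)
    show "finite (decode_pt ` B)" "finite (decode_pt ` C)" using fin by simp_all
    show "indep hyperedges (decode_pt ` B) (decode_pt ` C)"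
      using indep_code[OF sub sub, of B C] ind(1) by (simp add: code_image_decode)
    show "indep hyperedges (g ` decode_pt ` B) (h ` decode_pt ` C)"
      using indep_code[OF imU[OF gh(1)] imU[OF gh(2)], of B C] ind(2) unfolding im[OF gh(1)] im[OF gh(2)] by simp
    show "g x = h x" if x: "x \<in> decode_pt ` B \<inter> decode_pt ` C" for x
    proof -
      obtain n where "n \<in> B \<inter> C" "x = decode_pt n" using x unfolding dInt[symmetric] by blast
      then show ?thesis using arg_cong[OF agree, of n decode_pt] decode_lift gh by simp
    qed
    have "code_pt ` (g ` decode_pt ` B \<inter> h ` decode_pt ` C) = code_pt ` g ` (decode_pt ` B \<inter> decode_pt ` C)"
      using int unfolding im[OF gh(1)] im[OF gh(2)] dInt
        inj_on_image_Int[OF inj_code imU[OF gh(1)] imU[OF gh(2)]] .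
    moreover have "g ` decode_pt ` B \<inter> h ` decode_pt ` C \<subseteq> U"
      using imU[OF gh(1), of B] by (rule le_infI1)
    moreover have "g ` (decode_pt ` B \<inter> decode_pt ` C) \<subseteq> U"
      unfolding dInt[symmetric] by (rule imU[OF gh(1)])
    ultimately show "g ` decode_pt ` B \<inter> h ` decode_pt ` C = g ` (decode_pt ` B \<inter> decode_pt ` C)"
      by (simp add: inj_on_image_eq_iff[OF inj_code])
  qed (rule sub gh)+
  then obtain k where k: "k \<in> Aut" "\<forall>x\<in>decode_pt ` B. k x = g x" "\<forall>x\<in>decode_pt ` C. k x = h x" by blast
  then show ?thesis by (intro bexI[of _ "lift_perm k"]) (simp_all add: lift_perm_def)
qed

lemma lifted_free_perm_group: "free_perm_group (lift_perm ` Aut) ((`) code_pt ` hyperedges)"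
proof
  fix g assume "g \<in> lift_perm ` Aut"
  then obtain f where f: "f \<in> Aut" "g = lift_perm f" by blast
  show "bij g" "pinv g \<in> lift_perm ` Aut" using lift_inverse[OF f(1)] f(2) by auto
next
  have "id = lift_perm (\<lambda>x\<in>U. x)" by (rule ext) (simp add: lift_perm_def decode_mem)
  then show "id \<in> lift_perm ` Aut" using Aut_id by blast
next
  fix g h assume "g \<in> lift_perm ` Aut" "h \<in> lift_perm ` Aut"
  then obtain g' h' where "g' \<in> Aut" "h' \<in> Aut" "g = lift_perm g'" "h = lift_perm h'" by blast
  then show "g \<circ> h \<in> lift_perm ` Aut" using lift_compose Aut_compose by (metis imageI)
next
  fix f :: "nat \<Rightarrow> nat" assume "bij f" "\<And>S. finite S \<Longrightarrow> \<exists>g\<in>lift_perm ` Aut. \<forall>x\<in>S. g x = f x"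
  then show "f \<in> lift_perm ` Aut" by (rule lift_closed)
next
  fix t g assume "t \<in> (`) code_pt ` hyperedges" "g \<in> lift_perm ` Aut"
  then obtain s f where s: "s \<in> hyperedges" "t = code_pt ` s" and f: "f \<in> Aut" "g = lift_perm f" by blast
  then have "g ` t = code_pt ` f ` s" using lift_image[OF f(1) hyperedges_subset] by simp
  then show "g ` t \<in> (`) code_pt ` hyperedges" using hyperedges_image[OF s(1) f(1)] by blast
next
  fix A B C :: "nat set" assume "finite B" "finite C" "A \<subseteq> B" "A \<subseteq> C"
  then show "\<exists>k\<in>lift_perm ` Aut. (\<forall>x\<in>A. k x = x) \<and> k ` B \<inter> C = A \<and> indep ((`) code_pt ` hyperedges) (k ` B) C"
    by (rule lift_free)
next
  fix B C :: "nat set" and g h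
  assume a: "finite B" "finite C" "g \<in> lift_perm ` Aut" "h \<in> lift_perm ` Aut"
    "indep ((`) code_pt ` hyperedges) B C" "\<And>x. x \<in> B \<inter> C \<Longrightarrow> g x = h x" "g ` B \<inter> h ` C = g ` (B \<inter> C)"
    "indep ((`) code_pt ` hyperedges) (g ` B) (h ` C)"
  obtain g' h' where gh: "g' \<in> Aut" "h' \<in> Aut" "g = lift_perm g'" "h = lift_perm h'" using a(3,4) by blast
  show "\<exists>k\<in>lift_perm ` Aut. (\<forall>x\<in>B. k x = g x) \<and> (\<forall>x\<in>C. k x = h x)"
    using a(5-) unfolding gh(3,4) by (intro lift_glue[OF a(1,2) gh(1,2)])
qed

lemma automorphism_conjugation_nonempty:
  assumes bij_\<theta>: "bij_betw \<theta> Aut Aut" and hom_\<theta>: "\<And>f g. f \<in> Aut \<Longrightarrow> g \<in> Aut \<Longrightarrow> \<theta> (compose U f g) = compose U (\<theta> f) (\<theta> g)"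
  shows "\<exists>h\<in>Bij U. \<forall>g\<in>Aut. \<forall>x\<in>U. \<theta> g (h x) = h (g x)"
proof -
  let ?G = "lift_perm ` Aut"
  have inj: "inj_on lift_perm Aut"
  proof (rule inj_onI)
    fix f g assume f: "f \<in> Aut" and g: "g \<in> Aut" and eq: "lift_perm f = lift_perm g"
    have "f x = g x" if "x \<in> U" for x
      using decode_lift[OF f, of "code_pt x"] decode_lift[OF g, of "code_pt x"] eq decode_code[OF that] by simp
    then show "f = g" using AutD(1)[OF f] AutD(1)[OF g] unfolding Bij_def by (blast intro: extensionalityI)
  qed
  define \<delta> where "\<delta> = inv_into Aut lift_perm"
  have \<delta>: "\<delta> (lift_perm f) = f" if "f \<in> Aut" for f unfolding \<delta>_def using inj that by simp
  define \<alpha> where "\<alpha> = lift_perm \<circ> (\<theta> \<circ> \<delta>)"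
  have \<theta>: "\<theta> f \<in> Aut" if "f \<in> Aut" for f using bij_\<theta> that by (auto dest: bij_betwE)
  have \<alpha>: "\<alpha> (lift_perm f) = lift_perm (\<theta> f)" if "f \<in> Aut" for f unfolding \<alpha>_def using \<delta>[OF that] by simp
  interpret free_perm_group ?G "(`) code_pt ` hyperedges" by (rule lifted_free_perm_group)
  have "bij_betw \<alpha> ?G ?G"
    unfolding \<alpha>_def \<delta>_def using inj_on_imp_bij_betw[OF inj] bij_\<theta>
    by (intro bij_betw_trans[of _ _ Aut] bij_betw_inv_into)
  moreover have "\<alpha> (f \<circ> g) = \<alpha> f \<circ> \<alpha> g" if "f \<in> ?G" "g \<in> ?G" for f g
  proof -
    obtain f' g' where fg: "f' \<in> Aut" "g' \<in> Aut" "f = lift_perm f'" "g = lift_perm g'" using \<open>f \<in> ?G\<close> \<open>g \<in> ?G\<close> by blast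
    have "\<alpha> (f \<circ> g) = lift_perm (\<theta> (compose U f' g'))"
      unfolding fg(3,4) lift_compose[OF fg(1,2), symmetric] by (rule \<alpha>[OF Aut_compose[OF fg(1,2)]])
    also have "\<dots> = \<alpha> f \<circ> \<alpha> g"
      unfolding fg(3,4) \<alpha>[OF fg(1)] \<alpha>[OF fg(2)] hom_\<theta>[OF fg(1,2)] by (rule lift_compose[OF \<theta> \<theta>]) fact+
    finally show ?thesis .
  qed
  ultimately interpret free_perm_group_automorphism ?G "(`) code_pt ` hyperedges" \<alpha>
    by unfold_locales
  obtain \<phi> where \<phi>: "bij \<phi>" "\<forall>g\<in>?G. \<forall>x. \<phi> (g x) = \<alpha> g (\<phi> x)" using automorphism_is_conjugation by blast
  define h where "h = (\<lambda>x\<in>U. decode_pt (\<phi> (code_pt x)))"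
  have h: "h x = decode_pt (\<phi> (code_pt x))" if "x \<in> U" for x using that unfolding h_def by simp
  have "bij_betw h U U"
  proof (rule bij_betwI[where g = "\<lambda>x. decode_pt (pinv \<phi> (code_pt x))"])
    show "h \<in> U \<rightarrow> U" "(\<lambda>x. decode_pt (pinv \<phi> (code_pt x))) \<in> U \<rightarrow> U" using h decode_mem by auto
    show "decode_pt (pinv \<phi> (code_pt (h x))) = x" if "x \<in> U" for x
      using that \<phi>(1) by (simp add: h decode_code bij_is_inj)
    show "h (decode_pt (pinv \<phi> (code_pt x))) = x" if "x \<in> U" for x
      using that \<phi>(1) by (simp add: h decode_mem decode_code bij_is_surj surj_f_inv_f)
  qed
  then have "h \<in> Bij U" unfolding Bij_def h_def by simp
  moreover have "\<theta> g (h x) = h (g x)" if g: "g \<in> Aut" and x: "x \<in> U" for g x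
  proof -
    have "\<phi> (lift_perm g (code_pt x)) = \<alpha> (lift_perm g) (\<phi> (code_pt x))" using \<phi>(2) g by blast
    then have "decode_pt (\<phi> (lift_perm g (code_pt x))) = \<theta> g (decode_pt (\<phi> (code_pt x)))"
      unfolding \<alpha>[OF g] using decode_lift[OF \<theta>[OF g]] by simp
    moreover have "lift_perm g (code_pt x) = code_pt (g x)" unfolding lift_perm_def decode_code[OF x] ..
    ultimately show ?thesis using h[OF x] h[OF AutD(3)[OF g x]] by simp
  qed
  ultimately show ?thesis by blast
qed

end

lemma automorphism_conjugation:
  assumes bij: "bij_betw \<theta> Aut Aut" and hom: "\<And>f g. f \<in> Aut \<Longrightarrow> g \<in> Aut \<Longrightarrow> \<theta> (compose U f g) = compose U (\<theta> f) (\<theta> g)"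
  shows "\<exists>h\<in>Bij U. \<forall>g\<in>Aut. \<forall>x\<in>U. \<theta> g (h x) = h (g x)"
proof (cases "U = {}")
  case True
  then show ?thesis using AutD(1)[OF Aut_id] by (intro bexI[of _ "\<lambda>x\<in>U. x"]) auto
next
  case False
  then show ?thesis using automorphism_conjugation_nonempty[OF _ assms] by blast
qed

section \<open>Conjugation by automorphisms of the orbital structure\<close>

abbreviation "OAut \<equiv> carrier (aut_group orbital_language (orbital_structure L M))"

lemma orbital_interp_iff:
  assumes "length as = n" "length bs = n" "0 < n"
  shows "as @ bs \<in> interp (orbital_structure L M) n \<longleftrightarrow>
    set as \<subseteq> U \<and> set bs \<subseteq> U \<and> (\<exists>g\<in>Aut. map g as = bs)"
  using assms unfolding orbital_structure_def by auto

lemma OAut_iff: "h \<in> OAut \<longleftrightarrow> h \<in> Bij U \<and> (\<forall>as bs. set as \<subseteq> U \<and> set bs \<subseteq> U \<and> length as = length bs \<longrightarrow>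
  ((\<exists>g\<in>Aut. map g as = bs) \<longleftrightarrow> (\<exists>g\<in>Aut. map g (map h as) = map h bs)))"
proof -
  have univ: "universe (orbital_structure L M) = U" unfolding orbital_structure_def by simp
  have OA: "h \<in> OAut \<longleftrightarrow> h \<in> Bij U \<and> is_isomorphism orbital_language (orbital_structure L M) (orbital_structure L M) h"
    unfolding aut_group_def univ by simp
  have into: "set (map h xs) \<subseteq> U" if "h \<in> Bij U" "set xs \<subseteq> U" for xs
    using that by (auto simp: Bij_def dest: bij_betwE)
  have orbital_iff: "(as @ bs \<in> interp (orbital_structure L M) (length as) \<longleftrightarrow>
      map h as @ map h bs \<in> interp (orbital_structure L M) (length as)) \<longleftrightarrow>
    ((\<exists>g\<in>Aut. map g as = bs) \<longleftrightarrow> (\<exists>g\<in>Aut. map g (map h as) = map h bs))"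
    if h: "h \<in> Bij U" and ab: "set as \<subseteq> U" "set bs \<subseteq> U" "length as = length bs" and n: "0 < length as" for as bs
  proof -
    have l: "length (map h as) = length as" "length (map h bs) = length as" using ab(3) by simp_all
    show ?thesis
      unfolding orbital_interp_iff[OF refl ab(3)[symmetric] n] orbital_interp_iff[OF l n]
      using ab(1,2) into[OF h ab(1)] into[OF h ab(2)] by blast
  qed
  show ?thesis
  proof
    assume "h \<in> OAut"
    then have h: "h \<in> Bij U" and iso: "is_isomorphism orbital_language (orbital_structure L M) (orbital_structure L M) h"
      using OA by simp_all
    have "(\<exists>g\<in>Aut. map g as = bs) \<longleftrightarrow> (\<exists>g\<in>Aut. map g (map h as) = map h bs)"
      if ab: "set as \<subseteq> U" "set bs \<subseteq> U" "length as = length bs" for as bs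
    proof (cases "as = []")
      case False
      then have n: "0 < length as" by simp
      then have "length as \<in> symbols orbital_language" "length (as @ bs) = arity orbital_language (length as)"
        "set (as @ bs) \<subseteq> universe (orbital_structure L M)"
        using ab unfolding orbital_language_def univ by simp_all
      then have "as @ bs \<in> interp (orbital_structure L M) (length as) \<longleftrightarrow>
        map h (as @ bs) \<in> interp (orbital_structure L M) (length as)"
        using iso unfolding is_isomorphism_def by blast
      then show ?thesis unfolding map_append by (rule orbital_iff[OF h ab n, THEN iffD1])
    qed (use ab Aut_id in auto)
    then show "h \<in> Bij U \<and> (\<forall>as bs. set as \<subseteq> U \<and> set bs \<subseteq> U \<and> length as = length bs \<longrightarrow>
      ((\<exists>g\<in>Aut. map g as = bs) \<longleftrightarrow> (\<exists>g\<in>Aut. map g (map h as) = map h bs)))" using h by blast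
  next
    assume H: "h \<in> Bij U \<and> (\<forall>as bs. set as \<subseteq> U \<and> set bs \<subseteq> U \<and> length as = length bs \<longrightarrow>
      ((\<exists>g\<in>Aut. map g as = bs) \<longleftrightarrow> (\<exists>g\<in>Aut. map g (map h as) = map h bs)))"
    have "is_isomorphism orbital_language (orbital_structure L M) (orbital_structure L M) h"
      unfolding is_isomorphism_def
    proof (intro conjI ballI allI impI)
      show "bij_betw h (universe (orbital_structure L M)) (universe (orbital_structure L M))"
        using H unfolding univ Bij_def by simp
      fix n xs assume n: "n \<in> symbols orbital_language"
        and xs: "length xs = arity orbital_language n \<and> set xs \<subseteq> universe (orbital_structure L M)"
      have n0: "0 < n" "length xs = 2 * n" and xsU: "set xs \<subseteq> U" using n xs unfolding orbital_language_def univ by simp_all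
      define as where "as = take n xs"
      define bs where "bs = drop n xs"
      have ab: "xs = as @ bs" "length as = n" "length bs = n" using n0 unfolding as_def bs_def by simp_all
      have abU: "set as \<subseteq> U" "set bs \<subseteq> U" using xsU unfolding ab(1) by simp_all
      have "(\<exists>g\<in>Aut. map g as = bs) \<longleftrightarrow> (\<exists>g\<in>Aut. map g (map h as) = map h bs)" using H abU ab(2,3) by simp
      then show "xs \<in> interp (orbital_structure L M) n \<longleftrightarrow> map h xs \<in> interp (orbital_structure L M) n"
        using orbital_iff[OF conjunct1[OF H] abU, THEN iffD2] ab(2,3) n0(1) unfolding ab(1) map_append by simp
    qed
    then show "h \<in> OAut" using OA H by simp
  qed
qed

text \<open>The conjugate of g by h, restricted to \<open>U\<close> so that it is extensional like
  the elements of \<open>Bij\<close>.\<close>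

definition conj_by :: "('a \<Rightarrow> 'a) \<Rightarrow> ('a \<Rightarrow> 'a) \<Rightarrow> 'a \<Rightarrow> 'a" where
  "conj_by h g = (\<lambda>y\<in>U. h (g (inv_into U h y)))"

lemma BijD: "h \<in> Bij U \<Longrightarrow> x \<in> U \<Longrightarrow> h x \<in> U" "h \<in> Bij U \<Longrightarrow> y \<in> U \<Longrightarrow> \<exists>x\<in>U. y = h x"
  "h \<in> Bij U \<Longrightarrow> x \<in> U \<Longrightarrow> x' \<in> U \<Longrightarrow> h x = h x' \<longleftrightarrow> x = x'"
  by (auto simp: Bij_def bij_betw_def inj_on_eq_iff)

lemma conj_by_apply: "h \<in> Bij U \<Longrightarrow> x \<in> U \<Longrightarrow> conj_by h g (h x) = h (g x)"
  unfolding conj_by_def by (simp add: BijD(1)) (simp add: Bij_def bij_betw_def)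

lemma conj_by_unique:
  assumes "h \<in> Bij U" "k \<in> extensional U" "\<And>x. x \<in> U \<Longrightarrow> k (h x) = h (g x)"
  shows "conj_by h g = k"
proof (rule extensionalityI[of _ U])
  show "conj_by h g \<in> extensional U" unfolding conj_by_def by simp
  fix y assume "y \<in> U"
  then obtain x where "x \<in> U" "y = h x" using BijD(2)[OF assms(1)] by blast
  then show "conj_by h g y = k y" using assms conj_by_apply by simp
qed (fact assms(2))

text \<open>A tuple and its image under g are in one orbit, and h preserves this, so on each tuple
  the conjugate agrees with some automorphism k. Preserving relations concerns one tuple at a time,
  so k may depend on the tuple.\<close>

lemma conj_by_mem:
  assumes h: "h \<in> OAut" and g: "g \<in> Aut"
  shows "conj_by h g \<in> Aut"
proof -
  have hB: "h \<in> Bij U" using h unfolding OAut_iff by simp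
  have gB: "g \<in> Bij U" using g by (rule AutD(1))
  have b: "bij_betw h U U" "bij_betw g U U" using hB gB unfolding Bij_def by simp_all
  have "bij_betw (\<lambda>y. h (g (inv_into U h y))) U U"
    using bij_betw_trans[OF bij_betw_trans[OF bij_betw_inv_into[OF b(1)] b(2)] b(1)] by (simp add: comp_def)
  then have "bij_betw (conj_by h g) U U" unfolding conj_by_def by (simp cong: bij_betw_cong)
  moreover have "xs \<in> interp M R \<longleftrightarrow> map (conj_by h g) xs \<in> interp M R" if xs: "set xs \<subseteq> U" for R xs
  proof -
    have "set xs \<subseteq> h ` U" using xs b(1) unfolding bij_betw_def by simp
    from map_preimage[OF this] obtain as where as: "set as \<subseteq> U" "xs = map h as" by auto
    have gas: "set (map g as) \<subseteq> U" using AutD(3)[OF g] as(1) by auto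
    have "\<exists>k\<in>Aut. map k (map h as) = map h (map g as)"
      using h g as(1) gas unfolding OAut_iff by (metis length_map)
    then obtain k where k: "k \<in> Aut" "map k xs = map h (map g as)" unfolding as(2) by blast
    have "map (conj_by h g) xs = map h (map g as)"
      unfolding as(2) using as(1) conj_by_apply[OF hB] by (auto simp: subset_iff)
    then have "map (conj_by h g) xs = map k xs" using k(2) by simp
    then show ?thesis using AutD(4)[OF k(1) xs] by metis
  qed
  moreover have "conj_by h g \<in> extensional U" unfolding conj_by_def by simp
  ultimately show ?thesis unfolding Aut_iff by blast
qed

lemma OAutI:
  assumes h: "h \<in> Bij U" and \<theta>: "bij_betw \<theta> Aut Aut" and conj: "\<forall>g\<in>Aut. \<forall>x\<in>U. \<theta> g (h x) = h (g x)"
  shows "h \<in> OAut"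
  unfolding OAut_iff
proof (intro conjI allI impI)
  fix as bs assume ab: "set as \<subseteq> U \<and> set bs \<subseteq> U \<and> length as = length bs"
  have eq: "map (\<theta> g) (map h as) = map h (map g as)" if "g \<in> Aut" for g
    using ab conj that by (auto simp: subset_iff)
  show "(\<exists>g\<in>Aut. map g as = bs) \<longleftrightarrow> (\<exists>g\<in>Aut. map g (map h as) = map h bs)"
  proof
    assume "\<exists>g\<in>Aut. map g as = bs"
    then obtain g where g: "g \<in> Aut" "map g as = bs" by blast
    then have "map (\<theta> g) (map h as) = map h bs" using eq by metis
    moreover have "\<theta> g \<in> Aut" using g(1) \<theta> by (auto dest: bij_betwE)
    ultimately show "\<exists>g\<in>Aut. map g (map h as) = map h bs" by blast
  next
    assume "\<exists>g\<in>Aut. map g (map h as) = map h bs"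
    then obtain k where k: "k \<in> Aut" "map k (map h as) = map h bs" by blast
    then obtain g where g: "g \<in> Aut" "k = \<theta> g" using \<theta> by (metis bij_betw_def imageE)
    then have "map h (map g as) = map h bs" using eq k(2) by metis
    moreover have "inj_on h (set (map g as) \<union> set bs)"
    proof (rule inj_on_subset)
      show "inj_on h U" using h unfolding Bij_def bij_betw_def by simp
      show "set (map g as) \<union> set bs \<subseteq> U" using ab AutD(3)[OF g(1)] by auto
    qed
    ultimately have "map g as = bs" using inj_on_map_eq_map by metis
    then show "\<exists>g\<in>Aut. map g as = bs" using g(1) by blast
  qed
qed (fact h)

text \<open>If h a = h' y with a \<noteq> y, take an automorphism fixing a but not y: its conjugate
  by h fixes the common value and its conjugate by h' moves it.\<close>

lemma conj_by_inj:
  assumes h: "h \<in> Bij U" "h' \<in> Bij U" and eq: "\<And>g. g \<in> Aut \<Longrightarrow> conj_by h g = conj_by h' g"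
  shows "h = h'"
proof (rule extensionalityI[of _ U])
  show "h \<in> extensional U" "h' \<in> extensional U" using h unfolding Bij_def by simp_all
  fix a assume a: "a \<in> U"
  obtain y where y: "y \<in> U" "h a = h' y" using BijD(2)[OF h(2) BijD(1)[OF h(1) a]] by blast
  have "a = y"
  proof (rule ccontr)
    assume "a \<noteq> y"
    from move_point[OF a y(1) this] obtain g where g: "g \<in> Aut" "g a = a" "g y \<noteq> y" by blast
    have "h (g a) = h' (g y)"
      using conj_by_apply[OF h(1) a, of g] conj_by_apply[OF h(2) y(1), of g] eq[OF g(1)] y(2) by simp
    then have "h' y = h' (g y)" using g(2) y(2) by simp
    then show False using BijD(3)[OF h(2) y(1) AutD(3)[OF g(1) y(1)]] g(3) by simp
  qed
  then show "h a = h' a" using y(2) by simp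
qed

lemma OAut_Bij: "h \<in> OAut \<Longrightarrow> h \<in> Bij U" unfolding OAut_iff by simp

lemma mult_O: "h \<in> OAut \<Longrightarrow> h' \<in> OAut \<Longrightarrow>
  h \<otimes>\<^bsub>aut_group orbital_language (orbital_structure L M)\<^esub> h' = compose U h h'"
  using OAut_Bij[of h] OAut_Bij[of h'] by (simp add: aut_group_def BijGroup_def orbital_structure_def)

lemma one_O: "\<one>\<^bsub>aut_group orbital_language (orbital_structure L M)\<^esub> = (\<lambda>x\<in>U. x)"
  by (simp add: aut_group_def BijGroup_def orbital_structure_def)

lemma conj_by_compose:
  assumes h: "h \<in> OAut" "h' \<in> OAut" and g: "g \<in> Aut"
  shows "conj_by (compose U h h') g = conj_by h (conj_by h' g)"
proof (rule conj_by_unique)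
  note hB = OAut_Bij[OF h(1)] OAut_Bij[OF h(2)]
  show "compose U h h' \<in> Bij U" using hB by (rule compose_Bij)
  show "conj_by h (conj_by h' g) \<in> extensional U" unfolding conj_by_def by simp
  fix x assume x: "x \<in> U"
  then show "conj_by h (conj_by h' g) (compose U h h' x) = compose U h h' (g x)"
    using conj_by_apply[OF hB(1) BijD(1)[OF hB(2) x]] conj_by_apply[OF hB(2) x] AutD(3)[OF g x]
    by (simp add: compose_def)
qed

lemma conj_by_mult:
  assumes h: "h \<in> OAut" and g: "g \<in> Aut" "g' \<in> Aut"
  shows "conj_by h (compose U g g') = compose U (conj_by h g) (conj_by h g')"
proof (rule conj_by_unique)
  note hB = OAut_Bij[OF h]
  show "h \<in> Bij U" by (rule hB)
  show "compose U (conj_by h g) (conj_by h g') \<in> extensional U" by simp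
  fix x assume x: "x \<in> U"
  then show "compose U (conj_by h g) (conj_by h g') (h x) = h (compose U g g' x)"
    using conj_by_apply[OF hB x] conj_by_apply[OF hB AutD(3)[OF g(2) x]] BijD(1)[OF hB x] by (simp add: compose_def)
qed

lemma conj_by_auto:
  assumes h: "h \<in> OAut"
  shows "restrict (conj_by h) Aut \<in> auto (aut_group L M)"
proof -
  note hB = OAut_Bij[OF h]
  have "restrict (conj_by h) Aut \<in> hom (aut_group L M) (aut_group L M)"
    unfolding hom_def using conj_by_mem[OF h] conj_by_mult[OF h] by (auto simp: mult_aut_group Aut_compose)
  moreover have "bij_betw (restrict (conj_by h) Aut) Aut Aut"
  proof -
    define h' where "h' = inv\<^bsub>aut_group orbital_language (orbital_structure L M)\<^esub> h"
    have "h' \<in> OAut" unfolding h'_def by (rule group.inv_closed[OF group_aut_group h])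
    moreover have "compose U h h' = (\<lambda>x\<in>U. x)" "compose U h' h = (\<lambda>x\<in>U. x)"
      using group.r_inv[OF group_aut_group h] group.l_inv[OF group_aut_group h]
      unfolding h'_def[symmetric] mult_O[OF h calculation] mult_O[OF calculation h] one_O by simp_all
    ultimately have h': "h' \<in> OAut" "compose U h h' = (\<lambda>x\<in>U. x)" "compose U h' h = (\<lambda>x\<in>U. x)"
      by simp_all
    have idc: "conj_by (\<lambda>x\<in>U. x) g = g" if "g \<in> Aut" for g
      using that AutD(1)[OF that] AutD(3)[OF that] by (intro conj_by_unique id_Bij) (simp_all add: Bij_def)
    show ?thesis
    proof (rule bij_betwI[where g = "conj_by h'"])
      show "restrict (conj_by h) Aut \<in> Aut \<rightarrow> Aut" "conj_by h' \<in> Aut \<rightarrow> Aut"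
        using conj_by_mem h h'(1) by auto
      show "conj_by h' (restrict (conj_by h) Aut g) = g" if "g \<in> Aut" for g
        using conj_by_compose[OF h'(1) h that] h'(3) idc that by simp
      show "restrict (conj_by h) Aut (conj_by h' g) = g" if "g \<in> Aut" for g
        using conj_by_compose[OF h h'(1) that] h'(2) idc that conj_by_mem[OF h'(1) that] by simp
    qed
  qed
  ultimately show ?thesis unfolding auto_def Bij_def by simp
qed

text \<open>The isomorphism is conjugation. For surjectivity,
  \<open>automorphism_conjugation\<close> supplies a permutation inducing a given automorphism, and
  \<open>OAutI\<close> shows that it preserves the orbital structure.\<close>

theorem AutoGroup_iso_orbital: "AutoGroup (aut_group L M) \<cong> aut_group orbital_language (orbital_structure L M)"
proof -
  let ?A = "AutoGroup (aut_group L M)" and ?O = "aut_group orbital_language (orbital_structure L M)"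
  define \<Psi> where "\<Psi> h = restrict (conj_by h) Aut" for h
  have autoB: "auto (aut_group L M) \<subseteq> Bij Aut" unfolding auto_def by blast
  have cA: "carrier ?A = auto (aut_group L M)" unfolding AutoGroup_def by simp
  have mA: "f \<otimes>\<^bsub>?A\<^esub> g = compose Aut f g" if "f \<in> auto (aut_group L M)" "g \<in> auto (aut_group L M)" for f g
    using subsetD[OF autoB that(1)] subsetD[OF autoB that(2)] unfolding AutoGroup_def BijGroup_def by simp
  have "\<Psi> \<in> hom ?O ?A"
    unfolding hom_def cA
  proof (intro CollectI conjI ballI)
    show "\<Psi> \<in> OAut \<rightarrow> auto (aut_group L M)" unfolding \<Psi>_def using conj_by_auto by blast
    fix h h' assume h: "h \<in> OAut" "h' \<in> OAut"
    have "restrict (conj_by (compose U h h')) Aut = compose Aut (\<Psi> h) (\<Psi> h')"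
      unfolding \<Psi>_def compose_def[of Aut] using conj_by_compose[OF h] conj_by_mem[OF h(2)]
      by (intro restrict_ext) simp
    then show "\<Psi> (h \<otimes>\<^bsub>?O\<^esub> h') = \<Psi> h \<otimes>\<^bsub>?A\<^esub> \<Psi> h'"
      using mA[OF conj_by_auto[OF h(1)] conj_by_auto[OF h(2)]] mult_O[OF h] unfolding \<Psi>_def by simp
  qed
  moreover have "bij_betw \<Psi> OAut (carrier ?A)"
    unfolding bij_betw_def
  proof
    show "inj_on \<Psi> OAut"
    proof (rule inj_onI)
      fix h h' assume h: "h \<in> OAut" "h' \<in> OAut" and eq: "\<Psi> h = \<Psi> h'"
      have "conj_by h g = conj_by h' g" if "g \<in> Aut" for g
        using fun_cong[OF eq, of g] that unfolding \<Psi>_def by simp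
      then show "h = h'" by (rule conj_by_inj[OF OAut_Bij[OF h(1)] OAut_Bij[OF h(2)]])
    qed
    show "\<Psi> ` OAut = carrier ?A"
      unfolding cA
    proof
      show "\<Psi> ` OAut \<subseteq> auto (aut_group L M)" unfolding \<Psi>_def using conj_by_auto by blast
      show "auto (aut_group L M) \<subseteq> \<Psi> ` OAut"
      proof
        fix \<theta> assume \<theta>: "\<theta> \<in> auto (aut_group L M)"
        then have bij: "bij_betw \<theta> Aut Aut" and ext: "\<theta> \<in> extensional Aut"
          and hm: "\<theta> \<in> hom (aut_group L M) (aut_group L M)" unfolding auto_def Bij_def by simp_all
        have \<theta>A: "\<theta> g \<in> Aut" if "g \<in> Aut" for g using bij that by (auto dest: bij_betwE)
        have "\<theta> (compose U f g) = compose U (\<theta> f) (\<theta> g)" if "f \<in> Aut" "g \<in> Aut" for f g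
          using hom_mult[OF hm that] mult_aut_group[OF that] mult_aut_group[OF \<theta>A[OF that(1)] \<theta>A[OF that(2)]] by simp
        from automorphism_conjugation[OF bij this] obtain h where
          h: "h \<in> Bij U" "\<forall>g\<in>Aut. \<forall>x\<in>U. \<theta> g (h x) = h (g x)" by blast
        have hO: "h \<in> OAut" by (rule OAutI[OF h(1) bij h(2)])
        have "\<Psi> h = \<theta>"
        proof (rule extensionalityI[of _ Aut])
          show "\<Psi> h \<in> extensional Aut" unfolding \<Psi>_def by simp
          fix g assume g: "g \<in> Aut"
          have "conj_by h g = \<theta> g"
            using h g AutD(1)[OF \<theta>A[OF g]] by (intro conj_by_unique) (auto simp: Bij_def)
          then show "\<Psi> h g = \<theta> g" using g unfolding \<Psi>_def by simp
        qed (rule ext)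
        then show "\<theta> \<in> \<Psi> ` OAut" using hO by blast
      qed
    qed
  qed
  ultimately have "?O \<cong> ?A" unfolding is_iso_def iso_def by blast
  then show ?thesis by (rule group.iso_sym[OF group_aut_group])
qed

end

theorem corollary1p5:
  fixes L :: "'r language" and M :: "('r, 'a) rel_structure"
  assumes "finite (symbols L)"
    and "is_structure L M"
    and "countable (universe M)"
    and "free_homogeneous L M"
  shows "AutoGroup (aut_group L M) \<cong> aut_group orbital_language (orbital_structure L M)"
proof -
  have "homogeneous L M" "has_free_amalgamation (age L M)"
    using assms(4) unfolding free_homogeneous_def is_fraisse_limit_def by auto
  then interpret free_structure L M using assms(2,3) by unfold_locales
  show ?thesis by (rule AutoGroup_iso_orbital)
qed

end
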